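(* Let $f$ be an element of $C_c^{\infty,1}(P_p\backslash G_p/G_p^\circ,\mathbf{Z}[1/p])[\tfrac{1}{1-\mathcal{S}_p}]$. Then $f=\mathcal{P}_{f,\mathrm{loc}}\cdot f_0$ and the Hecke operator $\mathcal{P}_{f,\mathrm{loc}}$ lies in the ideal $$\mathfrak{h}_p=\left(p-1,\ \mathcal{P}_p(1)'\right)\subseteq\mathcal{H}^\circ_{G_p}(\mathbf{Z}[1/p])[\tfrac{1}{1-\mathcal{S}_p}].$$ If moreover $f=(1-\mathcal{S}_p)\cdot f_1$ for some $f_1\in C_c^{\infty,1}(P_p\backslash G_p/G_p^\circ,\mathbf{Z}[1/p])$, then $\mathcal{P}_{f,\mathrm{loc}}$ lies in the ideal $(p-1,\mathcal{P}_p(1)')$ of $\mathcal{H}^\circ_{G_p}(\mathbf{Z}[1/p])$ (without inverting $1-\mathcal{S}_p$).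
   Context: Let $p$ be a prime, $H_p=\mathrm{GL}_2(\mathbf{Q}_p)$, $H_p^\circ=\mathrm{GL}_2(\mathbf{Z}_p)$, $G_p=H_p\times H_p$, $G_p^\circ=H_p^\circ\times H_p^\circ$, $H_p\subset G_p$ diagonally; Haar measure on $G_p$ gives $G_p^\circ$ volume $1$. $\mathcal{H}^\circ_{G_p}(\mathbf{Z}[1/p])$ is the ring of $\mathbf{Z}[1/p]$-valued compactly supported $G_p^\circ$-bi-invariant functions under convolution; $\theta'(\gamma)=\theta(\gamma^{-1})$. Hecke operators: $\mathcal{S}_{p,1}=\mathrm{ch}((pI,1)G_p^\circ)$, $\mathcal{S}_{p,2}=\mathrm{ch}((1,pI)G_p^\circ)$, $\mathcal{T}_{p,1}=\mathrm{ch}(G_p^\circ(\mathrm{diag}(p,1),1)G_p^\circ)$, $\mathcal{T}_{p,2}=\mathrm{ch}(G_p^\circ(1,\mathrm{diag}(p,1))G_p^\circ)$, $\mathcal{S}_p=\mathcal{S}_{p,1}\mathcal{S}_{p,2}$. $\mathcal{P}_p(x)=1-\tfrac1p\mathcal{T}_{p,1}\mathcal{T}_{p,2}x+(\tfrac1p\mathcal{S}_{p,1}\mathcal{T}_{p,2}^2+\tfrac1p\mathcal{S}_{p,2}\mathcal{T}_{p,1}^2-2\mathcal{S}_{p,1}\mathcal{S}_{p,2})x^2-\tfrac1p\mathcal{S}_{p,1}\mathcal{S}_{p,2}\mathcal{T}_{p,1}\mathcal{T}_{p,2}x^3+\mathcal{S}_{p,1}^2\mathcal{S}_{p,2}^2x^4$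 (the polynomial whose image under the spherical Hecke eigensystem of an unramified $\pi_{p,1}\boxtimes\pi_{p,2}$ at $x=p^{-s}$ is the inverse Rankin–Selberg $L$-factor). $P_p=\{\left(\begin{smallmatrix}a&b\\0&1\end{smallmatrix}\right)\}$ embedded diagonally in $G_p$; $C_c^\infty(P_p\backslash G_p/G_p^\circ,\mathbf{Z}[1/p])$: $\mathbf{Z}[1/p]$-valued, left $P_p$-, right $G_p^\circ$-invariant functions supported on finitely many $P_pgG_p^\circ$, with $(\theta\cdot f)(x)=\int\theta(g)f(xg)dg$. Let $Z_p$ be the center of $H_p$ and $T_p$ the diagonal torus of $H_p$, and $Z_p(T_p\times\{1\})=\{(zt,z):z\in Z_p,t\in T_p\}\subset G_p$. $C_c^{\infty,1}(P_p\backslash G_p/G_p^\circ,\mathbf{Z}[1/p])$ is the set of $f\in C_c^\infty(P_p\backslash G_p/G_p^\circ,\mathbf{Z}[1/p])$ taking values in $(p-1)\mathbf{Z}[1/p]$ on $Z_p(T_p\times\{1\})$. $C_c^{\infty,1}(\dots)[\tfrac{1}{1-\mathcal{S}_p}]$ is the $\mathcal{H}^\circ_{G_p}(\mathbf{Z}[1/p])[\tfrac{1}{1-\mathcal{S}_p}]$-submodule it generates inside the localization of $C_c^\infty(P_p\backslash G_p/G_p^\circ,\mathbf{Z}[1/p])$ at the powers of $1-\mathcal{S}_p$. With $f_0=\mathrm{ch}(P_pG_p^\circ)$, the localized module $C_c^\infty(P_p\backslash G_p/G_p^\circ)[\tfrac{1}{1-\mathcal{S}_p}]$ is free of rank one over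 $\mathcal{H}^\circ_{G_p}[\tfrac{1}{1-\mathcal{S}_p}]$ on $f_0$ (a result of the paper), and $\mathcal{P}_{f,\mathrm{loc}}$ denotes the unique element with $\mathcal{P}_{f,\mathrm{loc}}\cdot f_0=f$. *)

theory Defs
  imports
    "HOL-Analysis.Analysis"
    "HOL-Computational_Algebra.Polynomial_Factorial"
    "HOL-Algebra.Ideal"
    "HOL-Algebra.Module"
    "HOL-Algebra.Polynomials"
begin

section \<open>The fields of \<open>p\<close>-adic numbers\<close>

text \<open>
  The prime \<open>p\<close> is carried by a type variable: \<open>p = CARD('p)\<close>.
\<close>

class prime_card = finite +
  assumes prime_card: "Factorial_Ring.prime CARD('a)"

text \<open>
  \<open>\<int>\<^sub>p\<close> is the inverse limit of the rings \<open>\<int>/p\<^sup>n\<close>, the \<open>n\<close>-th component being represented by its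
  residue in \<open>{0..<p\<^sup>n}\<close>; \<open>\<rat>\<^sub>p\<close> is its field of fractions.
\<close>

typedef 'p padic_int =
  "{x :: nat \<Rightarrow> int. \<forall>n. x n mod int CARD('p::prime_card) ^ n = x n
      \<and> x (Suc n) mod int CARD('p) ^ n = x n}"
  by (rule exI[of _ "\<lambda>_. 0"]) simp

setup_lifting type_definition_padic_int

lemma mod_power_Suc_mod: "(a mod q ^ Suc n) mod q ^ n = a mod (q ^ n :: int)"
  by (rule mod_mod_cancel) (simp add: le_imp_power_dvd)

instantiation padic_int :: (prime_card) comm_ring_1
begin

lift_definition zero_padic_int :: "'a padic_int" is "\<lambda>_. 0" by simp

lift_definition one_padic_int :: "'a padic_int" is "\<lambda>n. 1 mod int CARD('a) ^ n"
  by (simp only: mod_power_Suc_mod mod_mod_trivial simp_thms)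

lift_definition plus_padic_int :: "'a padic_int \<Rightarrow> 'a padic_int \<Rightarrow> 'a padic_int"
  is "\<lambda>x y n. (x n + y n) mod int CARD('a) ^ n"
  by (simp only: mod_power_Suc_mod mod_mod_trivial simp_thms) (metis mod_add_eq)

lift_definition minus_padic_int :: "'a padic_int \<Rightarrow> 'a padic_int \<Rightarrow> 'a padic_int"
  is "\<lambda>x y n. (x n - y n) mod int CARD('a) ^ n"
  by (simp only: mod_power_Suc_mod mod_mod_trivial simp_thms) (metis mod_diff_eq)

lift_definition uminus_padic_int :: "'a padic_int \<Rightarrow> 'a padic_int"
  is "\<lambda>x n. (- x n) mod int CARD('a) ^ n"
  by (simp only: mod_power_Suc_mod mod_mod_trivial simp_thms) (metis mod_minus_eq)

lift_definition times_padic_int :: "'a padic_int \<Rightarrow> 'a padic_int \<Rightarrow> 'a padic_int"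
  is "\<lambda>x y n. (x n * y n) mod int CARD('a) ^ n"
  by (simp only: mod_power_Suc_mod mod_mod_trivial simp_thms) (metis mod_mult_eq)

instance
proof
  fix a b c :: "'a padic_int"
  show "a * b * c = a * (b * c)"
    by transfer (simp add: mod_mult_left_eq mod_mult_right_eq mult.assoc)
  show "a * b = b * a"
    by transfer (simp add: mult.commute)
  show "1 * a = a"
    by transfer (auto simp add: mod_mult_left_eq)
  show "a + b + c = a + (b + c)"
    by transfer (simp add: mod_add_left_eq mod_add_right_eq add.assoc)
  show "a + b = b + a"
    by transfer (simp add: add.commute)
  show "0 + a = a"
    by transfer auto
  show "- a + a = 0"
    by transfer (simp add: mod_add_left_eq)
  show "a - b = a + - b"
    by transfer (simp add: mod_add_right_eq)
  show "(a + b) * c = a * c + b * c"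
    by transfer (simp add: mod_mult_left_eq mod_add_eq distrib_right)
  show "(0 :: 'a padic_int) \<noteq> 1"
  proof transfer
    have "CARD('a) > 1"
      using prime_card[where ?'a = 'a] prime_gt_1_nat by blast
    then have "(1 :: int) mod int CARD('a) ^ 1 = 1" by simp
    then show "(\<lambda>_. 0) \<noteq> (\<lambda>n. (1 :: int) mod int CARD('a) ^ n)"
      by (metis zero_neq_one)
  qed
qed

end

lemma padic_int_coherent:
  fixes x :: "'p::prime_card padic_int"
  shows "Rep_padic_int x (m + k) mod int CARD('p) ^ m = Rep_padic_int x m"
proof (induction k)
  case 0
  show ?case using Rep_padic_int[of x] by simp
next
  case (Suc k)
  have "Rep_padic_int x (m + Suc k) mod int CARD('p) ^ (m + k) = Rep_padic_int x (m + k)"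
    using Rep_padic_int[of x] by simp
  moreover have "int CARD('p) ^ m dvd int CARD('p) ^ (m + k)"
    by (simp add: le_imp_power_dvd)
  ultimately show ?case
    using Suc.IH by (metis mod_mod_cancel)
qed

instance padic_int :: (prime_card) idom
proof
  fix a b :: "'a padic_int"
  let ?p = "int CARD('a)"
  have p: "prime_elem ?p"
    using prime_card[where ?'a = 'a] by simp
  have ex: "\<exists>n. Rep_padic_int x n \<noteq> 0" if "x \<noteq> 0" for x :: "'a padic_int"
    using that by (auto simp flip: Rep_padic_int_inject simp: zero_padic_int.rep_eq)
  assume "a \<noteq> 0" "b \<noteq> 0"
  then obtain m n where mn: "Rep_padic_int a m \<noteq> 0" "Rep_padic_int b n \<noteq> 0"
    using ex by blast
  show "a * b \<noteq> 0"
  proof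
    assume "a * b = 0"
    then have "Rep_padic_int (a * b) (m + n) = 0"
      by (simp add: zero_padic_int.rep_eq)
    then have dvd: "?p ^ (m + n) dvd Rep_padic_int a (m + n) * Rep_padic_int b (m + n)"
      by (auto simp: times_padic_int.rep_eq)
    have "?p ^ m dvd Rep_padic_int a (m + n) \<or> ?p ^ n dvd Rep_padic_int b (m + n)"
    proof (cases "m + n")
      case 0
      then show ?thesis by simp
    next
      case (Suc c)
      then have "?p ^ c dvd Rep_padic_int a (m + n) * Rep_padic_int b (m + n)"
        using dvd by (metis power_le_dvd le_add2 plus_1_eq_Suc)
      then show ?thesis
        using prime_elem_power_dvd_cases[OF _ Suc p] by blast
    qed
    then show False
      using mn padic_int_coherent[of a m n] padic_int_coherent[of b n m]
      by (auto simp: add.commute)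
  qed
qed

type_synonym 'p padic = "'p padic_int fract"


section \<open>General linear groups\<close>

typedef (overloaded) 'a gl2 = "{A :: 'a::comm_ring_1 ^ 2 ^ 2. invertible A}"
proof
  show "mat 1 \<in> {A :: 'a ^ 2 ^ 2. invertible A}"
    by (auto simp: invertible_def intro!: exI[of _ "mat 1"])
qed

setup_lifting type_definition_gl2

lemma matrix_inv_both:
  fixes A :: "'a::comm_ring_1 ^ 'n ^ 'n"
  assumes "invertible A"
  shows "A ** matrix_inv A = mat 1" "matrix_inv A ** A = mat 1"
  using assms someI_ex[of "\<lambda>B. A ** B = mat 1 \<and> B ** A = mat 1"]
  unfolding invertible_def matrix_inv_def by auto

instantiation gl2 :: (comm_ring_1) "{monoid_mult, inverse}"
begin

lift_definition one_gl2 :: "'a gl2" is "mat 1"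
  by (auto simp: invertible_def intro!: exI[of _ "mat 1"])

lift_definition times_gl2 :: "'a gl2 \<Rightarrow> 'a gl2 \<Rightarrow> 'a gl2" is "\<lambda>A B. A ** B"
proof -
  fix A B :: "'a ^ 2 ^ 2"
  assume "invertible A" "invertible B"
  then obtain A' B' where
    "A ** A' = mat 1" "A' ** A = mat 1" "B ** B' = mat 1" "B' ** B = mat 1"
    unfolding invertible_def by blast
  then have "(A ** B) ** (B' ** A') = mat 1" "(B' ** A') ** (A ** B) = mat 1"
    by (metis matrix_mul_assoc matrix_mul_rid)+
  then show "invertible (A ** B)"
    unfolding invertible_def by blast
qed

lift_definition inverse_gl2 :: "'a gl2 \<Rightarrow> 'a gl2" is matrix_inv
  using matrix_inv_both unfolding invertible_def by blast

definition divide_gl2 :: "'a gl2 \<Rightarrow> 'a gl2 \<Rightarrow> 'a gl2" where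
  "divide_gl2 A B = A * inverse B"

instance
  by standard (transfer; simp add: matrix_mul_assoc)+

end

lemma gl2_inverse [simp]:
  fixes A :: "'a::comm_ring_1 gl2"
  shows "A * inverse A = 1" "inverse A * A = 1"
  by (transfer; simp add: matrix_inv_both)+

instantiation prod :: ("{monoid_mult, inverse}", "{monoid_mult, inverse}") "{monoid_mult, inverse}"
begin

definition one_prod :: "'a \<times> 'b" where
  "one_prod = (1, 1)"

definition times_prod :: "'a \<times> 'b \<Rightarrow> 'a \<times> 'b \<Rightarrow> 'a \<times> 'b" where
  "times_prod x y = (fst x * fst y, snd x * snd y)"

definition inverse_prod :: "'a \<times> 'b \<Rightarrow> 'a \<times> 'b" where
  "inverse_prod x = (inverse (fst x), inverse (snd x))"

definition divide_prod :: "'a \<times> 'b \<Rightarrow> 'a \<times> 'b \<Rightarrow> 'a \<times> 'b" where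
  "divide_prod x y = x * inverse y"

instance
  by standard (auto simp: one_prod_def times_prod_def mult.assoc)

end

text \<open>Meaningful only when \<open>a * d - b * c\<close> is a unit.\<close>

definition gl2_of :: "'a::comm_ring_1 \<Rightarrow> 'a \<Rightarrow> 'a \<Rightarrow> 'a \<Rightarrow> 'a gl2" where
  "gl2_of a b c d = Abs_gl2 (vector [vector [a, b], vector [c, d]])"

type_synonym 'p Hp = "'p padic gl2"
type_synonym 'p Gp = "'p Hp \<times> 'p Hp"

definition Hp0 :: "'p::prime_card Hp set" where
  "Hp0 = {h. \<exists>A :: 'p padic_int gl2. \<forall>i j. Rep_gl2 h $ i $ j = to_fract (Rep_gl2 A $ i $ j)}"

definition Gp0 :: "'p::prime_card Gp set" where
  "Gp0 = Hp0 \<times> Hp0"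

definition mirabolic :: "'p::prime_card Gp set" where
  "mirabolic = {(u, u) | u. \<exists>a b. a \<noteq> 0 \<and> u = gl2_of a b 0 1}"

text \<open>The set \<open>Z\<^sub>p(T\<^sub>p \<times> {1}) = {(z t, z)}\<close>.\<close>

definition centre_torus :: "'p::prime_card Gp set" where
  "centre_torus = {(gl2_of z 0 0 z * gl2_of a 0 0 d, gl2_of z 0 0 z) | z a d.
     z \<noteq> 0 \<and> a \<noteq> 0 \<and> d \<noteq> 0}"


section \<open>Topology and Haar measure\<close>

text \<open>
  The \<open>p\<close>-adic topology on \<open>GL\<^sub>2(\<rat>\<^sub>p)\<close>: the matrices congruent to \<open>g\<close> entrywise modulo
  \<open>p\<^sup>n \<int>\<^sub>p\<close> form a neighbourhood basis of \<open>g\<close>.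
\<close>

definition gl2_ball :: "nat \<Rightarrow> 'p::prime_card Hp \<Rightarrow> 'p Hp set" where
  "gl2_ball n g = {h. \<forall>i j. \<exists>a.
     Rep_gl2 h $ i $ j - Rep_gl2 g $ i $ j = of_nat CARD('p) ^ n * to_fract a}"

definition Hp_topology :: "'p::prime_card Hp topology" where
  "Hp_topology = topology (\<lambda>U. \<forall>g\<in>U. \<exists>n. gl2_ball n g \<subseteq> U)"

lemma gl2_ball_antimono:
  assumes "m \<le> n"
  shows "gl2_ball n g \<subseteq> gl2_ball m (g :: 'p::prime_card Hp)"
proof
  fix h assume h: "h \<in> gl2_ball n g"
  have "\<exists>a. Rep_gl2 h $ i $ j - Rep_gl2 g $ i $ j = of_nat CARD('p) ^ m * to_fract a" for i j
  proof -
    obtain a :: "'p padic_int" where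
      a: "Rep_gl2 h $ i $ j - Rep_gl2 g $ i $ j = of_nat CARD('p) ^ n * to_fract a"
      using h unfolding gl2_ball_def by blast
    have of_nat: "to_fract (of_nat k :: 'p padic_int) = of_nat k" for k
      by (induction k) simp_all
    have pow: "to_fract ((of_nat k :: 'p padic_int) ^ l) = of_nat k ^ l" for k l
      by (induction l) (simp_all add: of_nat)
    have "of_nat CARD('p) ^ n * to_fract a =
        of_nat CARD('p) ^ m * to_fract (of_nat CARD('p) ^ (n - m) * a)"
      using assms by (simp only: to_fract_mult pow mult.assoc [symmetric] power_add [symmetric]) simp
    then show ?thesis
      using a by metis
  qed
  then show "h \<in> gl2_ball m g"
    unfolding gl2_ball_def by blast
qed

lemma openin_Hp_topology:
  "openin Hp_topology U \<longleftrightarrow> (\<forall>g\<in>U. \<exists>n. gl2_ball n g \<subseteq> (U :: 'p::prime_card Hp set))"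
proof -
  have "istopology (\<lambda>U :: 'p Hp set. \<forall>g\<in>U. \<exists>n. gl2_ball n g \<subseteq> U)"
    unfolding istopology_def
  proof (intro conjI allI impI ballI)
    fix S T :: "'p Hp set" and g
    assume "\<forall>g\<in>S. \<exists>n. gl2_ball n g \<subseteq> S" "\<forall>g\<in>T. \<exists>n. gl2_ball n g \<subseteq> T" "g \<in> S \<inter> T"
    then obtain m n where "gl2_ball m g \<subseteq> S" "gl2_ball n g \<subseteq> T" by blast
    then have "gl2_ball (max m n) g \<subseteq> S \<inter> T"
      using gl2_ball_antimono[of m "max m n" g] gl2_ball_antimono[of n "max m n" g] by auto
    then show "\<exists>n. gl2_ball n g \<subseteq> S \<inter> T" ..
  next
    fix K :: "'p Hp set set" and g
    assume "\<forall>S\<in>K. \<forall>g\<in>S. \<exists>n. gl2_ball n g \<subseteq> S" "g \<in> \<Union>K"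
    then show "\<exists>n. gl2_ball n g \<subseteq> \<Union>K" by (meson Sup_upper UnionE subset_trans)
  qed
  then show ?thesis
    by (simp add: Hp_topology_def)
qed

definition Gp_topology :: "'p::prime_card Gp topology" where
  "Gp_topology = prod_topology Hp_topology Hp_topology"

text \<open>
  The Haar measure on the Borel sets of \<open>G\<^sub>p\<close>. It is unique, and automatically finite on compact
  sets, because the compact open subgroup \<open>Gp0\<close> has measure \<open>1\<close>.
\<close>

definition haar_measure :: "'p::prime_card Gp measure \<Rightarrow> bool" where
  "haar_measure \<mu> \<longleftrightarrow>
     space \<mu> = UNIV \<and> sets \<mu> = sigma_sets UNIV {U. openin Gp_topology U} \<and>
     (\<forall>g. \<forall>A\<in>sets \<mu>. emeasure \<mu> ((\<lambda>x. g * x) ` A) = emeasure \<mu> A) \<and>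
     emeasure \<mu> Gp0 = 1"


section \<open>Hecke algebra and universal module\<close>

text \<open>\<open>\<int>[1/p]\<close> as a subring of the reals, so that integrals can be Lebesgue integrals.\<close>

definition Z_inv :: "nat \<Rightarrow> real set" where
  "Z_inv p = {of_int a / of_nat p ^ k | a k. True}"

definition convolution :: "'p::prime_card Gp measure \<Rightarrow> ('p Gp \<Rightarrow> real) \<Rightarrow> ('p Gp \<Rightarrow> real) \<Rightarrow> 'p Gp \<Rightarrow> real" where
  "convolution \<mu> \<theta> \<eta> = (\<lambda>x. LINT g|\<mu>. \<theta> g * \<eta> (inverse g * x))"

definition hecke :: "'p::prime_card Gp measure \<Rightarrow> ('p Gp \<Rightarrow> real) ring" where
  "hecke \<mu> = \<lparr>
     carrier = {\<theta>. range \<theta> \<subseteq> Z_inv CARD('p)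
       \<and> (\<forall>k\<in>Gp0. \<forall>l\<in>Gp0. \<forall>g. \<theta> (k * g * l) = \<theta> g)
       \<and> compactin Gp_topology (Gp_topology closure_of {g. \<theta> g \<noteq> 0})},
     mult = convolution \<mu>,
     one = indicat_real Gp0,
     zero = (\<lambda>_. 0),
     add = (\<lambda>\<theta> \<eta> g. \<theta> g + \<eta> g)\<rparr>"

definition hecke_dual :: "('p::prime_card Gp \<Rightarrow> real) \<Rightarrow> 'p Gp \<Rightarrow> real" where
  "hecke_dual \<theta> = (\<lambda>g. \<theta> (inverse g))"

definition hecke_action :: "'p::prime_card Gp measure \<Rightarrow> ('p Gp \<Rightarrow> real) \<Rightarrow> ('p Gp \<Rightarrow> real) \<Rightarrow> 'p Gp \<Rightarrow> real" where
  "hecke_action \<mu> \<theta> f = (\<lambda>x. LINT g|\<mu>. \<theta> g * f (x * g))"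

text \<open>
  The module \<open>C\<^sub>c\<^sup>\<infinity>(P\<^sub>p \ G\<^sub>p / G\<^sub>p\<^sup>0, \<int>[1/p])\<close>. Only the additive fields and \<open>smult\<close> of the record
  type of modules are meaningful.
\<close>

definition Cc :: "'p::prime_card Gp measure \<Rightarrow> ('p Gp \<Rightarrow> real, 'p Gp \<Rightarrow> real) module" where
  "Cc \<mu> = \<lparr>
     carrier = {f. range f \<subseteq> Z_inv CARD('p)
       \<and> (\<forall>u\<in>mirabolic. \<forall>k\<in>Gp0. \<forall>g. f (u * g * k) = f g)
       \<and> (\<exists>S. finite S \<and> {g. f g \<noteq> 0} \<subseteq> {u * s * k | u s k. u \<in> mirabolic \<and> s \<in> S \<and> k \<in> Gp0})},
     mult = undefined,
     one = undefined,
     zero = (\<lambda>_. 0),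
     add = (\<lambda>f h g. f g + h g),
     smult = hecke_action \<mu>\<rparr>"

definition Cc1 :: "'p::prime_card Gp measure \<Rightarrow> ('p Gp \<Rightarrow> real) set" where
  "Cc1 \<mu> = {f \<in> carrier (Cc \<mu>).
     \<forall>g\<in>centre_torus. f g \<in> (\<lambda>x. (of_nat CARD('p) - 1) * x) ` Z_inv CARD('p)}"

definition f0 :: "'p::prime_card Gp \<Rightarrow> real" where
  "f0 = indicat_real {u * k | u k. u \<in> mirabolic \<and> k \<in> Gp0}"


section \<open>Hecke operators\<close>

definition S1 :: "'p::prime_card Gp \<Rightarrow> real" where
  "S1 = (let p = of_nat CARD('p) in indicat_real {(gl2_of p 0 0 p, 1) * k | k. k \<in> Gp0})"

definition S2 :: "'p::prime_card Gp \<Rightarrow> real" where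
  "S2 = (let p = of_nat CARD('p) in indicat_real {(1, gl2_of p 0 0 p) * k | k. k \<in> Gp0})"

definition T1 :: "'p::prime_card Gp \<Rightarrow> real" where
  "T1 = (let p = of_nat CARD('p) in
     indicat_real {k * (gl2_of p 0 0 1, 1) * l | k l. k \<in> Gp0 \<and> l \<in> Gp0})"

definition T2 :: "'p::prime_card Gp \<Rightarrow> real" where
  "T2 = (let p = of_nat CARD('p) in
     indicat_real {k * (1, gl2_of p 0 0 1) * l | k l. k \<in> Gp0 \<and> l \<in> Gp0})"

text \<open>The image of a scalar in the Hecke algebra.\<close>

definition hecke_const :: "real \<Rightarrow> 'p::prime_card Gp \<Rightarrow> real" where
  "hecke_const c = (\<lambda>g. c * indicat_real Gp0 g)"

text \<open>
  The polynomial \<open>\<P>\<^sub>p\<close> over the Hecke algebra, as a list of coefficients starting with the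
  leading one (the convention of \<^theory>\<open>HOL-Algebra.Polynomials\<close>).
\<close>

definition hecke_poly :: "'p::prime_card Gp measure \<Rightarrow> ('p Gp \<Rightarrow> real) list" where
  "hecke_poly \<mu> = (let R = hecke \<mu>; q = hecke_const (1 / of_nat CARD('p)) in
     [ S1 [^]\<^bsub>R\<^esub> (2::nat) \<otimes>\<^bsub>R\<^esub> S2 [^]\<^bsub>R\<^esub> (2::nat),
       \<ominus>\<^bsub>R\<^esub> (q \<otimes>\<^bsub>R\<^esub> S1 \<otimes>\<^bsub>R\<^esub> S2 \<otimes>\<^bsub>R\<^esub> T1 \<otimes>\<^bsub>R\<^esub> T2),
       q \<otimes>\<^bsub>R\<^esub> S1 \<otimes>\<^bsub>R\<^esub> T2 [^]\<^bsub>R\<^esub> (2::nat) \<oplus>\<^bsub>R\<^esub> q \<otimes>\<^bsub>R\<^esub> S2 \<otimes>\<^bsub>R\<^esub> T1 [^]\<^bsub>R\<^esub> (2::nat)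
         \<ominus>\<^bsub>R\<^esub> hecke_const 2 \<otimes>\<^bsub>R\<^esub> S1 \<otimes>\<^bsub>R\<^esub> S2,
       \<ominus>\<^bsub>R\<^esub> (q \<otimes>\<^bsub>R\<^esub> T1 \<otimes>\<^bsub>R\<^esub> T2),
       \<one>\<^bsub>R\<^esub> ])"

definition hecke_poly_at_1 :: "'p::prime_card Gp measure \<Rightarrow> 'p Gp \<Rightarrow> real" where
  "hecke_poly_at_1 \<mu> = ring.eval (hecke \<mu>) (hecke_poly \<mu>) \<one>\<^bsub>hecke \<mu>\<^esub>"

definition one_minus_S :: "'p::prime_card Gp measure \<Rightarrow> 'p Gp \<Rightarrow> real" where
  "one_minus_S \<mu> = \<one>\<^bsub>hecke \<mu>\<^esub> \<ominus>\<^bsub>hecke \<mu>\<^esub> (S1 \<otimes>\<^bsub>hecke \<mu>\<^esub> S2)"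


section \<open>Localization at the powers of an element\<close>

text \<open>The pair \<open>(m, k)\<close> stands for the fraction \<open>m / s\<^sup>k\<close>.\<close>

definition loc_rel ::
  "('a, 'c) ring_scheme \<Rightarrow> ('a, 'b, 'd) module_scheme \<Rightarrow> 'a \<Rightarrow> (('b \<times> nat) \<times> ('b \<times> nat)) set" where
  "loc_rel R M s = {((m, k), (n, l)). m \<in> carrier M \<and> n \<in> carrier M \<and>
     (\<exists>j::nat. s [^]\<^bsub>R\<^esub> j \<odot>\<^bsub>M\<^esub> (s [^]\<^bsub>R\<^esub> l \<odot>\<^bsub>M\<^esub> m) = s [^]\<^bsub>R\<^esub> j \<odot>\<^bsub>M\<^esub> (s [^]\<^bsub>R\<^esub> k \<odot>\<^bsub>M\<^esub> n))}"

definition loc_frac ::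
  "('a, 'c) ring_scheme \<Rightarrow> ('a, 'b, 'd) module_scheme \<Rightarrow> 'a \<Rightarrow> 'b \<Rightarrow> nat \<Rightarrow> ('b \<times> nat) set" where
  "loc_frac R M s m k = loc_rel R M s `` {(m, k)}"

definition loc_module ::
  "('a, 'c) ring_scheme \<Rightarrow> ('a, 'b, 'd) module_scheme \<Rightarrow> 'a \<Rightarrow> (('a \<times> nat) set, ('b \<times> nat) set) module" where
  "loc_module R M s = \<lparr>
     carrier = (carrier M \<times> UNIV) // loc_rel R M s,
     mult = undefined,
     one = undefined,
     zero = loc_frac R M s \<zero>\<^bsub>M\<^esub> 0,
     add = (\<lambda>A B. \<Union>(m, k)\<in>A. \<Union>(n, l)\<in>B.
       loc_frac R M s ((s [^]\<^bsub>R\<^esub> l \<odot>\<^bsub>M\<^esub> m) \<oplus>\<^bsub>M\<^esub> (s [^]\<^bsub>R\<^esub> k \<odot>\<^bsub>M\<^esub> n)) (k + l)),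
     smult = (\<lambda>A B. \<Union>(a, k)\<in>A. \<Union>(m, l)\<in>B. loc_frac R M s (a \<odot>\<^bsub>M\<^esub> m) (k + l))\<rparr>"

definition regular_module :: "('a, 'c) ring_scheme \<Rightarrow> ('a, 'a) module" where
  "regular_module R = \<lparr>carrier = carrier R, mult = mult R, one = one R, zero = zero R, add = add R,
     smult = mult R\<rparr>"

definition loc_ring :: "('a, 'c) ring_scheme \<Rightarrow> 'a \<Rightarrow> ('a \<times> nat) set ring" where
  "loc_ring R s = (let L = loc_module R (regular_module R) s in
     \<lparr>carrier = carrier L, mult = smult L, one = loc_frac R (regular_module R) s \<one>\<^bsub>R\<^esub> 0,
      zero = zero L, add = add L\<rparr>)"

definition generated_submodule ::
  "('a, 'c) ring_scheme \<Rightarrow> ('a, 'b, 'd) module_scheme \<Rightarrow> 'b set \<Rightarrow> 'b set" where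
  "generated_submodule R M A = \<Inter>{N. submodule N R M \<and> A \<subseteq> N}"


section \<open>The localized Hecke algebra and its module\<close>

definition hecke_loc :: "'p::prime_card Gp measure \<Rightarrow> (('p Gp \<Rightarrow> real) \<times> nat) set ring" where
  "hecke_loc \<mu> = loc_ring (hecke \<mu>) (one_minus_S \<mu>)"

definition to_hecke_loc :: "'p::prime_card Gp measure \<Rightarrow> ('p Gp \<Rightarrow> real) \<Rightarrow> (('p Gp \<Rightarrow> real) \<times> nat) set" where
  "to_hecke_loc \<mu> \<theta> = loc_frac (hecke \<mu>) (regular_module (hecke \<mu>)) (one_minus_S \<mu>) \<theta> 0"

definition Cc_loc :: "'p::prime_card Gp measure \<Rightarrow>
    ((('p Gp \<Rightarrow> real) \<times> nat) set, (('p Gp \<Rightarrow> real) \<times> nat) set) module" where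
  "Cc_loc \<mu> = loc_module (hecke \<mu>) (Cc \<mu>) (one_minus_S \<mu>)"

definition to_Cc_loc :: "'p::prime_card Gp measure \<Rightarrow> ('p Gp \<Rightarrow> real) \<Rightarrow> (('p Gp \<Rightarrow> real) \<times> nat) set" where
  "to_Cc_loc \<mu> f = loc_frac (hecke \<mu>) (Cc \<mu>) (one_minus_S \<mu>) f 0"

definition Cc1_loc :: "'p::prime_card Gp measure \<Rightarrow> (('p Gp \<Rightarrow> real) \<times> nat) set set" where
  "Cc1_loc \<mu> = generated_submodule (hecke_loc \<mu>) (Cc_loc \<mu>) (to_Cc_loc \<mu> ` Cc1 \<mu>)"

text \<open>
  \<open>\<P>\<^sub>f\<^sub>,\<^sub>l\<^sub>o\<^sub>c\<close>; the description is proper because the localized module is free of rank one on \<open>f0\<close>.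
\<close>

definition P_loc :: "'p::prime_card Gp measure \<Rightarrow> (('p Gp \<Rightarrow> real) \<times> nat) set \<Rightarrow>
    (('p Gp \<Rightarrow> real) \<times> nat) set" where
  "P_loc \<mu> f = (THE P. P \<in> carrier (hecke_loc \<mu>) \<and> P \<odot>\<^bsub>Cc_loc \<mu>\<^esub> to_Cc_loc \<mu> f0 = f)"

text \<open>Generators of the ideals \<open>(p - 1, \<P>\<^sub>p(1)')\<close>.\<close>

definition ideal_gens :: "'p::prime_card Gp measure \<Rightarrow> ('p Gp \<Rightarrow> real) set" where
  "ideal_gens \<mu> = {hecke_const (of_nat CARD('p) - 1), hecke_dual (hecke_poly_at_1 \<mu>)}"

end

theory Submission
  imports Defs "HOL-Number_Theory.Cong"
begin

text \<open>
  A point of \<open>G\<^sub>p / G\<^sub>p\<^sup>0\<close> is a pair of lattices in the plane, and \<open>P\<^sub>p\<close>-orbits of such pairs are classified by four integers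
  \<open>(n, m, i, j)\<close>: two scaling factors, and the distances \<open>i\<close>, \<open>j\<close> of the two vertices of the tree to
  the point where their rays to the end fixed by \<open>P\<^sub>p\<close> meet. The orbits with \<open>i = 0\<close> or \<open>j = 0\<close> are those that meet
  \<open>Z\<^sub>p(T\<^sub>p \<times> {1})\<close>. Let \<open>e\<^sub>i\<^sub>j\<close> be the indicator function of the orbit \<open>(0, 0, i, j)\<close>. Recursions from
  \<open>\<T>\<^sub>p\<^sub>,\<^sub>1\<close> and \<open>\<T>\<^sub>p\<^sub>,\<^sub>2\<close> show that \<open>(1 - \<S>\<^sub>p) \<cdot> e\<^sub>i\<^sub>0\<close> and \<open>(1 - \<S>\<^sub>p) \<cdot> e\<^sub>0\<^sub>j\<close> are Hecke translates of \<open>f\<^sub>0 = e\<^sub>0\<^sub>0\<close>,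
  and, starting from the identity
  \<open>(1 - \<S>\<^sub>p) \<cdot> e\<^sub>1\<^sub>1 = p \<S>\<^sub>p \<P>\<^sub>p(1)' \<cdot> f\<^sub>0 + (p - 1) (1 - \<S>\<^sub>p) \<cdot> f\<^sub>0\<close>, that
  \<open>(1 - \<S>\<^sub>p) \<cdot> e\<^sub>i\<^sub>j\<close> lies in \<open>(p - 1, \<P>\<^sub>p(1)') \<cdot> f\<^sub>0\<close> for \<open>i, j \<ge> 1\<close>. The integrality condition on
  \<open>f\<close> supplies the factor \<open>p - 1\<close> on the remaining orbits, so \<open>(1 - \<S>\<^sub>p) \<cdot> f\<close> lies in \<open>(p - 1, \<P>\<^sub>p(1)') \<cdot> f\<^sub>0\<close>.
  The coefficient is unique because \<open>f\<^sub>0\<close> has no torsion, which is seen on the part of a Hecke operator of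
  maximal distance.
\<close>

section \<open>Valuations\<close>

text \<open>The factor 1 - S_p is the determinant of a linear system: T_1 f0 and T_2 f0 are sums of
  shifted copies of e_10 and e_01, and eliminating one of the two leaves the other minus its shift
  by S_p. The factor p - 1 counts neighbours: a vertex has p neighbours away from the end, and if
  the other vertex lies in that direction, one of them leads towards it. So the recursion from e_1j
  to e_2j involves (p - 1) e_0j for j > 0, but p e_00 on the axis j = 0, and the ideal closes up on
  the interior orbits as soon as e_11 is reached. The integrals are tamed by the open compact
  subgroup \<open>Gp0\<close> of measure one: compact support means finitely many cosets, and
  integrals are finite sums. Fractions have powers of the central element 1 - S_p as denominators,
  and ideals are built as left ideals inside the two-sided ones. Absence of torsion serves twice: it
  makes the coefficient of f0 unique, and it carries the regularity of 1 - S_p, which is visible on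
  functions supported on finitely many orbits, over to the Hecke algebra.\<close>

lemma of_nat_padic_int_rep:
  "Rep_padic_int (of_nat k :: 'p::prime_card padic_int) n = int k mod int CARD('p) ^ n"
  by (induction k)
    (simp_all add: zero_padic_int.rep_eq one_padic_int.rep_eq plus_padic_int.rep_eq mod_add_eq)

lemma card_gt_1: "CARD('p::prime_card) > 1"
  using prime_card[where ?'a = 'p] prime_gt_1_nat by blast

lemma Rep_padic_int_range:
  fixes a :: "'p::prime_card padic_int"
  shows "0 \<le> Rep_padic_int a n" "Rep_padic_int a n < int CARD('p) ^ n"
    "Rep_padic_int a n mod int CARD('p) ^ n = Rep_padic_int a n"
proof -
  show *: "Rep_padic_int a n mod int CARD('p) ^ n = Rep_padic_int a n"
    using Rep_padic_int[of a] by simp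
  have "int CARD('p) ^ n > 0" using card_gt_1[where ?'p = 'p] by simp
  then show "0 \<le> Rep_padic_int a n" "Rep_padic_int a n < int CARD('p) ^ n"
    using pos_mod_sign[of "int CARD('p) ^ n" "Rep_padic_int a n"]
      pos_mod_bound[of "int CARD('p) ^ n" "Rep_padic_int a n"] * by simp_all
qed

text \<open>If the \<open>n\<close>-th component vanishes, coherence makes every later component
  divisible by p^n, and dividing the sequence shifted by \<open>n\<close> by p^n gives the
  quotient.\<close>

lemma padic_int_dvd_power_iff:
  fixes a :: "'p::prime_card padic_int"
  shows "of_nat CARD('p) ^ n dvd a \<longleftrightarrow> Rep_padic_int a n = 0"
proof
  assume "of_nat CARD('p) ^ n dvd a"
  then obtain b where b: "a = of_nat (CARD('p) ^ n) * b" by (auto elim: dvdE)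
  show "Rep_padic_int a n = 0"
    unfolding b times_padic_int.rep_eq of_nat_padic_int_rep by simp
next
  let ?q = "int CARD('p)"
  assume 0: "Rep_padic_int a n = 0"
  have q: "?q > 0" using card_gt_1[where ?'p = 'p] by simp
  define u where "u k = Rep_padic_int a (n + k) div ?q ^ n" for k
  have dvd: "?q ^ n dvd Rep_padic_int a (n + k)" for k
    using padic_int_coherent[of a n k] 0 by auto
  have u: "?q ^ n * u k = Rep_padic_int a (n + k)" for k
    unfolding u_def using dvd by simp
  have coh: "u k mod ?q ^ k = u k \<and> u (Suc k) mod ?q ^ k = u k" for k
  proof
    have "?q ^ n * (u k mod ?q ^ k) = (?q ^ n * u k) mod (?q ^ n * ?q ^ k)"
      by (rule mult_mod_right)
    also have "\<dots> = ?q ^ n * u k"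
      unfolding u power_add[symmetric] by (rule Rep_padic_int_range)
    finally show "u k mod ?q ^ k = u k" using q by simp
    have "?q ^ n * (u (Suc k) mod ?q ^ k) = (?q ^ n * u (Suc k)) mod (?q ^ n * ?q ^ k)"
      by (rule mult_mod_right)
    also have "\<dots> = ?q ^ n * u k"
      unfolding u power_add[symmetric] using padic_int_coherent[of a "n + k" 1] by simp
    finally show "u (Suc k) mod ?q ^ k = u k" using q by simp
  qed
  have rep: "Rep_padic_int (Abs_padic_int u :: 'p padic_int) = u"
    by (rule Abs_padic_int_inverse) (use coh in blast)
  have "a = of_nat (CARD('p) ^ n) * Abs_padic_int u"
    unfolding Rep_padic_int_inject[symmetric]
  proof
    fix k
    have "Rep_padic_int (of_nat (CARD('p) ^ n) * Abs_padic_int u :: 'p padic_int) k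
        = (?q ^ n * u k) mod ?q ^ k"
      unfolding times_padic_int.rep_eq rep of_nat_padic_int_rep
      by (simp only: of_nat_power mod_mult_left_eq)
    also have "\<dots> = Rep_padic_int a k"
      unfolding u using padic_int_coherent[of a k n] by (simp add: add.commute)
    finally show "Rep_padic_int a k
      = Rep_padic_int (of_nat (CARD('p) ^ n) * Abs_padic_int u :: 'p padic_int) k" ..
  qed
  then show "of_nat CARD('p) ^ n dvd a" by simp
qed

text \<open>A unit modulo p is a unit modulo every p^k. Inverses modulo p^k are unique, so the
  chosen ones reduce to each other and form an element of the inverse limit.\<close>

lemma padic_int_unit_iff:
  fixes a :: "'p::prime_card padic_int"
  shows "a dvd 1 \<longleftrightarrow> Rep_padic_int a 1 \<noteq> 0"
proof
  assume "a dvd 1"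
  then obtain b where "1 = a * b" by (auto elim: dvdE)
  then have "Rep_padic_int (1 :: 'p padic_int) 1 = Rep_padic_int (a * b) 1" by simp
  then show "Rep_padic_int a 1 \<noteq> 0"
    using card_gt_1[where ?'p = 'p] by (auto simp: one_padic_int.rep_eq times_padic_int.rep_eq)
next
  let ?q = "int CARD('p)"
  assume a: "Rep_padic_int a 1 \<noteq> 0"
  have q: "?q > 0" using card_gt_1[where ?'p = 'p] by simp
  have cop: "coprime (Rep_padic_int a k) (?q ^ k)" for k
  proof (cases k)
    case (Suc l)
    have "\<not> ?q dvd Rep_padic_int a k"
    proof
      assume "?q dvd Rep_padic_int a k"
      then have "Rep_padic_int a (1 + l) mod ?q ^ 1 = 0" unfolding Suc by simp
      with a padic_int_coherent[of a 1 l] show False by simp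
    qed
    moreover have "Factorial_Ring.prime ?q"
      using prime_card[where ?'a = 'p] by simp
    ultimately have "coprime ?q (Rep_padic_int a k)"
      by (rule prime_imp_coprime[rotated])
    then have "coprime (Rep_padic_int a k) ?q"
      by (simp only: coprime_commute)
    then show ?thesis by (rule coprime_power_right_iff[THEN iffD2, OF disjI1])
  qed simp
  have "\<exists>b. [Rep_padic_int a k * b = 1] (mod ?q ^ k) \<and> b mod ?q ^ k = b" for k
  proof -
    obtain b where "[Rep_padic_int a k * b = 1] (mod ?q ^ k)"
      using cong_solve_coprime_int[OF cop] by blast
    then show ?thesis
      by (intro exI[of _ "b mod ?q ^ k"]) (simp add: cong_def mod_mult_right_eq)
  qed
  then obtain v where v: "[Rep_padic_int a k * v k = 1] (mod ?q ^ k)" "v k mod ?q ^ k = v k" for k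
    by metis
  have "v (Suc k) mod ?q ^ k = v k" for k
  proof -
    have "[Rep_padic_int a (Suc k) * v (Suc k) = 1] (mod ?q ^ k)"
      using v(1)[of "Suc k"] by (rule cong_dvd_modulus) (simp add: le_imp_power_dvd)
    moreover have "[Rep_padic_int a (Suc k) = Rep_padic_int a k] (mod ?q ^ k)"
      using padic_int_coherent[of a k 1] by (simp add: cong_def Rep_padic_int_range(3))
    ultimately have "[Rep_padic_int a k * v (Suc k) = 1] (mod ?q ^ k)"
      by (meson cong_scalar_right cong_sym cong_trans)
    then have "[Rep_padic_int a k * v (Suc k) = Rep_padic_int a k * v k] (mod ?q ^ k)"
      using v(1)[of k] by (meson cong_sym cong_trans)
    then have "[v (Suc k) = v k] (mod ?q ^ k)"
      using cop by (simp add: cong_mult_lcancel)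
    then show ?thesis using v(2)[of k] by (simp add: cong_def)
  qed
  then have rep: "Rep_padic_int (Abs_padic_int v :: 'p padic_int) = v"
    by (intro Abs_padic_int_inverse) (use v(2) in simp)
  have "1 = a * Abs_padic_int v"
    unfolding Rep_padic_int_inject[symmetric]
    using v(1) by (auto simp: one_padic_int.rep_eq times_padic_int.rep_eq rep cong_def)
  then show "a dvd 1" by (rule dvdI)
qed

text \<open>The exponent is one less than the index of the first nonzero component; component 0 is a
  residue modulo 1 and never counts.\<close>

lemma padic_int_decompose:
  fixes a :: "'p::prime_card padic_int"
  assumes "a \<noteq> 0"
  obtains n u where "a = of_nat CARD('p) ^ n * u" "u dvd 1"
proof -
  have "\<exists>n. Rep_padic_int a n \<noteq> 0"
    using assms by (auto simp flip: Rep_padic_int_inject simp: zero_padic_int.rep_eq)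
  then obtain n where n: "Rep_padic_int a n \<noteq> 0" "\<forall>m<n. Rep_padic_int a m = 0"
    using exists_least_iff[of "\<lambda>n. Rep_padic_int a n \<noteq> 0"] by auto
  have "n \<noteq> 0" using n(1) Rep_padic_int_range[of a 0] by (intro notI) simp
  then obtain m where m: "n = Suc m" using not0_implies_Suc by blast
  obtain u where u: "a = of_nat CARD('p) ^ m * u"
    using n(2) m padic_int_dvd_power_iff[of m a] by (auto elim: dvdE)
  have "\<not> of_nat CARD('p) ^ Suc m dvd a"
    using n(1) m padic_int_dvd_power_iff[of "Suc m" a] by simp
  then have "\<not> of_nat CARD('p) ^ 1 dvd u"
    unfolding u by (auto elim!: dvdE simp: algebra_simps)
  then have "u dvd 1"
    unfolding padic_int_dvd_power_iff padic_int_unit_iff .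
  with u that show ?thesis by blast
qed

section \<open>The valuation on the field of fractions\<close>

abbreviation pp :: "'p::prime_card padic" where
  "pp \<equiv> of_nat CARD('p)"

lemma to_fract_of_nat [simp]: "to_fract (of_nat k) = of_nat k"
  by (induction k) simp_all

lemma to_fract_power [simp]: "to_fract (x ^ k) = to_fract x ^ k"
  by (induction k) simp_all

lemma pp_nonzero [simp]: "(pp :: 'p::prime_card padic) \<noteq> 0"
proof -
  have "Rep_padic_int (of_nat CARD('p) :: 'p padic_int) 2 \<noteq> 0"
    unfolding of_nat_padic_int_rep using card_gt_1[where ?'p = 'p]
    by (simp add: power2_eq_square)
  then have "(of_nat CARD('p) :: 'p padic_int) \<noteq> 0"
    by (metis zero_padic_int.rep_eq)
  then show ?thesis
    by (metis to_fract_eq_0_iff to_fract_of_nat)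
qed

text \<open>Membership in p^m Z_p. Unlike \<open>val\<close>, it treats 0 correctly, so statements
  about several entries, some of which may vanish, are phrased with it.\<close>

definition pdvd :: "int \<Rightarrow> 'p::prime_card padic \<Rightarrow> bool" where
  "pdvd m x \<longleftrightarrow> (\<exists>a. x = pp powi m * to_fract a)"

lemma pdvd_zero [simp]: "pdvd m 0"
  unfolding pdvd_def by (rule exI[of _ 0]) simp

lemma pdvd_add: "pdvd m x \<Longrightarrow> pdvd m y \<Longrightarrow> pdvd m (x + y)"
  unfolding pdvd_def by (metis distrib_left to_fract_add)

lemma pdvd_minus [simp]: "pdvd m (- x) \<longleftrightarrow> pdvd m x"
  unfolding pdvd_def by (metis add.inverse_inverse mult_minus_right to_fract_uminus)

lemma pdvd_diff: "pdvd m x \<Longrightarrow> pdvd m y \<Longrightarrow> pdvd m (x - y)"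
  using pdvd_add[of m x "- y"] by simp

lemma pdvd_mult: "pdvd m x \<Longrightarrow> pdvd n y \<Longrightarrow> pdvd (m + n) (x * y)"
proof -
  assume "pdvd m x" "pdvd n y"
  then obtain a b where "x = pp powi m * to_fract a" "y = pp powi n * to_fract b"
    unfolding pdvd_def by blast
  then have "x * y = pp powi (m + n) * to_fract (a * b)"
    by (simp add: power_int_add)
  then show ?thesis unfolding pdvd_def by blast
qed

lemma pdvd_mult_pp [simp]: "pdvd m (pp powi n * x) \<longleftrightarrow> pdvd (m - n) x"
proof -
  have "(pp powi n * x = pp powi m * to_fract a) = (x = pp powi (m - n) * to_fract a)" for a
    by (auto simp: power_int_diff field_simps)
  then show ?thesis unfolding pdvd_def by simp
qed

lemma pdvd_0_iff: "pdvd 0 x \<longleftrightarrow> x \<in> range to_fract"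
  unfolding pdvd_def by auto

lemma pdvd_mono: "pdvd m x \<Longrightarrow> n \<le> m \<Longrightarrow> pdvd n x"
proof -
  assume "pdvd m x" "n \<le> m"
  then obtain a where "x = pp powi m * to_fract a" unfolding pdvd_def by blast
  moreover have "(pp :: 'a padic) powi m = pp powi n * to_fract (of_nat CARD('a) ^ nat (m - n))"
    using \<open>n \<le> m\<close> power_int_add[of "pp :: 'a padic" n "m - n"] by (simp add: power_int_def)
  ultimately have "x = pp powi n * to_fract (of_nat CARD('a) ^ nat (m - n) * a)"
    by simp
  then show ?thesis unfolding pdvd_def by blast
qed

lemma padic_decompose:
  fixes x :: "'p::prime_card padic"
  assumes "x \<noteq> 0"
  obtains m u where "x = pp powi m * to_fract u" "u dvd 1"
proof -
  obtain a b where x: "x = Fract a b" "b \<noteq> 0" by (cases x) auto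
  with assms have "a \<noteq> 0" by (auto simp: Fract_conv_to_fract)
  obtain m u where u: "a = of_nat CARD('p) ^ m * u" "u dvd 1"
    using padic_int_decompose[OF \<open>a \<noteq> 0\<close>] .
  obtain n v where v: "b = of_nat CARD('p) ^ n * v" "v dvd 1"
    using padic_int_decompose[OF \<open>b \<noteq> 0\<close>] .
  obtain w where w: "1 = v * w" using v(2) by (rule dvdE)
  have "to_fract v * to_fract w = (1 :: 'p padic)" by (metis w to_fract_1 to_fract_mult)
  then have w': "1 / to_fract v = to_fract w"
    by (metis div_by_0 mult_eq_0_iff nonzero_mult_div_cancel_left zero_neq_one)
  have "x = pp powi (int m - int n) * (to_fract u * (1 / to_fract v))"
    using x u v by (simp add: Fract_conv_to_fract power_int_diff)
  also have "\<dots> = pp powi (int m - int n) * to_fract (u * w)" unfolding w' by simp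
  finally have "x = pp powi (int m - int n) * to_fract (u * w)" .
  moreover have "w dvd 1" using w by (metis dvd_triv_right)
  then have "u * w dvd 1" using u(2) mult_dvd_mono[of u 1 w 1] by simp
  ultimately show ?thesis using that by blast
qed

text \<open>At 0 there is no greatest exponent and the value is unspecified, which accounts for the
  disjunct \<open>x = 0\<close> in \<open>pdvd_iff\<close>.\<close>

definition val :: "'p::prime_card padic \<Rightarrow> int" where
  "val x = (GREATEST m. pdvd m x)"

lemma unit_not_pdvd_1:
  assumes "(u :: 'p::prime_card padic_int) dvd 1"
  shows "\<not> pdvd 1 (to_fract u)"
proof
  assume "pdvd 1 (to_fract u)"
  then obtain a where "to_fract u = pp * to_fract a"
    unfolding pdvd_def by auto
  then have "to_fract u = to_fract (of_nat CARD('p) * a)" by simp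
  then have "u = of_nat CARD('p) * a" by (simp only: to_fract_eq_iff)
  then have "of_nat CARD('p) ^ 1 dvd u" by simp
  with assms show False unfolding padic_int_dvd_power_iff padic_int_unit_iff by simp
qed

lemma pdvd_unit: 
  assumes "(u :: 'p::prime_card padic_int) dvd 1"
  shows "pdvd m (pp powi n * to_fract u) \<longleftrightarrow> m \<le> n"
proof -
  have "pdvd (m - n) (to_fract u) \<longleftrightarrow> m \<le> n"
    using unit_not_pdvd_1[OF assms] pdvd_mono[of "m - n" "to_fract u" 1]
      pdvd_mono[of 0 "to_fract u" "m - n"] pdvd_0_iff[of "to_fract u"] by force
  then show ?thesis by simp
qed

lemma val_unit:
  assumes "(u :: 'p::prime_card padic_int) dvd 1"
  shows "val (pp powi n * to_fract u) = n"
  unfolding val_def pdvd_unit[OF assms] by (rule Greatest_equality) auto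

lemma pdvd_iff: "pdvd m x \<longleftrightarrow> x = 0 \<or> m \<le> val x"
  by (cases "x = 0") (auto elim!: padic_decompose simp: val_unit pdvd_unit simp del: pdvd_mult_pp)

lemma val_pp [simp]: "val (pp powi n) = n"
  using val_unit[of 1 n] by simp

lemma val_1 [simp]: "val 1 = 0"
  using val_pp[of 0] by simp

lemma val_mult: "x \<noteq> 0 \<Longrightarrow> y \<noteq> 0 \<Longrightarrow> val (x * y) = val x + val y"
proof -
  assume "x \<noteq> 0" "y \<noteq> 0"
  then obtain m u n v where *: "x = pp powi m * to_fract u" "u dvd 1"
    "y = pp powi n * to_fract v" "v dvd 1"
    by (metis padic_decompose)
  then have "x * y = pp powi (m + n) * to_fract (u * v)"
    by (simp add: power_int_add)
  moreover have "u * v dvd 1" using * mult_dvd_mono[of u 1 v 1] by simp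
  ultimately show ?thesis using * by (simp only: val_unit)
qed

lemma val_inverse: "x \<noteq> 0 \<Longrightarrow> val (inverse x) = - val x"
  using val_mult[of x "inverse x"] by simp

lemma val_divide: "x \<noteq> 0 \<Longrightarrow> y \<noteq> 0 \<Longrightarrow> val (x / y) = val x - val y"
  by (simp add: divide_inverse val_mult val_inverse)

lemma val_minus [simp]: "val (- x) = val x"
  unfolding val_def by simp

lemma val_of_nat_coprime:
  assumes "0 < c" "c < CARD('p)"
  shows "(of_nat c :: 'p::prime_card padic) \<noteq> 0" "val (of_nat c :: 'p padic) = 0"
proof -
  have "(of_nat c :: 'p padic_int) dvd 1"
    unfolding padic_int_unit_iff of_nat_padic_int_rep using assms by simp
  from val_unit[OF this, of 0] show "val (of_nat c :: 'p padic) = 0" by simp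
  from \<open>of_nat c dvd 1\<close> have "(of_nat c :: 'p padic_int) \<noteq> 0" by auto
  then show "(of_nat c :: 'p padic) \<noteq> 0"
    by (metis to_fract_eq_0_iff to_fract_of_nat)
qed

lemma pdvd_of_nat [simp]: "pdvd 0 (of_nat c)"
  unfolding pdvd_0_iff by (metis rangeI to_fract_of_nat)

lemma pdvd_1 [simp]: "pdvd 0 1"
  using pdvd_of_nat[of 1] by simp

lemma padic_residue:
  assumes "pdvd 0 (x :: 'p::prime_card padic)"
  obtains c where "c < CARD('p) ^ n" "pdvd (int n) (x - of_nat c)"
proof -
  obtain a where a: "x = to_fract a" using assms unfolding pdvd_0_iff by blast
  define c where "c = nat (Rep_padic_int a n)"
  have "Rep_padic_int (a - of_nat c) n = 0"
    unfolding minus_padic_int.rep_eq of_nat_padic_int_rep c_def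
    using Rep_padic_int_range[of a n] by simp
  then obtain b where b: "a - of_nat c = of_nat CARD('p) ^ n * b"
    unfolding padic_int_dvd_power_iff[symmetric] by (rule dvdE)
  have "x - of_nat c = to_fract (a - of_nat c)" by (simp add: a)
  also have "\<dots> = pp powi int n * to_fract b" by (simp add: b)
  finally have "pdvd (int n) (x - of_nat c)" unfolding pdvd_def by blast
  moreover have "c < CARD('p) ^ n"
    using Rep_padic_int_range[of a n] unfolding c_def by (simp add: nat_less_iff)
  ultimately show ?thesis using that by blast
qed

section \<open>Minimal valuations\<close>

text \<open>Zeros are removed because \<open>val\<close> is unspecified there;
  \<open>le_mval_iff\<close> restores them through \<open>pdvd\<close>.\<close>

definition mval :: "'p::prime_card padic set \<Rightarrow> int" where
  "mval A = Min (val ` (A - {0}))"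

lemma le_mval_iff:
  assumes "finite A" "\<exists>x\<in>A. x \<noteq> 0"
  shows "m \<le> mval A \<longleftrightarrow> (\<forall>x\<in>A. pdvd m x)"
proof -
  have "val ` (A - {0}) \<noteq> {}" using assms by auto
  then show ?thesis unfolding mval_def using assms by (subst Min_ge_iff) (auto simp: pdvd_iff)
qed

lemma pdvd_divide: "x \<noteq> 0 \<Longrightarrow> pdvd m (y / x) \<longleftrightarrow> pdvd (m + val x) y"
  by (cases "y = 0") (auto simp: pdvd_iff val_divide)

section \<open>Entries, determinants and inverses of two-by-two matrices\<close>

abbreviation m11 :: "'a::comm_ring_1 gl2 \<Rightarrow> 'a" where "m11 h \<equiv> Rep_gl2 h $ 1 $ 1"
abbreviation m12 :: "'a::comm_ring_1 gl2 \<Rightarrow> 'a" where "m12 h \<equiv> Rep_gl2 h $ 1 $ 2"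
abbreviation m21 :: "'a::comm_ring_1 gl2 \<Rightarrow> 'a" where "m21 h \<equiv> Rep_gl2 h $ 2 $ 1"
abbreviation m22 :: "'a::comm_ring_1 gl2 \<Rightarrow> 'a" where "m22 h \<equiv> Rep_gl2 h $ 2 $ 2"

definition det2 :: "'a::comm_ring_1 gl2 \<Rightarrow> 'a" where
  "det2 h = m11 h * m22 h - m12 h * m21 h"

lemma gl2_eqI:
  "m11 g = m11 h \<Longrightarrow> m12 g = m12 h \<Longrightarrow> m21 g = m21 h \<Longrightarrow> m22 g = m22 h \<Longrightarrow> g = h"
  unfolding Rep_gl2_inject[symmetric] by (simp add: vec_eq_iff forall_2)

lemma gl2_times_entries [simp]:
  "m11 (g * h) = m11 g * m11 h + m12 g * m21 h"
  "m12 (g * h) = m11 g * m12 h + m12 g * m22 h"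
  "m21 (g * h) = m21 g * m11 h + m22 g * m21 h"
  "m22 (g * h) = m21 g * m12 h + m22 g * m22 h"
  by (simp_all add: times_gl2.rep_eq matrix_matrix_mult_def sum_2)

lemma gl2_one_entries [simp]:
  "m11 1 = 1" "m12 1 = 0" "m21 1 = 0" "m22 1 = 1"
  by (simp_all add: one_gl2.rep_eq mat_def)

lemma det2_mult: "det2 (g * h) = det2 g * det2 h"
  by (simp add: det2_def algebra_simps)

lemma det2_one [simp]: "det2 1 = 1"
  by (simp add: det2_def)

lemma det2_dvd_1: "det2 h dvd 1"
  using det2_mult[of h "inverse h"] by (metis det2_one dvd_triv_left gl2_inverse(1))

text \<open>The adjugate times the inverse of the determinant witnesses invertibility, which allows
  the entries to be read back through \<open>Abs_gl2\<close>.\<close>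

lemma gl2_of_entries:
  fixes a b c d :: "'a::comm_ring_1"
  assumes "a * d - b * c dvd 1"
  shows "m11 (gl2_of a b c d) = a" "m12 (gl2_of a b c d) = b"
    "m21 (gl2_of a b c d) = c" "m22 (gl2_of a b c d) = d"
proof -
  obtain w where w: "1 = (a * d - b * c) * w" using assms by (rule dvdE)
  let ?A = "vector [vector [a, b], vector [c, d]] :: 'a ^ 2 ^ 2"
  let ?B = "vector [vector [d * w, - b * w], vector [- c * w, a * w]] :: 'a ^ 2 ^ 2"
  have "?A ** ?B = mat 1" "?B ** ?A = mat 1"
    using w by (auto simp: vec_eq_iff matrix_matrix_mult_def sum_2 forall_2 mat_def algebra_simps)
  then have "invertible ?A" unfolding invertible_def by blast
  then have "Rep_gl2 (gl2_of a b c d) = ?A"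
    unfolding gl2_of_def by (simp add: Abs_gl2_inverse)
  then show "m11 (gl2_of a b c d) = a" "m12 (gl2_of a b c d) = b"
    "m21 (gl2_of a b c d) = c" "m22 (gl2_of a b c d) = d" by simp_all
qed

lemma gl2_of_entries_field [simp]:
  fixes a b c d :: "'a::field"
  assumes "a * d - b * c \<noteq> 0"
  shows "m11 (gl2_of a b c d) = a" "m12 (gl2_of a b c d) = b"
    "m21 (gl2_of a b c d) = c" "m22 (gl2_of a b c d) = d"
  using gl2_of_entries[of a d b c] assms by (simp_all add: dvd_field_iff)

lemma det2_gl2_of: "a * d - b * c \<noteq> 0 \<Longrightarrow> det2 (gl2_of a b c d) = (a * d - b * c :: 'a::field)"
  by (simp add: det2_def)

lemma det2_nonzero [simp]: "det2 (h :: 'a::field gl2) \<noteq> 0"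
  using det2_dvd_1[of h] by auto

lemma gl2_inverse_unique: "g * h = 1 \<Longrightarrow> inverse g = (h :: 'a::comm_ring_1 gl2)"
  by (metis gl2_inverse(2) mult.assoc mult.right_neutral mult_1)

lemma gl2_inverse_inverse [simp]: "inverse (inverse g) = (g :: 'a::comm_ring_1 gl2)"
  by (rule gl2_inverse_unique) simp

lemma gl2_inverse_mult: "inverse (g * h) = inverse h * inverse (g :: 'a::comm_ring_1 gl2)"
  by (rule gl2_inverse_unique) (metis gl2_inverse(1) mult.assoc mult_1_right)

lemma gl2_inverse_entries:
  fixes h :: "'a::field gl2"
  shows "m11 (inverse h) = m22 h / det2 h" "m12 (inverse h) = - m12 h / det2 h"
    "m21 (inverse h) = - m21 h / det2 h" "m22 (inverse h) = m11 h / det2 h"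
proof -
  let ?D = "det2 h"
  define B where "B = gl2_of (m22 h / ?D) (- m12 h / ?D) (- m21 h / ?D) (m11 h / ?D)"
  have D: "m22 h / ?D * (m11 h / ?D) - (- m12 h / ?D) * (- m21 h / ?D) = 1 / ?D"
    using det2_nonzero[of h] by (simp add: det2_def divide_simps)
  have B: "m11 B = m22 h / ?D" "m12 B = - m12 h / ?D" "m21 B = - m21 h / ?D" "m22 B = m11 h / ?D"
    unfolding B_def by (subst gl2_of_entries_field; simp only: D; simp)+
  have "m11 h * m22 h / ?D - m12 h * m21 h / ?D = 1"
    unfolding diff_divide_distrib[symmetric] using det2_nonzero[of h] by (simp add: det2_def)
  then have "h * B = 1"
    by (intro gl2_eqI) (simp_all add: B algebra_simps)
  then have "inverse h = B" by (rule gl2_inverse_unique)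
  with B show "m11 (inverse h) = m22 h / det2 h" "m12 (inverse h) = - m12 h / det2 h"
    "m21 (inverse h) = - m21 h / det2 h" "m22 (inverse h) = m11 h / det2 h" by simp_all
qed

lemma det2_inverse: "det2 (inverse h) = inverse (det2 (h :: 'a::field gl2))"
  using det2_mult[of h "inverse h"] by (simp add: inverse_unique)

text \<open>
  The valuation of the determinant, the content of the matrix and the content of its bottom row.
\<close>

definition dval :: "'p::prime_card Hp \<Rightarrow> int" where
  "dval h = val (det2 h)"

definition cont :: "'p::prime_card Hp \<Rightarrow> int" where
  "cont h = mval {m11 h, m12 h, m21 h, m22 h}"

definition rcont :: "'p::prime_card Hp \<Rightarrow> int" where
  "rcont h = mval {m21 h, m22 h}"

lemma le_cont_iff:
  "m \<le> cont h \<longleftrightarrow> pdvd m (m11 h) \<and> pdvd m (m12 h) \<and> pdvd m (m21 h) \<and> pdvd m (m22 h)"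
proof -
  have "\<exists>x\<in>{m11 h, m12 h, m21 h, m22 h}. x \<noteq> 0"
    using det2_nonzero[of h] by (auto simp: det2_def)
  then show ?thesis unfolding cont_def by (subst le_mval_iff) auto
qed

lemma le_rcont_iff: "m \<le> rcont h \<longleftrightarrow> pdvd m (m21 h) \<and> pdvd m (m22 h)"
proof -
  have "\<exists>x\<in>{m21 h, m22 h}. x \<noteq> 0"
    using det2_nonzero[of h] by (auto simp: det2_def)
  then show ?thesis unfolding rcont_def by (subst le_mval_iff) auto
qed

lemma cont_eqI:
  assumes "\<And>m. m \<le> t \<longleftrightarrow> pdvd m (m11 h) \<and> pdvd m (m12 h) \<and> pdvd m (m21 h) \<and> pdvd m (m22 h)"
  shows "cont h = t"
  using assms le_cont_iff by (metis order_antisym order_refl)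

lemma rcont_eqI:
  assumes "\<And>m. m \<le> t \<longleftrightarrow> pdvd m (m21 h) \<and> pdvd m (m22 h)"
  shows "rcont h = t"
  using assms le_rcont_iff by (metis order_antisym order_refl)

lemma dval_mult: "dval (g * h) = dval g + dval h"
  by (simp add: dval_def det2_mult val_mult)

lemma dval_inverse: "dval (inverse h) = - dval h"
  by (simp add: dval_def det2_inverse val_inverse)

lemma dval_one [simp]: "dval 1 = 0"
  by (simp add: dval_def)

lemma cont_mult: "cont g + cont h \<le> cont (g * h)"
  using le_cont_iff[of "cont g" g] le_cont_iff[of "cont h" h]
  by (auto simp: le_cont_iff intro!: pdvd_add pdvd_mult)

lemma rcont_mult: "rcont g + cont h \<le> rcont (g * h)"
  using le_rcont_iff[of "rcont g" g] le_cont_iff[of "cont h" h]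
  by (auto simp: le_rcont_iff intro!: pdvd_add pdvd_mult)

text \<open>The inverse is the adjugate divided by the determinant, and the adjugate has the same
  entries up to sign and position.\<close>

lemma cont_inverse: "cont (inverse h) = cont h - dval h"
proof (rule cont_eqI)
  fix m
  have "pdvd m (x / det2 h) \<longleftrightarrow> pdvd (m + dval h) x" for x
    by (cases "x = 0") (auto simp: pdvd_iff val_divide dval_def)
  then show "m \<le> cont h - dval h \<longleftrightarrow> pdvd m (m11 (inverse h)) \<and> pdvd m (m12 (inverse h))
      \<and> pdvd m (m21 (inverse h)) \<and> pdvd m (m22 (inverse h))"
    using le_cont_iff[of "m + dval h" h] by (auto simp: gl2_inverse_entries algebra_simps)
qed

text \<open>The determinant is quadratic in the entries. The nonnegative number
  \<open>dval h - 2 * cont h\<close> is the distance in the tree from the base vertex to its image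
  under \<open>h\<close>.\<close>

lemma cont_le_dval: "2 * cont h \<le> dval h"
proof -
  have "pdvd (cont h + cont h) (det2 h)"
    unfolding det2_def by (intro pdvd_diff pdvd_mult; use le_cont_iff[of "cont h" h] in simp)
  then show ?thesis by (simp add: pdvd_iff dval_def)
qed

text \<open>Replaces membership in GL_2(Z_p) by two numerical conditions: the entries are integral
  and the determinant is a unit. Later memberships are checked in this form.\<close>

lemma Hp0_iff: "h \<in> Hp0 \<longleftrightarrow> 0 \<le> cont h \<and> dval (h :: 'p::prime_card Hp) = 0"
proof
  assume "h \<in> Hp0"
  then obtain A :: "'p padic_int gl2" where A: "Rep_gl2 h $ i $ j = to_fract (Rep_gl2 A $ i $ j)" for i j
    unfolding Hp0_def by blast
  have "det2 h = to_fract (det2 A)" by (simp add: det2_def A)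
  then have "dval h = 0" using val_unit[OF det2_dvd_1[of A], of 0] by (simp add: dval_def)
  moreover have "0 \<le> cont h" unfolding le_cont_iff by (simp add: A pdvd_0_iff)
  ultimately show "0 \<le> cont h \<and> dval h = 0" by simp
next
  assume h: "0 \<le> cont h \<and> dval h = 0"
  then obtain a b c d where e: "m11 h = to_fract a" "m12 h = to_fract b"
    "m21 h = to_fract c" "m22 h = to_fract d"
    unfolding le_cont_iff pdvd_0_iff by blast
  have D: "det2 h = to_fract (a * d - b * c)" by (simp add: det2_def e)
  obtain m u where u: "det2 h = pp powi m * to_fract u" "u dvd 1"
    using padic_decompose[OF det2_nonzero] .
  then have "m = 0" using h val_unit[OF u(2), of m] by (simp add: dval_def)
  then have "to_fract (a * d - b * c) = to_fract u" using D u by simp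
  then have "a * d - b * c dvd 1" using u(2) by (simp only: to_fract_eq_iff)
  note E = gl2_of_entries[OF this]
  have "\<forall>i j. Rep_gl2 h $ i $ j = to_fract (Rep_gl2 (gl2_of a b c d) $ i $ j)"
    by (simp add: forall_2 e E)
  then show "h \<in> Hp0" unfolding Hp0_def by blast
qed

lemma cont_one: "cont (1 :: 'p::prime_card Hp) = 0"
  by (rule cont_eqI) (auto simp: pdvd_iff)

lemma Hp0_cont: "h \<in> Hp0 \<Longrightarrow> cont h = 0"
  using cont_le_dval[of h] by (simp add: Hp0_iff)

lemma Hp0_one [simp]: "1 \<in> Hp0"
  by (simp add: Hp0_iff cont_one)

lemma Hp0_mult [intro]: "g \<in> Hp0 \<Longrightarrow> h \<in> Hp0 \<Longrightarrow> g * h \<in> Hp0"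
  using cont_mult[of g h] by (simp add: Hp0_iff dval_mult)

lemma Hp0_inverse [intro]: "h \<in> Hp0 \<Longrightarrow> inverse h \<in> Hp0"
  by (simp add: Hp0_iff dval_inverse cont_inverse)

text \<open>Superadditivity of \<open>cont\<close>, applied to \<open>k\<close> and to its inverse,
  both of content 0, gives both inequalities.\<close>

lemma cont_mult_Hp0 [simp]:
  assumes "k \<in> Hp0"
  shows "cont (h * k) = cont h" "cont (k * h) = cont h"
proof -
  have k: "cont k = 0" "cont (inverse k) = 0" using assms Hp0_cont by blast+
  have "h * k * inverse k = h" "inverse k * (k * h) = h"
    by (simp_all add: mult.assoc) (simp flip: mult.assoc)
  then show "cont (h * k) = cont h" "cont (k * h) = cont h"
    using k cont_mult[of h k] cont_mult[of "h * k" "inverse k"]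
      cont_mult[of k h] cont_mult[of "inverse k" "k * h"] by simp_all
qed

lemma rcont_mult_Hp0 [simp]:
  assumes "k \<in> Hp0"
  shows "rcont (h * k) = rcont h"
proof -
  have k: "cont k = 0" "cont (inverse k) = 0" using assms Hp0_cont by blast+
  have "h * k * inverse k = h" by (simp add: mult.assoc)
  then show ?thesis using k rcont_mult[of h k] rcont_mult[of "h * k" "inverse k"] by simp
qed

lemma dval_mult_Hp0 [simp]: "k \<in> Hp0 \<Longrightarrow> dval (h * k) = dval h" "k \<in> Hp0 \<Longrightarrow> dval (k * h) = dval h"
  by (simp_all add: dval_mult Hp0_iff)

section \<open>Iwasawa and Cartan decompositions\<close>

lemma gl2_of_mult:
  fixes a b c d :: "'a::field"
  assumes "a * d - b * c \<noteq> 0" "a' * d' - b' * c' \<noteq> 0"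
  shows "gl2_of a b c d * gl2_of a' b' c' d' =
    gl2_of (a * a' + b * c') (a * b' + b * d') (c * a' + d * c') (c * b' + d * d')"
proof -
  have "(a * a' + b * c') * (c * b' + d * d') - (a * b' + b * d') * (c * a' + d * c') =
    (a * d - b * c) * (a' * d' - b' * c')" by (simp add: algebra_simps)
  then have "(a * a' + b * c') * (c * b' + d * d') - (a * b' + b * d') * (c * a' + d * c') \<noteq> 0"
    using assms by simp
  then show ?thesis using assms by (intro gl2_eqI) simp_all
qed

lemma Hp0_gl2_of:
  assumes "a * d - b * c \<noteq> 0" "val (a * d - b * c) = 0" "pdvd 0 a" "pdvd 0 b" "pdvd 0 c" "pdvd 0 d"
  shows "gl2_of a b c d \<in> Hp0"
  using assms by (simp add: Hp0_iff le_cont_iff dval_def det2_gl2_of)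

text \<open>Column operations over Z_p: the bottom entry of smaller valuation clears the other, and
  a unit scales the surviving one to a power of p. The upper left entry is normalized only in
  \<open>Hp_iwasawa\<close>.\<close>

lemma Hp_bottom_row_reduce:
  fixes h :: "'p::prime_card Hp"
  obtains x b n k where "x \<noteq> 0" "k \<in> Hp0" "h = gl2_of x b 0 (pp powi n) * k"
proof -
  have *: "\<exists>k\<in>Hp0. m21 (h * k) = 0"
  proof (cases "m22 h \<noteq> 0 \<and> pdvd 0 (m21 h / m22 h)")
    case True
    define k :: "'p Hp" where "k = gl2_of 1 0 (- m21 h / m22 h) 1"
    have "k \<in> Hp0" unfolding k_def using True by (intro Hp0_gl2_of) auto
    moreover have "m21 (h * k) = 0" using True by (simp add: k_def)
    ultimately show ?thesis by blast
  next
    case False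
    \<comment> \<open>The right entry does not divide the left one, so the valuations force the
      converse; the matrix \<open>k\<close> below swaps the columns while clearing.\<close>
    then have "m21 h \<noteq> 0 \<and> pdvd 0 (m22 h / m21 h)"
      using det2_nonzero[of h] by (auto simp: det2_def pdvd_iff val_divide)
    moreover define k :: "'p Hp" where "k = gl2_of (m22 h / m21 h) 1 (- 1) 0"
    ultimately have "k \<in> Hp0" "m21 (h * k) = 0" by (auto intro!: Hp0_gl2_of)
    then show ?thesis by blast
  qed
  then obtain k where k: "k \<in> Hp0" "m21 (h * k) = 0" by blast
  define g where "g = h * k"
  have nz: "m11 g \<noteq> 0" "m22 g \<noteq> 0"
    using det2_nonzero[of g] k(2) unfolding det2_def g_def by auto
  then obtain n u where u: "m22 g = pp powi n * to_fract u" "u dvd 1"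
    using padic_decompose by blast
  have vu: "to_fract u \<noteq> 0" "val (to_fract u) = 0" "pdvd 0 (to_fract u)"
    using val_unit[OF u(2), of 0] u nz by (auto simp: pdvd_iff)
  define l :: "'p Hp" where "l = gl2_of 1 0 0 (to_fract u)"
  have l: "l \<in> Hp0" unfolding l_def using vu by (intro Hp0_gl2_of) auto
  define A where "A = gl2_of (m11 g) (m12 g / to_fract u) 0 (pp powi n)"
  have "g = A * l"
    unfolding A_def
    by (rule gl2_eqI) (use nz k(2) vu u in \<open>simp_all add: l_def flip: g_def\<close>)
  moreover have "h = g * inverse k" by (simp add: g_def mult.assoc)
  ultimately have "h = A * (l * inverse k)" by (simp only: mult.assoc)
  moreover have "l * inverse k \<in> Hp0" using l k(1) by blast
  ultimately show ?thesis using that[of "m11 g"] nz(1) unfolding A_def by blast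
qed

lemma Hp_iwasawa:
  fixes h :: "'p::prime_card Hp"
  obtains m b n k where "k \<in> Hp0" "h = gl2_of (pp powi m) b 0 (pp powi n) * k"
proof -
  obtain x b n k where h: "x \<noteq> 0" "k \<in> Hp0" "h = gl2_of x b 0 (pp powi n) * k"
    by (rule Hp_bottom_row_reduce)
  obtain m u where u: "x = pp powi m * to_fract u" "u dvd 1"
    using padic_decompose h(1) by blast
  have vu: "to_fract u \<noteq> 0" "val (to_fract u) = 0" "pdvd 0 (to_fract u)"
    using val_unit[OF u(2), of 0] u h(1) by (auto simp: pdvd_iff)
  define l :: "'p Hp" where "l = gl2_of (to_fract u) 0 0 1"
  have "l \<in> Hp0" unfolding l_def using vu by (intro Hp0_gl2_of) auto
  moreover have "gl2_of x b 0 (pp powi n) = gl2_of (pp powi m) b 0 (pp powi n) * l"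
    unfolding l_def using vu u by (subst gl2_of_mult) auto
  ultimately show ?thesis using that[of "l * k"] h by (auto simp: mult.assoc)
qed

lemma cont_diag:
  "cont (gl2_of (pp powi a) 0 0 (pp powi c) :: 'p::prime_card Hp) = min a c"
  by (rule cont_eqI) (auto simp: pdvd_iff)

lemma dval_diag:
  "dval (gl2_of (pp powi a) 0 0 (pp powi c) :: 'p::prime_card Hp) = a + c"
  by (simp add: dval_def det2_gl2_of val_mult)

text \<open>Elimination with a pivot of minimal valuation: a diagonal entry that divides
  \<open>b\<close> clears it by a row or a column operation, and otherwise \<open>b\<close> itself
  is the pivot.\<close>

lemma Hp_upper_diagonalize:
  obtains k l a c where "k \<in> Hp0" "l \<in> Hp0"
    "k * gl2_of (pp powi m) b 0 (pp powi n) * l = (gl2_of (pp powi a) 0 0 (pp powi c) :: 'p::prime_card Hp)"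
proof -
  let ?h = "gl2_of (pp powi m) b 0 (pp powi n) :: 'p Hp"
  consider (n) "pdvd n b" | (m) "pdvd m b" | (b) "b \<noteq> 0" "val b < m" "val b < n"
    by (metis pdvd_iff linorder_not_le)
  then show ?thesis
  proof cases
    case n
    let ?k = "gl2_of 1 (- b / pp powi n) 0 1 :: 'p Hp"
    have "?k \<in> Hp0" using n by (intro Hp0_gl2_of) (auto simp: pdvd_divide)
    moreover have "?k * ?h * 1 = gl2_of (pp powi m) 0 0 (pp powi n)"
      by (simp add: gl2_of_mult)
    ultimately show ?thesis using that Hp0_one by blast
  next
    case m
    let ?k = "gl2_of 1 (- b / pp powi m) 0 1 :: 'p Hp"
    have "?k \<in> Hp0" using m by (intro Hp0_gl2_of) (auto simp: pdvd_divide)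
    moreover have "1 * ?h * ?k = gl2_of (pp powi m) 0 0 (pp powi n)"
      by (simp add: gl2_of_mult)
    ultimately show ?thesis using that Hp0_one by blast
  next
    case b
    obtain t u where u: "b = pp powi t * to_fract u" "u dvd 1"
      using padic_decompose b(1) by blast
    have t: "val b = t" using u val_unit by blast
    have vu: "to_fract u \<noteq> 0" "val (to_fract u) = 0" "pdvd 0 (to_fract u)"
      using val_unit[OF u(2), of 0] u b(1) by (auto simp: pdvd_iff)
    \<comment> \<open>Here \<open>R\<close> and \<open>U\<close> stand for the power of p and the
      unit in \<open>b\<close>. After the rows are swapped, \<open>b\<close> sits on the diagonal
      and clears \<open>Q\<close> and \<open>P\<close>; the last factor removes \<open>U\<close> and
      a sign.\<close>
    have *: "gl2_of 1 (- (Q / b)) 0 1 * gl2_of 0 1 1 0 * gl2_of P b 0 Q *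
        (gl2_of 1 0 (- (P / b)) 1 * gl2_of (- U) 0 0 (1 / U)) = gl2_of (P * Q / R) 0 0 R"
      if "P \<noteq> 0" "Q \<noteq> 0" "R \<noteq> 0" "U \<noteq> 0" "b = R * U" for P Q R U :: "'p padic"
    proof -
      have b: "b \<noteq> 0" using that by simp
      have "gl2_of 1 (- (Q / b)) 0 1 * gl2_of 0 1 1 0 = gl2_of (- (Q / b)) 1 1 0"
        by (subst gl2_of_mult) simp_all
      moreover have "gl2_of (- (Q / b)) 1 1 0 * gl2_of P b 0 Q = gl2_of (- (Q / b * P)) 0 P b"
        using b that(1,2) by (subst gl2_of_mult) simp_all
      moreover have "gl2_of 1 0 (- (P / b)) 1 * gl2_of (- U) 0 0 (1 / U) = gl2_of (- U) 0 (P / b * U) (1 / U)"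
        using that(4) by (subst gl2_of_mult) simp_all
      moreover have "gl2_of (- (Q / b * P)) 0 P b * gl2_of (- U) 0 (P / b * U) (1 / U) =
          gl2_of (Q / b * P * U) 0 0 (b / U)"
        using b that(1,2,4) by (subst gl2_of_mult) simp_all
      moreover have "Q / b * P * U = P * Q / R" "b / U = R"
        using that by simp_all
      ultimately show ?thesis by (simp only:)
    qed
    let ?k = "gl2_of 1 (- (pp powi n / b)) 0 1 * gl2_of 0 1 1 0 :: 'p Hp"
    let ?l = "gl2_of 1 0 (- (pp powi m / b)) 1 * gl2_of (- to_fract u) 0 0 (1 / to_fract u) :: 'p Hp"
    have "?k \<in> Hp0" using b by (intro Hp0_mult Hp0_gl2_of) (auto simp: pdvd_iff val_divide)
    moreover have "?l \<in> Hp0" using b vu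
      by (intro Hp0_mult Hp0_gl2_of) (auto simp: pdvd_iff val_divide)
    moreover have "?k * ?h * ?l = gl2_of (pp powi (m + n - t)) 0 0 (pp powi t)"
      using *[OF _ _ _ vu(1) u(1)] by (simp add: power_int_add power_int_diff)
    ultimately show ?thesis by (rule that)
  qed
qed

text \<open>Since \<open>cont\<close> and \<open>dval\<close> are invariant on both sides, the
  exponents of the diagonal form can be computed from \<open>h\<close> itself.\<close>

lemma Hp_cartan:
  fixes h :: "'p::prime_card Hp"
  obtains k l where "k \<in> Hp0" "l \<in> Hp0"
    "h = k * gl2_of (pp powi (dval h - cont h)) 0 0 (pp powi cont h) * l"
proof -
  obtain m b n k0 where k0: "k0 \<in> Hp0" "h = gl2_of (pp powi m) b 0 (pp powi n) * k0"
    by (rule Hp_iwasawa)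
  obtain k l a c where kl: "k \<in> Hp0" "l \<in> Hp0"
    "k * gl2_of (pp powi m) b 0 (pp powi n) * l = gl2_of (pp powi a) 0 0 (pp powi c)"
    by (rule Hp_upper_diagonalize)
  \<comment> \<open>The Weyl element exchanges the diagonal exponents, so the smaller one can be put
    last, where it equals the content.\<close>
  define w :: "'p Hp" where "w = gl2_of 0 1 1 0"
  have w: "w \<in> Hp0" unfolding w_def by (intro Hp0_gl2_of) auto
  have "w * gl2_of (pp powi a) 0 0 (pp powi c) * w = gl2_of (pp powi c) 0 0 (pp powi a)" for a c
    unfolding w_def by (intro gl2_eqI) simp_all
  then have "\<exists>k\<in>Hp0. \<exists>l\<in>Hp0. \<exists>a c. c \<le> a \<and>
      k * gl2_of (pp powi m) b 0 (pp powi n) * l = gl2_of (pp powi a) 0 0 (pp powi c)"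
  proof (cases "c \<le> a")
    case True
    then show ?thesis using kl by blast
  next
    case False
    have "(w * k) * gl2_of (pp powi m) b 0 (pp powi n) * (l * w) = w * (k * gl2_of (pp powi m) b 0 (pp powi n) * l) * w"
      by (simp only: mult.assoc)
    also have "\<dots> = gl2_of (pp powi c) 0 0 (pp powi a)" unfolding kl(3) by fact
    finally have "(w * k) * gl2_of (pp powi m) b 0 (pp powi n) * (l * w) = gl2_of (pp powi c) 0 0 (pp powi a)" .
    moreover have "w * k \<in> Hp0" "l * w \<in> Hp0" using kl(1,2) w by blast+
    ultimately show ?thesis using False by (metis linorder_linear)
  qed
  then obtain k l a c where kl: "k \<in> Hp0" "l \<in> Hp0" "c \<le> a"
    "k * gl2_of (pp powi m) b 0 (pp powi n) * l = gl2_of (pp powi a) 0 0 (pp powi c)"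
    by auto
  have h: "h = inverse k * gl2_of (pp powi a) 0 0 (pp powi c) * (inverse l * k0)"
    unfolding kl(4)[symmetric] k0(2) by (simp add: mult.assoc) (simp flip: mult.assoc add: mult.assoc[of _ l])
  have "inverse k \<in> Hp0" "inverse l * k0 \<in> Hp0" using kl k0 by blast+
  moreover from this have "cont h = c" "dval h = a + c"
    unfolding h using kl(3) by (simp_all add: cont_diag dval_diag)
  ultimately show ?thesis using that h by simp
qed

section \<open>Topology\<close>

lemma gl2_inverse_cancel [simp]:
  fixes g h :: "'a::comm_ring_1 gl2"
  shows "g * (inverse g * h) = h" "inverse g * (g * h) = h"
  by (simp_all flip: mult.assoc)

section \<open>Cosets of the compact open subgroup and balls\<close>

lemma Gp_one: "(1 :: 'p::prime_card Gp) = (1, 1)"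
  by (rule one_prod_def)

lemma Gp_fst_snd [simp]:
  fixes g h :: "'p::prime_card Gp"
  shows "fst (g * h) = fst g * fst h" "snd (g * h) = snd g * snd h"
    "fst (inverse g) = inverse (fst g)" "snd (inverse g) = inverse (snd g)"
    "fst (1 :: 'p Gp) = 1" "snd (1 :: 'p Gp) = 1"
  by (simp_all add: times_prod_def inverse_prod_def one_prod_def)

lemma Gp_Pair_mult: "(a, b) * (c, d) = ((a * c, b * d) :: 'p::prime_card Gp)"
  by (simp add: times_prod_def)

lemma Gp_inverse [simp]:
  fixes g :: "'p::prime_card Gp"
  shows "g * inverse g = 1" "inverse g * g = 1" "g * (inverse g * h) = h" "inverse g * (g * h) = h"
    "inverse (inverse g) = g" "inverse (1 :: 'p Gp) = 1"
proof -
  show 1: "g * inverse g = 1" "inverse g * g = 1"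
    by (rule prod_eqI; simp)+
  show "g * (inverse g * h) = h" "inverse g * (g * h) = h"
    by (simp_all only: mult.assoc[symmetric] 1 mult_1)
  show "inverse (inverse g) = g" by (rule prod_eqI) simp_all
  show "inverse (1 :: 'p Gp) = 1" by (rule prod_eqI; simp add: gl2_inverse_unique)
qed

lemma Gp_inverse_mult: "inverse (g * h) = inverse h * inverse (g :: 'p::prime_card Gp)"
  by (rule prod_eqI) (simp_all add: gl2_inverse_mult)

lemma Gp0_iff: "g \<in> Gp0 \<longleftrightarrow> fst g \<in> Hp0 \<and> snd g \<in> Hp0"
  by (auto simp: Gp0_def mem_Times_iff)

lemma Gp0_one [simp]: "1 \<in> Gp0"
  by (simp add: Gp0_iff)

lemma Gp0_mult: "g \<in> Gp0 \<Longrightarrow> h \<in> Gp0 \<Longrightarrow> g * h \<in> Gp0"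
  by (auto simp: Gp0_iff)

lemma Gp0_inverse: "g \<in> Gp0 \<Longrightarrow> inverse g \<in> Gp0"
  by (auto simp: Gp0_iff)

definition coset :: "'p::prime_card Gp \<Rightarrow> 'p Gp set" where
  "coset g = (\<lambda>k. g * k) ` Gp0"

lemma coset_iff: "x \<in> coset g \<longleftrightarrow> inverse g * x \<in> Gp0"
proof
  assume "inverse g * x \<in> Gp0"
  then have "g * (inverse g * x) \<in> coset g" unfolding coset_def by blast
  then show "x \<in> coset g" by simp
qed (auto simp: coset_def)

lemma coset_self [simp]: "g \<in> coset g"
  by (simp add: coset_iff)

lemma coset_eq: "x \<in> coset g \<Longrightarrow> coset x = coset g"
proof -
  assume x: "x \<in> coset g"
  have "inverse x * y = inverse (inverse g * x) * (inverse g * y)"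
    "inverse g * y = inverse g * x * (inverse x * y)" for y
    by (simp_all add: Gp_inverse_mult mult.assoc)
  with x show ?thesis unfolding set_eq_iff coset_iff by (metis Gp0_mult Gp0_inverse)
qed

lemma gl2_ball_iff:
  "h \<in> gl2_ball n g \<longleftrightarrow> pdvd (int n) (m11 h - m11 g) \<and> pdvd (int n) (m12 h - m12 g) \<and>
    pdvd (int n) (m21 h - m21 g) \<and> pdvd (int n) (m22 h - m22 g)"
  by (auto simp: gl2_ball_def forall_2 pdvd_def)

text \<open>Left multiplication by \<open>x\<close> costs \<open>- cont x\<close> digits of
  precision. \<open>nat\<close> cuts negative indices off at 0, which only strengthens the
  assumption on \<open>h\<close>.\<close>

lemma gl2_ball_mult:
  assumes "h \<in> gl2_ball (nat m) g" "int n - cont x \<le> m"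
  shows "x * h \<in> gl2_ball n (x * g)"
proof -
  have x: "pdvd (cont x) (m11 x)" "pdvd (cont x) (m12 x)" "pdvd (cont x) (m21 x)" "pdvd (cont x) (m22 x)"
    using le_cont_iff[of "cont x" x] by simp_all
  have *: "pdvd (int n) (a * c + b * d)"
    if "pdvd (cont x) a" "pdvd (cont x) b" "pdvd (int (nat m)) c" "pdvd (int (nat m)) d" for a b c d
    using pdvd_add[OF pdvd_mult[OF that(1,3)] pdvd_mult[OF that(2,4)]]
    by (rule pdvd_mono) (use assms(2) in simp)
  have e: "a * c + b * d - (a * c' + b * d') = a * (c - c') + b * (d - d')"
    for a b c d c' d' :: "'a padic" by (simp add: algebra_simps)
  show ?thesis
    using assms(1) unfolding gl2_ball_iff gl2_times_entries e by (intro conjI * x) simp_all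
qed

text \<open>The entries are integral and the determinant is 1 modulo p, hence a unit.\<close>

lemma gl2_ball_1_Hp0: "gl2_ball 1 1 \<subseteq> (Hp0 :: 'p::prime_card Hp set)"
proof
  fix h :: "'p Hp"
  assume "h \<in> gl2_ball 1 1"
  then have h: "pdvd 1 (m11 h - 1)" "pdvd 1 (m12 h)" "pdvd 1 (m21 h)" "pdvd 1 (m22 h - 1)"
    by (simp_all add: gl2_ball_iff)
  have mono: "pdvd 0 x" if "pdvd 1 x" for x :: "'p padic"
    using that by (rule pdvd_mono) simp
  have int: "pdvd 0 (m11 h)" "pdvd 0 (m22 h)"
    using pdvd_add[OF mono[OF h(1)] pdvd_1] pdvd_add[OF mono[OF h(4)] pdvd_1] by simp_all
  then have "0 \<le> cont h" using h int by (simp add: le_cont_iff mono)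
  moreover have "dval h = 0"
  proof -
    have e: "det2 h - 1 = (m11 h - 1) * m22 h + (m22 h - 1) - m12 h * m21 h"
      by (simp add: det2_def algebra_simps)
    have "pdvd (1 + 0) ((m11 h - 1) * m22 h)" "pdvd (1 + 0) (m12 h * m21 h)"
      by (intro pdvd_mult h int mono[OF h(3)])+
    then have 1: "pdvd 1 (det2 h - 1)"
      unfolding e by (simp only: add_0_right pdvd_diff pdvd_add h(4))
    then have "\<not> pdvd 1 (det2 h)"
      using pdvd_diff[of 1 "det2 h" "det2 h - 1"] by (auto simp: pdvd_iff[of 1 1])
    moreover have "pdvd 0 (det2 h)"
      using pdvd_add[OF mono[OF 1] pdvd_1] by simp
    ultimately show ?thesis by (force simp: pdvd_iff dval_def)
  qed
  ultimately show "h \<in> Hp0" by (simp add: Hp0_iff)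
qed

lemma openin_Hp_coset: "openin Hp_topology ((\<lambda>k. g * k) ` (Hp0 :: 'p::prime_card Hp set))"
  unfolding openin_Hp_topology
proof
  fix h :: "'p Hp"
  assume h: "h \<in> (\<lambda>k. g * k) ` Hp0"
  \<comment> \<open>Chosen so that left multiplication by \<open>inverse h\<close> carries the ball
    around \<open>h\<close> into the ball of index 1 around 1, which lies in
    \<open>Hp0\<close>.\<close>
  let ?n = "nat (1 - cont (inverse h))"
  have "x \<in> (\<lambda>k. g * k) ` Hp0" if "x \<in> gl2_ball ?n h" for x
  proof -
    have "inverse h * x \<in> gl2_ball 1 (inverse h * h)"
      using that by (rule gl2_ball_mult) simp
    then have k: "inverse h * x \<in> Hp0" using gl2_ball_1_Hp0 by auto
    obtain l where l: "l \<in> Hp0" "h = g * l" using h by blast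
    have "x = g * (l * (inverse h * x))" by (simp add: l(2) gl2_inverse_mult mult.assoc)
    then show ?thesis by (rule image_eqI) (rule Hp0_mult[OF l(1) k])
  qed
  then show "\<exists>n. gl2_ball n h \<subseteq> (\<lambda>k. g * k) ` Hp0" by blast
qed

lemma coset_Times: "coset g = (\<lambda>k. fst g * k) ` Hp0 \<times> (\<lambda>k. snd g * k) ` Hp0"
  by (auto simp: coset_def Gp0_def times_prod_def image_iff) 

lemma openin_coset: "openin Gp_topology (coset g)"
  unfolding coset_Times Gp_topology_def
  by (simp add: openin_prod_Times_iff openin_Hp_coset)

lemma topspace_Hp [simp]: "topspace Hp_topology = UNIV"
  using openin_Hp_topology[of UNIV] openin_subset[of Hp_topology UNIV] by auto

lemma topspace_Gp [simp]: "topspace Gp_topology = UNIV"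
  by (simp add: Gp_topology_def)

lemma continuous_map_Hp_translate:
  "continuous_map Hp_topology Hp_topology (\<lambda>h. g * h :: 'p::prime_card Hp)"
  unfolding continuous_map_def
proof (intro conjI allI impI)
  fix U :: "'p Hp set"
  assume U: "openin Hp_topology U"
  have "\<exists>n. gl2_ball n h \<subseteq> {x. g * x \<in> U}" if gh: "g * h \<in> U" for h
  proof -
    obtain n where n: "gl2_ball n (g * h) \<subseteq> U" using U gh by (auto simp: openin_Hp_topology)
    have "gl2_ball (nat (int n - cont g)) h \<subseteq> {x. g * x \<in> U}"
      using gl2_ball_mult[OF _ order_refl, of _ n g h] n by (intro subsetI CollectI) (rule subsetD)
    then show ?thesis by (rule exI)
  qed
  then show "openin Hp_topology {x \<in> topspace Hp_topology. g * x \<in> U}"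
    unfolding openin_Hp_topology by simp
qed simp

text \<open>
  Koenig's lemma on the tree of residues: if an open cover had no finite subcover, then there would
  be a descending sequence of residue classes without finite subcover, and hence a limit point
  covered by no member.
\<close>

definition residue :: "nat \<Rightarrow> 'p::prime_card padic_int gl2 \<Rightarrow> int \<times> int \<times> int \<times> int" where
  "residue n A = (Rep_padic_int (m11 A) n, Rep_padic_int (m12 A) n,
     Rep_padic_int (m21 A) n, Rep_padic_int (m22 A) n)"

lemma finite_range_residue: "finite (range (residue n :: 'p::prime_card padic_int gl2 \<Rightarrow> _))"
proof (rule finite_subset)
  let ?I = "{0 ..< int CARD('p) ^ n}"
  show "range (residue n :: 'p padic_int gl2 \<Rightarrow> _) \<subseteq> ?I \<times> ?I \<times> ?I \<times> ?I"
    by (auto simp: residue_def Rep_padic_int_range)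
qed simp

lemma residue_Suc:
  fixes A B :: "'p::prime_card padic_int gl2"
  assumes "residue (Suc n) A = residue (Suc n) B"
  shows "residue n A = residue n B"
proof -
  have "Rep_padic_int a n = Rep_padic_int b n" if "Rep_padic_int a (Suc n) = Rep_padic_int b (Suc n)"
    for a b :: "'p padic_int"
    using padic_int_coherent[of a n 1] padic_int_coherent[of b n 1] that by simp
  note * = this
  from assms show ?thesis unfolding residue_def prod.inject by (elim conjE) (intro conjI *)
qed

text \<open>The limit takes its \<open>n\<close>-th components from the \<open>n\<close>-th matrix.
  Invertibility survives because it is visible in the determinant modulo p.\<close>

lemma residue_limit:
  fixes A :: "nat \<Rightarrow> 'p::prime_card padic_int gl2"
  assumes "\<And>n. residue n (A (Suc n)) = residue n (A n)"
  shows "\<exists>B :: 'p padic_int gl2. \<forall>n. residue n B = residue n (A n)"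
proof -
  have lim: "\<exists>b :: 'p padic_int. \<forall>n. Rep_padic_int b n = Rep_padic_int (a n) n"
    if "\<And>n. Rep_padic_int (a (Suc n)) n = Rep_padic_int (a n) n" for a :: "nat \<Rightarrow> 'p padic_int"
  proof -
    let ?x = "\<lambda>n. Rep_padic_int (a n) n"
    have "?x (Suc n) mod int CARD('p) ^ n = ?x n" for n
      using padic_int_coherent[of "a (Suc n)" n 1] that[of n] by simp
    then have "Rep_padic_int (Abs_padic_int ?x :: 'p padic_int) = ?x"
      by (intro Abs_padic_int_inverse) (simp add: Rep_padic_int_range)
    then show ?thesis by (intro exI[of _ "Abs_padic_int ?x"]) simp
  qed
  obtain a b c d :: "'p padic_int" where e: "Rep_padic_int a n = Rep_padic_int (m11 (A n)) n"
    "Rep_padic_int b n = Rep_padic_int (m12 (A n)) n"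
    "Rep_padic_int c n = Rep_padic_int (m21 (A n)) n"
    "Rep_padic_int d n = Rep_padic_int (m22 (A n)) n" for n
  proof -
    have "\<exists>b :: 'p padic_int. \<forall>n. Rep_padic_int b n = Rep_padic_int (Rep_gl2 (A n) $ i $ j) n" for i j
      by (rule lim) (use assms exhaust_2[of i] exhaust_2[of j] in \<open>auto simp: residue_def\<close>)
    from this[of 1 1] this[of 1 2] this[of 2 1] this[of 2 2] show ?thesis using that by blast
  qed
  have "Rep_padic_int (a * d - b * c) 1 = Rep_padic_int (det2 (A 1)) 1"
    by (simp add: det2_def minus_padic_int.rep_eq times_padic_int.rep_eq e)
  then have "a * d - b * c dvd 1"
    using det2_dvd_1[of "A 1"] by (simp add: padic_int_unit_iff)
  then have "residue n (gl2_of a b c d) = residue n (A n)" for n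
    by (simp add: residue_def gl2_of_entries e)
  then show ?thesis by (intro exI allI)
qed

lemma compactin_Hp0: "compactin Hp_topology (Hp0 :: 'p::prime_card Hp set)"
  unfolding compactin_def
proof (intro conjI allI impI)
  fix \<U> :: "'p Hp set set"
  assume \<U>: "(\<forall>U\<in>\<U>. openin Hp_topology U) \<and> Hp0 \<subseteq> \<Union>\<U>"
  define lies where "lies A h \<longleftrightarrow> (\<forall>i j. Rep_gl2 h $ i $ j = to_fract (Rep_gl2 A $ i $ j))"
    for A :: "'p padic_int gl2" and h :: "'p Hp"
  \<comment> \<open>\<open>bad Z\<close> says that the part of \<open>Hp0\<close> lying over
    \<open>Z\<close> has no finite subcover.\<close>
  define bad where "bad Z \<longleftrightarrow> \<not> (\<exists>\<F>. finite \<F> \<and> \<F> \<subseteq> \<U> \<and> {h. \<exists>A\<in>Z. lies A h} \<subseteq> \<Union>\<F>)"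
    for Z :: "'p padic_int gl2 set"
  \<comment> \<open>There are finitely many residues at each level, so if every class in
    \<open>Z\<close> had a finite subcover, their union would be one for \<open>Z\<close>.\<close>
  have split: "\<exists>A\<in>Z. bad {B \<in> Z. residue n B = residue n A}" if "bad Z" for Z n
  proof (rule ccontr)
    assume "\<not> ?thesis"
    then have "\<forall>A\<in>Z. \<exists>\<F>. finite \<F> \<and> \<F> \<subseteq> \<U> \<and>
        {h. \<exists>B\<in>{B \<in> Z. residue n B = residue n A}. lies B h} \<subseteq> \<Union>\<F>"
      unfolding bad_def by blast
    from bchoice[OF this] obtain F where F: "\<forall>A\<in>Z. finite (F A) \<and> F A \<subseteq> \<U> \<and>
        {h. \<exists>B\<in>{B \<in> Z. residue n B = residue n A}. lies B h} \<subseteq> \<Union>(F A)" by (rule exE)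
    have "finite (residue n ` Z)" by (rule finite_subset[OF _ finite_range_residue]) blast
    then obtain Y where Y: "finite Y" "Y \<subseteq> Z" "residue n ` Z = residue n ` Y"
      by (metis finite_subset_image order_refl)
    have "finite (\<Union>(F ` Y))" "\<Union>(F ` Y) \<subseteq> \<U>" using F Y by blast+
    moreover have "{h. \<exists>B\<in>Z. lies B h} \<subseteq> \<Union>(\<Union>(F ` Y))"
    proof clarify
      fix h B assume B: "B \<in> Z" "lies B h"
      then obtain A where A: "A \<in> Y" "residue n B = residue n A" using Y(3) by (metis imageE imageI)
      have AZ: "A \<in> Z" using A(1) Y(2) by (rule subsetD[rotated])
      have "h \<in> {h. \<exists>B\<in>{B \<in> Z. residue n B = residue n A}. lies B h}"
        using B A(2) by (intro CollectI bexI[of _ B]) simp_all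
      then have "h \<in> \<Union>(F A)" using bspec[OF F AZ] by (elim conjE) (rule subsetD)
      then show "h \<in> \<Union>(\<Union>(F ` Y))" using A(1) by blast
    qed
    ultimately show False using that unfolding bad_def by blast
  qed
  show "\<exists>\<F>. finite \<F> \<and> \<F> \<subseteq> \<U> \<and> Hp0 \<subseteq> \<Union>\<F>"
  proof (rule ccontr)
    assume "\<not> ?thesis"
    moreover have "(Hp0 :: 'p Hp set) = {h. \<exists>A\<in>UNIV. lies A h}"
      by (simp add: Hp0_def lies_def)
    ultimately have "bad UNIV" unfolding bad_def by simp
    have "\<exists>A :: nat \<Rightarrow> 'p padic_int gl2. \<forall>n. bad {B. residue n B = residue n (A n)} \<and> residue n (A (Suc n)) = residue n (A n)"
    proof (rule dependent_nat_choice)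
      show "\<exists>A :: 'p padic_int gl2. bad {B. residue 0 B = residue 0 A}" using split[OF \<open>bad UNIV\<close>, of 0] by simp
      fix A :: "'p padic_int gl2" and n assume "bad {B. residue n B = residue n A}"
      from split[OF this, of "Suc n"] obtain A' :: "'p padic_int gl2" where A': "residue n A' = residue n A"
        "bad {B \<in> {B. residue n B = residue n A}. residue (Suc n) B = residue (Suc n) A'}" by blast
      have "{B \<in> {B. residue n B = residue n A}. residue (Suc n) B = residue (Suc n) A'} =
          ({B. residue (Suc n) B = residue (Suc n) A'} :: 'p padic_int gl2 set)"
      proof (intro subset_antisym subsetI)
        fix B :: "'p padic_int gl2" assume "B \<in> {B. residue (Suc n) B = residue (Suc n) A'}"
        then have "residue (Suc n) B = residue (Suc n) A'" by simp
        with residue_Suc[OF this] A'(1)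
        show "B \<in> {B \<in> {B. residue n B = residue n A}. residue (Suc n) B = residue (Suc n) A'}"
          by simp
      qed simp
      with A' show "\<exists>A' :: 'p padic_int gl2. bad {B. residue (Suc n) B = residue (Suc n) A'} \<and> residue n A' = residue n A"
        by (intro exI[of _ A']) simp
    qed
    then obtain A :: "nat \<Rightarrow> 'p padic_int gl2" where A: "\<And>n. bad {B. residue n B = residue n (A n)}"
      "\<And>n. residue n (A (Suc n)) = residue n (A n)" by blast
    from residue_limit[of A, OF A(2)]
    obtain B :: "'p padic_int gl2" where B: "\<forall>n. residue n B = residue n (A n)" by (rule exE)
    let ?D = "to_fract (det2 B)"
    let ?h = "gl2_of (to_fract (m11 B)) (to_fract (m12 B)) (to_fract (m21 B)) (to_fract (m22 B))"
    have "det2 B \<noteq> 0" using det2_dvd_1[of B] dvd_0_left[of "1 :: 'p padic_int"] by (intro notI) simp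
    then have "to_fract (m11 B) * to_fract (m22 B) - to_fract (m12 B) * to_fract (m21 B) \<noteq> 0"
      unfolding det2_def to_fract_mult[symmetric] to_fract_diff[symmetric] to_fract_eq_0_iff .
    then have h: "lies B ?h" unfolding lies_def by (simp add: forall_2)
    then have "?h \<in> Hp0" unfolding Hp0_def lies_def by blast
    then obtain U where U: "U \<in> \<U>" "?h \<in> U" using \<U> by blast
    then obtain n where n: "gl2_ball n ?h \<subseteq> U" using \<U> unfolding openin_Hp_topology by blast
    \<comment> \<open>The class of the limit point at level \<open>n\<close> lies in a ball inside
      the single member \<open>U\<close> of the cover, which contradicts its badness.\<close>
    have "{h. \<exists>B\<in>{B. residue n B = residue n (A n)}. lies B h} \<subseteq> U"
    proof clarify
      fix g C assume C: "residue n C = residue n (A n)" "lies C g"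
      have cong: "pdvd (int n) (to_fract x - to_fract y)"
        if "Rep_padic_int x n = Rep_padic_int y n" for x y :: "'p padic_int"
      proof -
        have "Rep_padic_int (x - y) n = 0" using that by (simp add: minus_padic_int.rep_eq)
        then obtain z where "x - y = of_nat CARD('p) ^ n * z"
          unfolding padic_int_dvd_power_iff[symmetric] by (rule dvdE)
        then have "to_fract x - to_fract y = pp powi int n * to_fract z"
          by (simp flip: to_fract_diff)
        then show ?thesis unfolding pdvd_def by blast
      qed
      have "residue n C = residue n B" using C B by simp
      then have "g \<in> gl2_ball n ?h"
        using C(2) h unfolding gl2_ball_iff lies_def residue_def by (simp add: cong)
      with n show "g \<in> U" by blast
    qed
    then have "\<not> bad {B. residue n B = residue n (A n)}"
      unfolding bad_def not_not using U(1) by (intro exI[of _ "{U}"] conjI) simp_all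
    with A(1) show False by blast
  qed
qed simp

lemma compactin_coset: "compactin Gp_topology (coset g)"
proof -
  have "compactin Hp_topology ((\<lambda>k. h * k) ` Hp0)" for h :: "'a Hp"
    by (rule image_compactin[OF compactin_Hp0 continuous_map_Hp_translate])
  then show ?thesis unfolding coset_Times Gp_topology_def by (simp add: compactin_Times)
qed

definition coset_finite :: "'p::prime_card Gp set \<Rightarrow> bool" where
  "coset_finite A \<longleftrightarrow> (\<exists>S. finite S \<and> A \<subseteq> (\<Union>s\<in>S. coset s))"

text \<open>Cosets are open, so a right invariant function is locally constant and its support is
  closed. The cover by cosets gives one direction, compactness of cosets the other.\<close>

lemma compact_support_iff:
  assumes "\<And>g k. k \<in> Gp0 \<Longrightarrow> \<theta> (g * k) = (\<theta> g :: real)"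
  shows "compactin Gp_topology (Gp_topology closure_of {g. \<theta> g \<noteq> 0}) \<longleftrightarrow> coset_finite {g. \<theta> g \<noteq> 0}"
proof -
  have const: "\<theta> x = \<theta> g" if "x \<in> coset g" for x g
    using that unfolding coset_def by (elim imageE) (simp only: assms)
  have "openin Gp_topology {g. \<theta> g = 0}"
  proof (rule openin_subopen[THEN iffD2], rule ballI)
    fix x assume x: "x \<in> {g. \<theta> g = 0}"
    have "coset x \<subseteq> {g. \<theta> g = 0}"
    proof
      fix y assume "y \<in> coset x"
      then have "\<theta> y = \<theta> x" by (rule const)
      with x show "y \<in> {g. \<theta> g = 0}" by simp
    qed
    then show "\<exists>T. openin Gp_topology T \<and> x \<in> T \<and> T \<subseteq> {g. \<theta> g = 0}"
      by (intro exI[of _ "coset x"]) (simp add: openin_coset)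
  qed
  then have closed: "closedin Gp_topology {g. \<theta> g \<noteq> 0}"
  proof -
    have "UNIV - {g. \<theta> g \<noteq> 0} = {g. \<theta> g = 0}" by blast
    then show ?thesis
      unfolding closedin_def topspace_Gp using \<open>openin Gp_topology {g. \<theta> g = 0}\<close> by simp
  qed
  then have eq: "Gp_topology closure_of {g. \<theta> g \<noteq> 0} = {g. \<theta> g \<noteq> 0}"
    by (rule closure_of_closedin)
  show ?thesis
  proof
    assume "compactin Gp_topology (Gp_topology closure_of {g. \<theta> g \<noteq> 0})"
    then have c: "compactin Gp_topology {g. \<theta> g \<noteq> 0}" unfolding eq .
    have "\<exists>\<F>. finite \<F> \<and> \<F> \<subseteq> range coset \<and> {g. \<theta> g \<noteq> 0} \<subseteq> \<Union>\<F>"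
      by (rule compactinD[OF c]) (auto intro: openin_coset coset_self)
    then show "coset_finite {g. \<theta> g \<noteq> 0}"
      unfolding coset_finite_def by (metis finite_subset_image)
  next
    assume "coset_finite {g. \<theta> g \<noteq> 0}"
    then obtain S where S: "finite S" "{g. \<theta> g \<noteq> 0} \<subseteq> (\<Union>s\<in>S. coset s)"
      unfolding coset_finite_def by blast
    have "compactin Gp_topology (\<Union>s\<in>S. coset s)"
      by (rule compactin_Union) (use S compactin_coset in auto)
    then show "compactin Gp_topology (Gp_topology closure_of {g. \<theta> g \<noteq> 0})"
      unfolding eq by (rule closed_compactin[OF _ S(2) closed])
  qed
qed

text \<open>Elements of \<open>Gp\<close> are pairs; quantifiers over them are kept whole so that
  the group laws apply.\<close>

declare split_paired_All [simp del] split_paired_Ex [simp del]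

section \<open>Integration over cosets\<close>

text \<open>Right invariance under \<open>Gp0\<close>, the hypothesis under which Haar integrals
  become sums over cosets.\<close>

definition rinv :: "('p::prime_card Gp \<Rightarrow> real) \<Rightarrow> bool" where
  "rinv \<phi> \<longleftrightarrow> (\<forall>g. \<forall>k\<in>Gp0. \<phi> (g * k) = \<phi> g)"

lemma rinvD: "rinv \<phi> \<Longrightarrow> k \<in> Gp0 \<Longrightarrow> \<phi> (g * k) = \<phi> g"
  by (simp add: rinv_def)

lemma rinv_coset: "rinv \<phi> \<Longrightarrow> x \<in> coset g \<Longrightarrow> \<phi> x = \<phi> g"
  unfolding coset_def by (elim imageE) (simp add: rinvD)

lemma rinv_translate: "rinv \<phi> \<Longrightarrow> rinv (\<lambda>g. \<phi> (h * g))"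
  by (simp add: rinv_def flip: mult.assoc)

lemma rinv_mult: "rinv \<phi> \<Longrightarrow> rinv \<psi> \<Longrightarrow> rinv (\<lambda>g. \<phi> g * \<psi> g)"
  by (simp add: rinv_def)

lemma coset_translate: "x \<in> coset (inverse h * s) \<longleftrightarrow> h * x \<in> coset s"
  by (simp add: coset_iff Gp_inverse_mult mult.assoc)

lemma coset_finite_transversal:
  fixes A :: "'p::prime_card Gp set"
  assumes "coset_finite A"
  shows "\<exists>S. finite S \<and> A \<subseteq> (\<Union>s\<in>S. coset s) \<and> inj_on coset S"
proof -
  obtain S where S: "finite S" "A \<subseteq> (\<Union>s\<in>S. coset s)"
    using assms unfolding coset_finite_def by (elim exE conjE)
  obtain U where U: "U \<subseteq> S" "inj_on coset U" "coset ` S = coset ` U"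
    using subset_image_inj[of "coset ` S" coset S] by auto
  have "A \<subseteq> (\<Union>s\<in>U. coset s)" using S(2) U(3) by simp
  then show ?thesis using finite_subset[OF U(1) S(1)] U(2) by (intro exI conjI)
qed

lemma coset_finite_subset: "coset_finite B \<Longrightarrow> A \<subseteq> B \<Longrightarrow> coset_finite A"
  unfolding coset_finite_def by (meson order_trans)

lemma coset_finite_UN: "finite I \<Longrightarrow> (\<And>i. i \<in> I \<Longrightarrow> coset_finite (A i)) \<Longrightarrow> coset_finite (\<Union>i\<in>I. A i)"
proof (induction I rule: finite_induct)
  case empty
  show ?case unfolding coset_finite_def by (intro exI[of _ "{}"]) simp
next
  case (insert i I)
  have "coset_finite (A i)" "coset_finite (\<Union>i\<in>I. A i)"
    using insert.IH insert.prems by simp_all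
  then obtain S T where "finite S" "A i \<subseteq> (\<Union>s\<in>S. coset s)" "finite T" "(\<Union>i\<in>I. A i) \<subseteq> (\<Union>s\<in>T. coset s)"
    unfolding coset_finite_def by (elim exE conjE)
  then show ?case unfolding coset_finite_def by (intro exI[of _ "S \<union> T"]) auto
qed

lemma coset_finite_coset [simp]: "coset_finite (coset g)"
  unfolding coset_finite_def by (intro exI[of _ "{g}"]) simp

lemma coset_finite_translate:
  assumes "coset_finite A"
  shows "coset_finite {x. h * x \<in> A}"
proof -
  obtain S where S: "finite S" "A \<subseteq> (\<Union>s\<in>S. coset s)"
    using assms unfolding coset_finite_def by (elim exE conjE)
  have "{x. h * x \<in> A} \<subseteq> (\<Union>s\<in>(\<lambda>s. inverse h * s) ` S. coset s)"
  proof
    fix x assume "x \<in> {x. h * x \<in> A}"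
    then have "h * x \<in> (\<Union>s\<in>S. coset s)" by (intro subsetD[OF S(2)]) simp
    then show "x \<in> (\<Union>s\<in>(\<lambda>s. inverse h * s) ` S. coset s)" by (simp add: coset_translate)
  qed
  then show ?thesis unfolding coset_finite_def
    using S(1) by (intro exI[of _ "(\<lambda>s. inverse h * s) ` S"] conjI finite_imageI)
qed

text \<open>Iwasawa provides an upper triangular representative. Its diagonal exponents add up to
  \<open>a\<close> and are at least \<open>b\<close>, and its off-diagonal entry, divisible by p^b,
  matters only modulo p^m; this leaves the finite list \<open>r m c\<close>.\<close>

lemma Hp_finite_cosets:
  "\<exists>S. finite S \<and> (\<forall>h. dval h = a \<and> cont h = b \<longrightarrow> (\<exists>s\<in>S. \<exists>k\<in>Hp0. h = s * (k :: 'p::prime_card Hp)))"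
proof -
  define r where "r m c = (gl2_of (pp powi m) (pp powi b * of_nat c) 0 (pp powi (a - m)) :: 'p Hp)"
    for m c
  define S where "S = (\<Union>m\<in>{b..a - b}. r m ` {..<CARD('p) ^ nat (m - b)})"
  have "\<exists>s\<in>S. \<exists>k\<in>Hp0. h = s * k" if h: "dval h = a" "cont h = b" for h
  proof -
    obtain m x n k where k: "k \<in> Hp0" and hk: "h = gl2_of (pp powi m) x 0 (pp powi n) * k"
      by (rule Hp_iwasawa)
    let ?u = "gl2_of (pp powi m) x 0 (pp powi n) :: 'p Hp"
    have u: "dval ?u = a" "cont ?u = b" using h k hk by simp_all
    have n: "n = a - m" using u(1) by (simp add: dval_def det2_gl2_of val_mult)
    have "pdvd b (pp powi m :: 'p padic)" "pdvd b x" "pdvd b (pp powi n :: 'p padic)"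
      using le_cont_iff[of b ?u] u(2) by simp_all
    then have b: "b \<le> m" "b \<le> n" "pdvd 0 (x / pp powi b)"
      by (simp_all add: pdvd_iff[of b "_ powi _"] pdvd_divide)
    obtain c where c: "c < CARD('p) ^ nat (m - b)" "pdvd (int (nat (m - b))) (x / pp powi b - of_nat c)"
      by (rule padic_residue[OF b(3)])
    have "x - pp powi b * of_nat c = pp powi b * (x / pp powi b - of_nat c)"
      by (simp add: algebra_simps)
    then have "pdvd m (x - pp powi b * of_nat c)" using c(2) b(1) by simp
    then have l: "gl2_of 1 ((x - pp powi b * of_nat c) / pp powi m) 0 1 \<in> (Hp0 :: 'p Hp set)"
      by (intro Hp0_gl2_of) (simp_all add: pdvd_divide)
    have "?u = r m c * gl2_of 1 ((x - pp powi b * of_nat c) / pp powi m) 0 1"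
      unfolding r_def n by (subst gl2_of_mult) simp_all
    then have "h = r m c * (gl2_of 1 ((x - pp powi b * of_nat c) / pp powi m) 0 1 * k)"
      unfolding hk by (simp only: mult.assoc)
    moreover have "r m c \<in> S" unfolding S_def using b n c(1) by auto
    ultimately show ?thesis using Hp0_mult[OF l k] by blast
  qed
  moreover have "finite S" unfolding S_def by simp
  ultimately show ?thesis by blast
qed

text \<open>Finiteness of the number of left cosets in a double coset of \<open>Gp0\<close>, phrased
  through the Cartan invariants.\<close>

lemma coset_finite_invariants:
  "coset_finite {g :: 'p::prime_card Gp. dval (fst g) = a \<and> cont (fst g) = b \<and> dval (snd g) = c \<and> cont (snd g) = d}"
proof -
  obtain S where S: "finite S" "\<And>h :: 'p Hp. dval h = a \<Longrightarrow> cont h = b \<Longrightarrow> \<exists>s\<in>S. \<exists>k\<in>Hp0. h = s * k"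
    using Hp_finite_cosets[of a b] by auto
  obtain T where T: "finite T" "\<And>h :: 'p Hp. dval h = c \<Longrightarrow> cont h = d \<Longrightarrow> \<exists>s\<in>T. \<exists>k\<in>Hp0. h = s * k"
    using Hp_finite_cosets[of c d] by auto
  have "{g :: 'p::prime_card Gp. dval (fst g) = a \<and> cont (fst g) = b \<and> dval (snd g) = c \<and> cont (snd g) = d}
    \<subseteq> (\<Union>s\<in>S \<times> T. coset s)"
  proof
    fix g :: "'p Gp"
    assume "g \<in> {g. dval (fst g) = a \<and> cont (fst g) = b \<and> dval (snd g) = c \<and> cont (snd g) = d}"
    then have g: "dval (fst g) = a" "cont (fst g) = b" "dval (snd g) = c" "cont (snd g) = d" by simp_all
    obtain s k where s: "s \<in> S" "k \<in> Hp0" "fst g = s * k" using S(2)[OF g(1,2)] by (elim bexE)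
    obtain t l where t: "t \<in> T" "l \<in> Hp0" "snd g = t * l" using T(2)[OF g(3,4)] by (elim bexE)
    have "g \<in> coset (s, t)"
      unfolding coset_iff using s t by (simp add: Gp0_iff)
    then show "g \<in> (\<Union>s\<in>S \<times> T. coset s)" using s(1) t(1) by blast
  qed
  then show ?thesis unfolding coset_finite_def using S(1) T(1) by (intro exI[of _ "S \<times> T"] conjI finite_cartesian_product)
qed

lemma inj_coset_unique: "inj_on coset S \<Longrightarrow> s \<in> S \<Longrightarrow> t \<in> S \<Longrightarrow> x \<in> coset s \<Longrightarrow> x \<in> coset t \<Longrightarrow> s = t"
  using coset_eq[of x s] coset_eq[of x t] by (simp add: inj_on_def)

section \<open>The carrier of the Hecke algebra and the scalars\<close>

definition hecke_carrier :: "('p::prime_card Gp \<Rightarrow> real) set" where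
  "hecke_carrier = {\<theta>. range \<theta> \<subseteq> Z_inv CARD('p) \<and> (\<forall>k\<in>Gp0. \<forall>l\<in>Gp0. \<forall>g. \<theta> (k * g * l) = \<theta> g) \<and>
     coset_finite {g. \<theta> g \<noteq> 0}}"

text \<open>\<open>coset_finite\<close> replaces the topological condition once and for all, and the
  carrier is seen to be independent of \<open>\<mu>\<close>.\<close>

lemma carrier_hecke: "carrier (hecke \<mu>) = (hecke_carrier :: ('p::prime_card Gp \<Rightarrow> real) set)"
proof -
  have "compactin Gp_topology (Gp_topology closure_of {g. \<theta> g \<noteq> 0}) \<longleftrightarrow> coset_finite {g. \<theta> g \<noteq> 0}"
    if "\<forall>k\<in>Gp0. \<forall>l\<in>Gp0. \<forall>g. \<theta> (k * g * l) = \<theta> g" for \<theta> :: "'p Gp \<Rightarrow> real"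
  proof (rule compact_support_iff)
    fix g k :: "'p Gp" assume "k \<in> Gp0"
    then show "\<theta> (g * k) = \<theta> g" using that[rule_format, OF Gp0_one] by simp
  qed
  then show ?thesis unfolding hecke_def hecke_carrier_def by auto
qed

lemma hecke_carrierD:
  fixes \<theta> :: "'p::prime_card Gp \<Rightarrow> real"
  assumes "\<theta> \<in> hecke_carrier"
  shows "\<theta> g \<in> Z_inv CARD('p)" "k \<in> Gp0 \<Longrightarrow> \<theta> (k * g) = \<theta> g" "rinv \<theta>" "coset_finite {g. \<theta> g \<noteq> 0}"
proof -
  have *: "\<And>k l g. k \<in> Gp0 \<Longrightarrow> l \<in> Gp0 \<Longrightarrow> \<theta> (k * g * l) = \<theta> g"
    using assms unfolding hecke_carrier_def by simp
  show "k \<in> Gp0 \<Longrightarrow> \<theta> (k * g) = \<theta> g" using *[of k 1 g] by simp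
  show "rinv \<theta>" unfolding rinv_def using *[of 1] by simp
  show "\<theta> g \<in> Z_inv CARD('p)" "coset_finite {g. \<theta> g \<noteq> 0}"
    using assms unfolding hecke_carrier_def by auto
qed

lemma hecke_carrierI:
  fixes \<theta> :: "'p::prime_card Gp \<Rightarrow> real"
  assumes "\<And>g. \<theta> g \<in> Z_inv CARD('p)" "\<And>k g. k \<in> Gp0 \<Longrightarrow> \<theta> (k * g) = \<theta> g"
    "\<And>k g. k \<in> Gp0 \<Longrightarrow> \<theta> (g * k) = \<theta> g" "coset_finite {g. \<theta> g \<noteq> 0}"
  shows "\<theta> \<in> hecke_carrier"
  unfolding hecke_carrier_def using assms by auto

text \<open>By the Cartan decomposition the four numbers determine the double coset, on which
  \<open>\<theta>\<close> is constant.\<close>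

lemma hecke_cartan:
  fixes \<theta> :: "'p::prime_card Gp \<Rightarrow> real"
  assumes \<theta>: "\<theta> \<in> hecke_carrier"
    and "dval (fst g) = dval (fst h)" "cont (fst g) = cont (fst h)"
      "dval (snd g) = dval (snd h)" "cont (snd g) = cont (snd h)"
  shows "\<theta> g = \<theta> h"
proof -
  define d where "d x = (gl2_of (pp powi (dval x - cont x)) 0 0 (pp powi cont x) :: 'p Hp)" for x :: "'p Hp"
  have *: "\<theta> g = \<theta> (d (fst g), d (snd g))" for g
  proof -
    obtain k l where kl: "k \<in> Hp0" "l \<in> Hp0" "fst g = k * d (fst g) * l"
      unfolding d_def by (rule Hp_cartan)
    obtain k' l' where kl': "k' \<in> Hp0" "l' \<in> Hp0" "snd g = k' * d (snd g) * l'"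
      unfolding d_def by (rule Hp_cartan)
    have "g = (k, k') * (d (fst g), d (snd g)) * (l, l')"
      using kl(3) kl'(3) by (intro prod_eqI) simp_all
    moreover have "(k, k') \<in> Gp0" "(l, l') \<in> Gp0" using kl kl' by (simp_all add: Gp0_iff)
    ultimately show ?thesis
      by (metis hecke_carrierD(2,3)[OF \<theta>] rinvD)
  qed
  show ?thesis unfolding *[of g] *[of h] d_def assms ..
qed

lemma Z_inv_of_int [simp]: "of_int a \<in> Z_inv p"
  unfolding Z_inv_def by (intro CollectI exI[of _ a] exI[of _ 0]) simp

lemma Z_inv_0 [simp]: "0 \<in> Z_inv p" and Z_inv_1 [simp]: "1 \<in> Z_inv p"
  using Z_inv_of_int[of 0 p] Z_inv_of_int[of 1 p] by simp_all

lemma Z_inv_mult: "x \<in> Z_inv p \<Longrightarrow> y \<in> Z_inv p \<Longrightarrow> x * y \<in> Z_inv p"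
proof -
  assume "x \<in> Z_inv p" "y \<in> Z_inv p"
  then obtain a k b l where "x = of_int a / of_nat p ^ k" "y = of_int b / of_nat p ^ l"
    unfolding Z_inv_def by auto
  then have "x * y = of_int (a * b) / of_nat p ^ (k + l)" by (simp add: power_add)
  then show ?thesis unfolding Z_inv_def by blast
qed

lemma Z_inv_add:
  assumes "p > 0" "x \<in> Z_inv p" "y \<in> Z_inv p"
  shows "x + y \<in> Z_inv p"
proof -
  obtain a k b l where "x = of_int a / of_nat p ^ k" "y = of_int b / of_nat p ^ l"
    using assms unfolding Z_inv_def by auto
  then have "x + y = of_int (a * int p ^ l + b * int p ^ k) / of_nat p ^ (k + l)"
    using assms(1) by (simp add: power_add add_divide_distrib)
  then show ?thesis unfolding Z_inv_def by blast
qed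

lemma Z_inv_uminus: "x \<in> Z_inv p \<Longrightarrow> - x \<in> Z_inv p"
  using Z_inv_mult[OF Z_inv_of_int[of "-1" p]] by simp

lemma Z_inv_sum: "p > 0 \<Longrightarrow> (\<And>i. i \<in> I \<Longrightarrow> f i \<in> Z_inv p) \<Longrightarrow> sum f I \<in> Z_inv p"
  by (induction I rule: infinite_finite_induct) (auto intro: Z_inv_add)

lemma Z_inv_inverse: "1 / of_nat p \<in> Z_inv p"
  unfolding Z_inv_def by (intro CollectI exI[of _ 1]) simp

lemma hecke_dual_dual [simp]: "hecke_dual (hecke_dual \<theta>) = \<theta>"
  by (simp add: hecke_dual_def)

text \<open>Inversion turns left cosets into right cosets, so finiteness of the support is passed
  through the Cartan invariants, which transform by explicit formulas.\<close>

lemma hecke_dual_carrier: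
  fixes \<theta> :: "'p::prime_card Gp \<Rightarrow> real"
  assumes \<theta>: "\<theta> \<in> hecke_carrier"
  shows "hecke_dual \<theta> \<in> hecke_carrier"
proof (rule hecke_carrierI)
  let ?i = "\<lambda>g :: 'p Gp. (dval (fst g), cont (fst g), dval (snd g), cont (snd g))"
  obtain S where S: "finite S" "{g. \<theta> g \<noteq> 0} \<subseteq> (\<Union>s\<in>S. coset s)"
    using hecke_carrierD(4)[OF \<theta>] unfolding coset_finite_def by (elim exE conjE)
  define A where "A s = {g :: 'p Gp. dval (fst g) = - dval (fst s) \<and> cont (fst g) = cont (fst s) - dval (fst s)
    \<and> dval (snd g) = - dval (snd s) \<and> cont (snd g) = cont (snd s) - dval (snd s)}" for s :: "'p Gp"
  have "g \<in> (\<Union>s\<in>S. A s)" if "hecke_dual \<theta> g \<noteq> 0" for g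
  proof -
    have "inverse g \<in> (\<Union>s\<in>S. coset s)"
      using that by (intro subsetD[OF S(2)]) (simp add: hecke_dual_def)
    then obtain s where s: "s \<in> S" "inverse g \<in> coset s" by (elim UN_E)
    then obtain k where k: "k \<in> Gp0" "inverse g = s * k" unfolding coset_def by (elim imageE)
    have "g = inverse k * inverse s" using arg_cong[OF k(2), of inverse] by (simp add: Gp_inverse_mult)
    moreover have "fst (inverse k) \<in> Hp0" "snd (inverse k) \<in> Hp0"
      using Gp0_inverse[OF k(1)] unfolding Gp0_iff by simp_all
    ultimately have "g \<in> A s" unfolding A_def by (simp add: dval_inverse cont_inverse)
    with s(1) show ?thesis by blast
  qed
  then have "{g. hecke_dual \<theta> g \<noteq> 0} \<subseteq> (\<Union>s\<in>S. A s)" by blast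
  moreover have "coset_finite (\<Union>s\<in>S. A s)"
    unfolding A_def by (intro coset_finite_UN S(1) coset_finite_invariants)
  ultimately show "coset_finite {g. hecke_dual \<theta> g \<noteq> 0}" by (rule coset_finite_subset[rotated])
qed (use hecke_carrierD[OF \<theta>] in \<open>simp_all add: hecke_dual_def Gp_inverse_mult rinvD Gp0_inverse\<close>)

lemma card_pos: "0 < CARD('p::prime_card)"
  using card_gt_1[where ?'p = 'p] by simp

lemma hecke_const_carrier: "c \<in> Z_inv CARD('p) \<Longrightarrow> hecke_const c \<in> (hecke_carrier :: ('p::prime_card Gp \<Rightarrow> real) set)"
proof (rule hecke_carrierI)
  have *: "k * g \<in> Gp0 \<longleftrightarrow> g \<in> Gp0" "g * k \<in> Gp0 \<longleftrightarrow> g \<in> Gp0" if k: "k \<in> Gp0" for k g :: "'p Gp"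
  proof -
    have "inverse k * (k * g) = g" "g * k * inverse k = g" by (simp_all add: mult.assoc)
    then show "k * g \<in> Gp0 \<longleftrightarrow> g \<in> Gp0" "g * k \<in> Gp0 \<longleftrightarrow> g \<in> Gp0"
      using Gp0_mult[OF k] Gp0_mult[OF Gp0_inverse[OF k]] Gp0_mult[OF _ k] Gp0_mult[OF _ Gp0_inverse[OF k]]
      by metis+
  qed
  show "hecke_const c (k * g) = hecke_const c g" "hecke_const c (g * k) = hecke_const c g"
    if "k \<in> Gp0" for k g :: "'p Gp" using * that by (simp_all add: hecke_const_def indicator_def)
  have "{g :: 'p Gp. hecke_const c g \<noteq> 0} \<subseteq> coset 1"
    by (rule subsetI) (simp add: hecke_const_def coset_iff indicator_def split: if_splits)
  then show "coset_finite {g :: 'p Gp. hecke_const c g \<noteq> 0}" by (rule coset_finite_subset[rotated]) simp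
qed (simp add: hecke_const_def indicator_def)

lemma hecke_dual_const [simp]: "hecke_dual (hecke_const c) = (hecke_const c :: 'p::prime_card Gp \<Rightarrow> real)"
proof -
  have "inverse g \<in> Gp0 \<longleftrightarrow> g \<in> Gp0" for g :: "'p Gp"
    using Gp0_inverse[of g] Gp0_inverse[of "inverse g"] by (metis Gp_inverse(5))
  then show ?thesis unfolding hecke_dual_def hecke_const_def indicator_def by simp
qed

section \<open>Haar integrals as sums over cosets\<close>

locale haar =
  fixes \<mu> :: "'p::prime_card Gp measure"
  assumes haar: "haar_measure \<mu>"
begin

lemma coset_measurable: "coset g \<in> sets \<mu>"
proof -
  have "sets \<mu> = sigma_sets UNIV {U. openin Gp_topology U}" using haar by (simp add: haar_measure_def)
  then show ?thesis using openin_coset[of g] by (simp add: sigma_sets.Basic)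
qed

lemma emeasure_coset: "emeasure \<mu> (coset g) = 1"
proof -
  have "coset (1 :: 'p Gp) = Gp0" by (simp add: coset_def)
  then have "Gp0 \<in> sets \<mu>" using coset_measurable[of 1] by simp
  then show ?thesis using haar unfolding haar_measure_def coset_def by simp
qed

text \<open>The function is a finite linear combination of indicators of disjoint cosets, each of
  measure one.\<close>

lemma has_bochner_integral_cosets:
  assumes \<phi>: "rinv \<phi>" and S: "finite S" "inj_on coset S" "{g. \<phi> g \<noteq> 0} \<subseteq> (\<Union>s\<in>S. coset s)"
  shows "has_bochner_integral \<mu> \<phi> (\<Sum>s\<in>S. \<phi> s)"
proof -
  have "(\<Sum>s\<in>S. \<phi> s * indicat_real (coset s) x) = \<phi> x" for x
  proof (cases "\<exists>s\<in>S. x \<in> coset s")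
    case True
    then obtain s where s: "s \<in> S" "x \<in> coset s" by (elim bexE)
    have "(\<Sum>t\<in>S. \<phi> t * indicat_real (coset t) x) = (\<Sum>t\<in>S. if t = s then \<phi> s else 0)"
    proof (rule sum.cong)
      fix t assume t: "t \<in> S"
      show "\<phi> t * indicat_real (coset t) x = (if t = s then \<phi> s else 0)"
      proof (cases "t = s")
        case False
        have "x \<notin> coset t"
        proof
          assume "x \<in> coset t"
          from inj_coset_unique[OF S(2) t s(1) this s(2)] False show False by simp
        qed
        with False show ?thesis by simp
      qed (use s(2) in simp)
    qed simp
    also have "\<dots> = \<phi> s" using s(1) S(1) by simp
    also have "\<dots> = \<phi> x" using rinv_coset[OF \<phi> s(2)] by simp
    finally show ?thesis .
  next
    case False
    then have "x \<notin> (\<Union>s\<in>S. coset s)" by simp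
    then have "x \<notin> {g. \<phi> g \<noteq> 0}" using S(3) by (rule contra_subsetD[rotated])
    then have "\<phi> x = 0" by simp
    moreover have "(\<Sum>t\<in>S. \<phi> t * indicat_real (coset t) x) = 0"
      using False by (intro sum.neutral) simp
    ultimately show ?thesis by simp
  qed
  moreover have "has_bochner_integral \<mu> (\<lambda>x. \<Sum>s\<in>S. \<phi> s * indicat_real (coset s) x)
      (\<Sum>s\<in>S. \<phi> s * measure \<mu> (coset s))"
    by (intro has_bochner_integral_sum has_bochner_integral_mult_right has_bochner_integral_real_indicator
        coset_measurable) (simp add: emeasure_coset)
  ultimately show ?thesis by (simp add: measure_def emeasure_coset)
qed

lemma integral_cosets:
  assumes "rinv \<phi>" "finite S" "inj_on coset S" "{g. \<phi> g \<noteq> 0} \<subseteq> (\<Union>s\<in>S. coset s)"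
  shows "(LINT g|\<mu>. \<phi> g) = (\<Sum>s\<in>S. \<phi> s)"
  using has_bochner_integral_cosets[OF assms] by (simp add: has_bochner_integral_integral_eq)

lemma integrable_cosets:
  assumes "rinv \<phi>" "coset_finite {g. \<phi> g \<noteq> 0}"
  shows "integrable \<mu> \<phi>"
proof -
  obtain S where "finite S" "{g. \<phi> g \<noteq> 0} \<subseteq> (\<Union>s\<in>S. coset s)" "inj_on coset S"
    using coset_finite_transversal[OF assms(2)] by (elim exE conjE)
  from has_bochner_integral_cosets[OF assms(1) this(1,3,2)] show ?thesis
    by (rule integrable.intros)
qed

text \<open>Translating a transversal of the support gives a transversal of the translated support,
  so the two sums have the same terms.\<close>

lemma integral_translate:
  assumes \<phi>: "rinv \<phi>" "coset_finite {g. \<phi> g \<noteq> 0}"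
  shows "(LINT g|\<mu>. \<phi> (h * g)) = (LINT g|\<mu>. \<phi> g)"
proof -
  obtain S where S: "finite S" "{g. \<phi> g \<noteq> 0} \<subseteq> (\<Union>s\<in>S. coset s)" "inj_on coset S"
    using coset_finite_transversal[OF \<phi>(2)] by (elim exE conjE)
  let ?t = "\<lambda>s. inverse h * s"
  have inj: "inj_on ?t S"
  proof (rule inj_onI)
    fix x y assume "?t x = ?t y"
    then have "h * ?t x = h * ?t y" by simp
    then show "x = y" by simp
  qed
  have "(LINT g|\<mu>. \<phi> (h * g)) = (\<Sum>s\<in>?t ` S. \<phi> (h * s))"
  proof (rule integral_cosets)
    show "rinv (\<lambda>g. \<phi> (h * g))" using \<phi>(1) by (rule rinv_translate)
    show "finite (?t ` S)" using S(1) by simp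
    show "{g. \<phi> (h * g) \<noteq> 0} \<subseteq> (\<Union>s\<in>?t ` S. coset s)"
    proof
      fix x assume "x \<in> {g. \<phi> (h * g) \<noteq> 0}"
      then have "h * x \<in> (\<Union>s\<in>S. coset s)" by (intro subsetD[OF S(2)]) simp
      then show "x \<in> (\<Union>s\<in>?t ` S. coset s)" by (simp add: coset_translate)
    qed
    show "inj_on coset (?t ` S)"
    proof (rule inj_onI, elim imageE)
      fix x y s t assume *: "coset x = coset y" "x = ?t s" "s \<in> S" "y = ?t t" "t \<in> S"
      have "x \<in> coset y" using *(1) coset_self[of x] by simp
      then have "s \<in> coset t" unfolding *(4) coset_translate using *(2) by simp
      then have "s = t" using inj_coset_unique[OF S(3) *(3) *(5) coset_self] by simp
      then show "x = y" using * by simp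
    qed
  qed
  also have "\<dots> = (\<Sum>s\<in>S. \<phi> s)" by (simp add: sum.reindex[OF inj])
  also have "\<dots> = (LINT g|\<mu>. \<phi> g)" by (rule integral_cosets[OF \<phi>(1) S(1,3,2), symmetric])
  finally show ?thesis .
qed

section \<open>The Hecke algebra and its action\<close>

lemma hecke_action_sum:
  fixes \<theta> :: "'p Gp \<Rightarrow> real"
  assumes "rinv \<theta>" "rinv f" "finite S" "inj_on coset S" "{g. \<theta> g \<noteq> 0} \<subseteq> (\<Union>s\<in>S. coset s)"
  shows "hecke_action \<mu> \<theta> f x = (\<Sum>s\<in>S. \<theta> s * f (x * s))"
  unfolding hecke_action_def
proof (rule integral_cosets)
  show "rinv (\<lambda>g. \<theta> g * f (x * g))" using assms by (intro rinv_mult rinv_translate)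
  have "{g. \<theta> g * f (x * g) \<noteq> 0} \<subseteq> {g. \<theta> g \<noteq> 0}" by (rule Collect_mono) simp
  with assms(5) show "{g. \<theta> g * f (x * g) \<noteq> 0} \<subseteq> (\<Union>s\<in>S. coset s)" by (rule order_trans[rotated])
qed fact+

lemma hecke_integrand:
  assumes "\<theta> \<in> hecke_carrier" "rinv f"
  shows "rinv (\<lambda>g. \<theta> g * f (x * g))" "coset_finite {g. \<theta> g * f (x * g) \<noteq> 0}"
    "integrable \<mu> (\<lambda>g. \<theta> g * f (x * g))"
proof -
  show 1: "rinv (\<lambda>g. \<theta> g * f (x * g))"
    using assms hecke_carrierD(3) by (intro rinv_mult rinv_translate)
  show 2: "coset_finite {g. \<theta> g * f (x * g) \<noteq> 0}"
    using hecke_carrierD(4)[OF assms(1)] by (rule coset_finite_subset) (rule Collect_mono, simp)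
  show "integrable \<mu> (\<lambda>g. \<theta> g * f (x * g))" using 1 2 by (rule integrable_cosets)
qed

lemma hecke_action_rinv:
  assumes \<theta>: "\<theta> \<in> hecke_carrier" and f: "rinv f"
  shows "rinv (hecke_action \<mu> \<theta> f)"
  unfolding rinv_def
proof (intro allI ballI)
  fix x k :: "'p Gp" assume k: "k \<in> Gp0"
  have "hecke_action \<mu> \<theta> f x = (LINT g|\<mu>. \<theta> (k * g) * f (x * (k * g)))"
    unfolding hecke_action_def by (rule integral_translate[OF hecke_integrand(1,2)[OF assms], symmetric])
  also have "\<dots> = hecke_action \<mu> \<theta> f (x * k)"
    by (simp add: hecke_action_def hecke_carrierD(2)[OF \<theta> k] mult.assoc)
  finally show "hecke_action \<mu> \<theta> f (x * k) = hecke_action \<mu> \<theta> f x" ..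
qed

lemma hecke_transversal:
  assumes "\<theta> \<in> hecke_carrier"
  shows "\<exists>S. finite S \<and>
    (\<forall>f x. rinv f \<longrightarrow> hecke_action \<mu> \<theta> f x = (\<Sum>s\<in>S. \<theta> s * f (x * s)))"
proof -
  obtain S where S: "finite S" "{g. \<theta> g \<noteq> 0} \<subseteq> (\<Union>s\<in>S. coset s)" "inj_on coset S"
    using coset_finite_transversal[OF hecke_carrierD(4)[OF assms]] by (elim exE conjE)
  then show ?thesis using hecke_action_sum[OF hecke_carrierD(3)[OF assms]] by (intro exI[of _ S]) simp
qed

text \<open>Convolution is the action on the dual function, read at the inverse point. Associativity
  and distributivity of convolution are inherited from the action in this way.\<close>

lemma convolution_eq_action:
  "convolution \<mu> \<theta> \<eta> x = hecke_action \<mu> \<theta> (hecke_dual \<eta>) (inverse x)"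
  by (simp add: convolution_def hecke_action_def hecke_dual_def Gp_inverse_mult)

lemma hecke_dual_convolution: "hecke_dual (convolution \<mu> \<theta> \<eta>) = hecke_action \<mu> \<theta> (hecke_dual \<eta>)"
  by (simp add: fun_eq_iff convolution_eq_action hecke_dual_def[of "convolution _ _ _"])

lemma convolution_sum:
  assumes \<theta>: "\<theta> \<in> hecke_carrier"
  shows "\<exists>S. finite S \<and> (\<forall>\<eta> x. \<eta> \<in> hecke_carrier \<longrightarrow>
    convolution \<mu> \<theta> \<eta> x = (\<Sum>s\<in>S. \<theta> s * \<eta> (inverse s * x)))"
proof -
  obtain S where S: "finite S" "\<forall>f x. rinv f \<longrightarrow> hecke_action \<mu> \<theta> f x = (\<Sum>s\<in>S. \<theta> s * f (x * s))"
    using hecke_transversal[OF \<theta>] by (elim exE conjE)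
  have "convolution \<mu> \<theta> \<eta> x = (\<Sum>s\<in>S. \<theta> s * \<eta> (inverse s * x))" if "\<eta> \<in> hecke_carrier" for \<eta> x
    unfolding convolution_eq_action
    using S(2) hecke_carrierD(3)[OF hecke_dual_carrier[OF that]]
    by (simp add: hecke_dual_def Gp_inverse_mult)
  with S(1) show ?thesis by (intro exI[of _ S]) simp
qed

text \<open>Expanding the convolution over a finite transversal of \<open>\<theta>\<close> replaces
  Fubini by the exchange of a finite sum with an integral; each inner integral is then translated by
  \<open>s\<close>.\<close>

lemma hecke_action_convolution:
  assumes \<theta>: "\<theta> \<in> hecke_carrier" and \<eta>: "\<eta> \<in> hecke_carrier" and f: "rinv f"
  shows "hecke_action \<mu> (convolution \<mu> \<theta> \<eta>) f = hecke_action \<mu> \<theta> (hecke_action \<mu> \<eta> f)"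
proof
  fix x
  obtain S where S: "finite S" "\<forall>f x. rinv f \<longrightarrow> hecke_action \<mu> \<theta> f x = (\<Sum>s\<in>S. \<theta> s * f (x * s))"
    using hecke_transversal[OF \<theta>] by (elim exE conjE)
  have conv: "convolution \<mu> \<theta> \<eta> y = (\<Sum>s\<in>S. \<theta> s * \<eta> (inverse s * y))" for y
    unfolding convolution_eq_action
    using S(2) hecke_carrierD(3)[OF hecke_dual_carrier[OF \<eta>]]
    by (simp add: hecke_dual_def Gp_inverse_mult)
  define \<psi> where "\<psi> s = (\<lambda>g. \<eta> g * f (x * s * g))" for s
  have \<psi>: "rinv (\<psi> s)" "coset_finite {g. \<psi> s g \<noteq> 0}" for s
    unfolding \<psi>_def using \<eta> f by (rule hecke_integrand)+
  have rinv_t: "rinv (\<lambda>g. \<psi> s (inverse s * g))" for s by (rule rinv_translate[OF \<psi>(1)])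
  have "coset_finite {g. \<psi> s (inverse s * g) \<noteq> 0}" for s
    using coset_finite_translate[OF \<psi>(2)[of s], of "inverse s"] by simp
  then have int: "integrable \<mu> (\<lambda>g. \<psi> s (inverse s * g))" for s
    by (rule integrable_cosets[OF rinv_t])
  have "hecke_action \<mu> (convolution \<mu> \<theta> \<eta>) f x = (LINT g|\<mu>. (\<Sum>s\<in>S. \<theta> s * \<psi> s (inverse s * g)))"
    unfolding hecke_action_def conv \<psi>_def by (simp add: sum_distrib_right mult.assoc)
  also have "\<dots> = (\<Sum>s\<in>S. \<theta> s * (LINT g|\<mu>. \<psi> s (inverse s * g)))"
    using int by simp
  also have "\<dots> = (\<Sum>s\<in>S. \<theta> s * (LINT g|\<mu>. \<psi> s g))"
    by (simp only: integral_translate[OF \<psi>])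
  also have "\<dots> = (\<Sum>s\<in>S. \<theta> s * hecke_action \<mu> \<eta> f (x * s))"
    by (simp only: \<psi>_def hecke_action_def)
  also have "\<dots> = hecke_action \<mu> \<theta> (hecke_action \<mu> \<eta> f) x"
    using S(2) hecke_action_rinv[OF \<eta> f] by simp
  finally show "hecke_action \<mu> (convolution \<mu> \<theta> \<eta>) f x = hecke_action \<mu> \<theta> (hecke_action \<mu> \<eta> f) x" .
qed

lemma convolution_carrier:
  assumes \<theta>: "\<theta> \<in> hecke_carrier" and \<eta>: "\<eta> \<in> hecke_carrier"
  shows "convolution \<mu> \<theta> \<eta> \<in> hecke_carrier"
proof (rule hecke_carrierI)
  obtain S where S: "finite S" "\<forall>\<eta> x. \<eta> \<in> hecke_carrier \<longrightarrow>
      convolution \<mu> \<theta> \<eta> x = (\<Sum>s\<in>S. \<theta> s * \<eta> (inverse s * x))"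
    using convolution_sum[OF \<theta>] by (elim exE conjE)
  have conv: "convolution \<mu> \<theta> \<eta> x = (\<Sum>s\<in>S. \<theta> s * \<eta> (inverse s * x))" for x using S(2) \<eta> by simp
  show "convolution \<mu> \<theta> \<eta> g \<in> Z_inv CARD('p)" for g
    unfolding conv using hecke_carrierD(1)[OF \<theta>] hecke_carrierD(1)[OF \<eta>]
    by (intro Z_inv_sum card_pos Z_inv_mult)
  show "convolution \<mu> \<theta> \<eta> (g * k) = convolution \<mu> \<theta> \<eta> g" if "k \<in> Gp0" for g k
    unfolding conv mult.assoc[symmetric] rinvD[OF hecke_carrierD(3)[OF \<eta>] that] ..
  \<comment> \<open>Left invariance becomes right invariance of the action at the inverse
    point.\<close>
  show "convolution \<mu> \<theta> \<eta> (k * g) = convolution \<mu> \<theta> \<eta> g" if "k \<in> Gp0" for g k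
    unfolding convolution_eq_action Gp_inverse_mult
    by (rule rinvD[OF hecke_action_rinv Gp0_inverse])
      (use \<theta> \<eta> that hecke_carrierD(3)[OF hecke_dual_carrier] in simp_all)
  have "{g. convolution \<mu> \<theta> \<eta> g \<noteq> 0} \<subseteq> (\<Union>s\<in>S. {g. inverse s * g \<in> {g. \<eta> g \<noteq> 0}})"
  proof
    fix g assume "g \<in> {g. convolution \<mu> \<theta> \<eta> g \<noteq> 0}"
    then have "(\<Sum>s\<in>S. \<theta> s * \<eta> (inverse s * g)) \<noteq> 0" unfolding conv by simp
    then obtain s where s: "s \<in> S" "\<theta> s * \<eta> (inverse s * g) \<noteq> 0" by (rule sum.not_neutral_contains_not_neutral)
    then have "\<eta> (inverse s * g) \<noteq> 0" by simp
    then show "g \<in> (\<Union>s\<in>S. {g. inverse s * g \<in> {g. \<eta> g \<noteq> 0}})" by (intro UN_I[OF s(1)]) simp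
  qed
  then show "coset_finite {g. convolution \<mu> \<theta> \<eta> g \<noteq> 0}"
    by (rule coset_finite_subset[rotated])
      (intro coset_finite_UN S(1) coset_finite_translate hecke_carrierD(4)[OF \<eta>])
qed

lemma hecke_action_add_left:
  assumes "\<theta> \<in> hecke_carrier" "\<eta> \<in> hecke_carrier" "rinv f"
  shows "hecke_action \<mu> (\<lambda>g. \<theta> g + \<eta> g) f = (\<lambda>g. hecke_action \<mu> \<theta> f g + hecke_action \<mu> \<eta> f g)"
  unfolding hecke_action_def distrib_right
  by (rule ext, rule Bochner_Integration.integral_add) (use assms hecke_integrand(3) in simp_all)

lemma hecke_action_add_right:
  assumes "\<theta> \<in> hecke_carrier" "rinv f" "rinv h"
  shows "hecke_action \<mu> \<theta> (\<lambda>g. f g + h g) = (\<lambda>g. hecke_action \<mu> \<theta> f g + hecke_action \<mu> \<theta> h g)"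
  unfolding hecke_action_def distrib_left
  by (rule ext, rule Bochner_Integration.integral_add) (use assms hecke_integrand(3) in simp_all)

lemma hecke_action_scale_left:
  "hecke_action \<mu> (\<lambda>g. c * \<theta> g) f = (\<lambda>g. c * hecke_action \<mu> \<theta> f g)"
  by (simp add: hecke_action_def mult.assoc)

lemma hecke_action_scale_right:
  "hecke_action \<mu> \<theta> (\<lambda>g. c * f g) = (\<lambda>g. c * hecke_action \<mu> \<theta> f g)"
  by (simp add: hecke_action_def mult.left_commute)

lemma hecke_action_const:
  assumes "rinv f"
  shows "hecke_action \<mu> (hecke_const c) f = (\<lambda>g. c * f g)"
proof
  fix x
  have "rinv (hecke_const c :: 'p Gp \<Rightarrow> real)"
    using hecke_carrierD(3)[OF hecke_const_carrier[OF Z_inv_1, where ?'p = 'p]]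
    by (simp add: rinv_def hecke_const_def)
  then have "hecke_action \<mu> (hecke_const c) f x = (\<Sum>s\<in>{1}. hecke_const c s * f (x * s))"
  proof (rule hecke_action_sum)
    show "{g :: 'p Gp. hecke_const c g \<noteq> 0} \<subseteq> (\<Union>s\<in>{1}. coset s)"
      by (rule subsetI) (simp add: hecke_const_def coset_iff indicator_def split: if_splits)
  qed (use assms in simp_all)
  then show "hecke_action \<mu> (hecke_const c) f x = c * f x" by (simp add: hecke_const_def)
qed

lemma hecke_const_1: "hecke_const 1 = indicat_real (Gp0 :: 'p Gp set)"
  by (simp add: hecke_const_def)

lemma convolution_const_left:
  assumes "\<theta> \<in> hecke_carrier"
  shows "convolution \<mu> (hecke_const c) \<theta> = (\<lambda>g. c * \<theta> g)"
  using hecke_action_const[OF hecke_carrierD(3)[OF hecke_dual_carrier[OF assms]]]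
  by (simp add: fun_eq_iff convolution_eq_action hecke_dual_def)

text \<open>After a left translation by \<open>x\<close> in the integral, the two factors have
  exchanged their roles.\<close>

lemma hecke_dual_antimult:
  assumes \<theta>: "\<theta> \<in> hecke_carrier" and \<eta>: "\<eta> \<in> hecke_carrier"
  shows "hecke_dual (convolution \<mu> \<theta> \<eta>) = convolution \<mu> (hecke_dual \<eta>) (hecke_dual \<theta>)"
proof
  fix x
  let ?\<phi> = "\<lambda>g. hecke_dual \<eta> g * \<theta> (inverse x * g)"
  have "hecke_dual (convolution \<mu> \<theta> \<eta>) x = (LINT g|\<mu>. ?\<phi> (x * g))"
    by (simp add: hecke_dual_def convolution_def Gp_inverse_mult mult.commute)
  also have "\<dots> = (LINT g|\<mu>. ?\<phi> g)"
    by (rule integral_translate; rule hecke_integrand)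
      (use hecke_dual_carrier[OF \<eta>] hecke_carrierD(3)[OF \<theta>] in simp_all)
  also have "\<dots> = convolution \<mu> (hecke_dual \<eta>) (hecke_dual \<theta>) x"
    by (simp add: hecke_dual_def convolution_def Gp_inverse_mult)
  finally show "hecke_dual (convolution \<mu> \<theta> \<eta>) x = convolution \<mu> (hecke_dual \<eta>) (hecke_dual \<theta>) x" .
qed

lemma convolution_const_right:
  assumes "\<theta> \<in> hecke_carrier" "c \<in> Z_inv CARD('p)"
  shows "convolution \<mu> \<theta> (hecke_const c) = (\<lambda>g. c * \<theta> g)"
proof -
  have "hecke_dual (convolution \<mu> \<theta> (hecke_const c)) = (\<lambda>g. c * hecke_dual \<theta> g)"
    using assms by (simp add: hecke_dual_antimult hecke_const_carrier convolution_const_left hecke_dual_carrier)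
  then have "hecke_dual (hecke_dual (convolution \<mu> \<theta> (hecke_const c))) = hecke_dual (\<lambda>g. c * hecke_dual \<theta> g)"
    by simp
  then show ?thesis unfolding hecke_dual_dual by (simp add: hecke_dual_def)
qed

lemma hecke_add_carrier:
  assumes "\<theta> \<in> hecke_carrier" "\<eta> \<in> hecke_carrier"
  shows "(\<lambda>g. \<theta> g + \<eta> g) \<in> (hecke_carrier :: ('p Gp \<Rightarrow> real) set)"
proof (rule hecke_carrierI)
  have "coset_finite (\<Union>b\<in>{True, False}. if b then {g. \<theta> g \<noteq> 0} else {g. \<eta> g \<noteq> 0})"
    by (rule coset_finite_UN) (use hecke_carrierD(4)[OF assms(1)] hecke_carrierD(4)[OF assms(2)] in simp_all)
  then show "coset_finite {g. \<theta> g + \<eta> g \<noteq> 0}"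
    by (rule coset_finite_subset) (rule subsetI, rule ccontr, simp)
qed (use hecke_carrierD[OF assms(1)] hecke_carrierD[OF assms(2)] in \<open>simp_all add: rinvD Z_inv_add card_pos\<close>)

lemma hecke_scale_carrier:
  assumes "\<theta> \<in> hecke_carrier" "c \<in> Z_inv CARD('p)"
  shows "(\<lambda>g. c * \<theta> g) \<in> (hecke_carrier :: ('p Gp \<Rightarrow> real) set)"
  using convolution_carrier[OF hecke_const_carrier[OF assms(2)] assms(1)] convolution_const_left[OF assms(1)]
  by simp

lemma hecke_sel [simp]:
  "carrier (hecke \<mu>) = hecke_carrier" "\<zero>\<^bsub>hecke \<mu>\<^esub> = (\<lambda>_. 0)" "\<one>\<^bsub>hecke \<mu>\<^esub> = hecke_const 1"
  "\<theta> \<oplus>\<^bsub>hecke \<mu>\<^esub> \<eta> = (\<lambda>g. \<theta> g + \<eta> g)" "\<theta> \<otimes>\<^bsub>hecke \<mu>\<^esub> \<eta> = convolution \<mu> \<theta> \<eta>"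
  by (simp_all add: carrier_hecke hecke_const_1) (simp_all add: hecke_def)

lemma ring_hecke: "ring (hecke \<mu>)"
proof (rule ringI)
  show "abelian_group (hecke \<mu>)"
  proof (rule abelian_groupI)
    fix \<theta> assume "\<theta> \<in> carrier (hecke \<mu>)"
    then have "(\<lambda>g. - 1 * \<theta> g) \<in> carrier (hecke \<mu>)"
      unfolding hecke_sel by (rule hecke_scale_carrier) (use Z_inv_of_int[of "-1"] in simp)
    then show "\<exists>\<eta>\<in>carrier (hecke \<mu>). \<eta> \<oplus>\<^bsub>hecke \<mu>\<^esub> \<theta> = \<zero>\<^bsub>hecke \<mu>\<^esub>"
      by (rule bexI[rotated]) simp
  next
    show "\<zero>\<^bsub>hecke \<mu>\<^esub> \<in> carrier (hecke \<mu>)"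
      using hecke_const_carrier[OF Z_inv_0] by (simp add: hecke_const_def)
  qed (simp_all add: hecke_add_carrier ac_simps)
  show "monoid (hecke \<mu>)"
  proof (rule monoidI)
    fix x y z assume "x \<in> carrier (hecke \<mu>)" "y \<in> carrier (hecke \<mu>)" "z \<in> carrier (hecke \<mu>)"
    then show "x \<otimes>\<^bsub>hecke \<mu>\<^esub> y \<otimes>\<^bsub>hecke \<mu>\<^esub> z = x \<otimes>\<^bsub>hecke \<mu>\<^esub> (y \<otimes>\<^bsub>hecke \<mu>\<^esub> z)"
      by (simp add: fun_eq_iff convolution_eq_action[of _ _ "_ :: 'p Gp"] hecke_dual_convolution
          hecke_action_convolution hecke_carrierD(3)[OF hecke_dual_carrier])
  qed (simp_all add: convolution_carrier hecke_const_carrier convolution_const_left convolution_const_right)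
  fix x y z assume *: "x \<in> carrier (hecke \<mu>)" "y \<in> carrier (hecke \<mu>)" "z \<in> carrier (hecke \<mu>)"
  then have d: "rinv (hecke_dual x)" "rinv (hecke_dual y)" "rinv (hecke_dual z)"
    by (simp_all add: hecke_carrierD(3)[OF hecke_dual_carrier])
  have dual: "hecke_dual (\<lambda>g. x g + y g) = (\<lambda>g. hecke_dual x g + hecke_dual y g)"
    by (simp add: hecke_dual_def)
  show "z \<otimes>\<^bsub>hecke \<mu>\<^esub> (x \<oplus>\<^bsub>hecke \<mu>\<^esub> y) = z \<otimes>\<^bsub>hecke \<mu>\<^esub> x \<oplus>\<^bsub>hecke \<mu>\<^esub> z \<otimes>\<^bsub>hecke \<mu>\<^esub> y"
    using * d by (simp add: fun_eq_iff convolution_eq_action dual hecke_action_add_right)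
  show "(x \<oplus>\<^bsub>hecke \<mu>\<^esub> y) \<otimes>\<^bsub>hecke \<mu>\<^esub> z = x \<otimes>\<^bsub>hecke \<mu>\<^esub> z \<oplus>\<^bsub>hecke \<mu>\<^esub> y \<otimes>\<^bsub>hecke \<mu>\<^esub> z"
    using * d by (simp add: fun_eq_iff convolution_eq_action hecke_action_add_left)
qed

lemma hecke_a_inv: "\<theta> \<in> hecke_carrier \<Longrightarrow> \<ominus>\<^bsub>hecke \<mu>\<^esub> \<theta> = (\<lambda>g. - \<theta> g)"
proof -
  assume \<theta>: "\<theta> \<in> hecke_carrier"
  interpret ring "hecke \<mu>" by (rule ring_hecke)
  have "(\<lambda>g. - 1 * \<theta> g) \<in> hecke_carrier"
    using \<theta> by (rule hecke_scale_carrier) (use Z_inv_of_int[of "-1"] in simp)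
  then show ?thesis using minus_equality[of "\<lambda>g. - \<theta> g" \<theta>] \<theta> by simp
qed

end

section \<open>Orbits\<close>

text \<open>
  In the tree of \<open>PGL\<^sub>2\<close> a point of \<open>G\<^sub>p / Gp0\<close> gives two vertices, and \<open>P\<^sub>p\<close> fixes an end. The last two
  components of \<open>orb g\<close> are the distances of the two vertices to the point where their rays to this
  end meet; the first two fix the scaling of the lattices.
\<close>

definition orb :: "'p::prime_card Gp \<Rightarrow> int \<times> int \<times> int \<times> int" where
  "orb g = (let n = rcont (fst g); m = rcont (snd g); c = cont (inverse (snd g) * fst g)
     in (n, m, dval (fst g) - dval (snd g) - n + m - c, n - m - c))"

text \<open>An upper triangular matrix corresponds to a ball in Q_p: the pair represents 1 + p^i Z_p
  and p^j Z_p, scaled by p^n and p^m. For nonnegative \<open>i\<close> and \<open>j\<close> their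
  rays to the end at infinity meet in the ball Z_p.\<close>

definition orep :: "int \<Rightarrow> int \<Rightarrow> int \<Rightarrow> int \<Rightarrow> 'p::prime_card Gp" where
  "orep n m i j = (gl2_of (pp powi (n + i)) (pp powi n) 0 (pp powi n),
     gl2_of (pp powi (m + j)) 0 0 (pp powi m))"

lemma orb_mult_Gp0:
  assumes "k \<in> Gp0"
  shows "orb (g * k) = orb g"
proof -
  have k: "fst k \<in> Hp0" "snd k \<in> Hp0" "inverse (snd k) \<in> Hp0" using assms by (auto simp: Gp0_iff)
  have "inverse (snd (g * k)) * fst (g * k) = inverse (snd k) * (inverse (snd g) * fst g) * fst k"
    by (simp add: gl2_inverse_mult mult.assoc)
  then show ?thesis using k by (simp add: orb_def)
qed

lemma mirabolicE:
  fixes u :: "'p::prime_card Gp"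
  assumes "u \<in> mirabolic"
  obtains a b where "a \<noteq> 0" "fst u = gl2_of a b 0 1" "snd u = gl2_of a b 0 1"
  using assms unfolding mirabolic_def by auto

lemma mirabolicI: "a \<noteq> 0 \<Longrightarrow> (gl2_of a b 0 1, gl2_of a b 0 1) \<in> mirabolic"
  unfolding mirabolic_def by blast

text \<open>A diagonally embedded element cancels in \<open>inverse (snd g) * fst g\<close>, and a
  left factor with bottom row (0, 1) does not change the bottom row.\<close>

lemma orb_mirabolic_mult:
  assumes "u \<in> mirabolic"
  shows "orb (u * g) = orb g"
proof -
  obtain a b where u: "a \<noteq> 0" "fst u = gl2_of a b 0 1" "snd u = gl2_of a b 0 1"
    using assms by (rule mirabolicE)
  have "inverse (snd (u * g)) * fst (u * g) = inverse (snd g) * fst g"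
    by (simp add: gl2_inverse_mult mult.assoc u)
  moreover have "rcont (gl2_of a b 0 1 * h) = rcont h" for h
    using u(1) by (simp add: rcont_def)
  ultimately show ?thesis by (simp add: orb_def u dval_mult)
qed

lemma gl2_of_diag_inverse:
  assumes "a \<noteq> 0" "d \<noteq> (0 :: 'a::field)"
  shows "inverse (gl2_of a 0 0 d) = gl2_of (1 / a) 0 0 (1 / d)"
  by (rule gl2_inverse_unique, rule gl2_eqI) (use assms in simp_all)

lemma rcont_upper: "a \<noteq> 0 \<Longrightarrow> d \<noteq> 0 \<Longrightarrow> rcont (gl2_of a b 0 d) = val d"
  by (rule rcont_eqI) (simp add: pdvd_iff)

lemma dval_upper: "a \<noteq> 0 \<Longrightarrow> d \<noteq> 0 \<Longrightarrow> dval (gl2_of a b 0 d) = val a + val d"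
  by (simp add: dval_def det2_gl2_of val_mult)

lemma cont_upper:
  assumes "a \<noteq> 0" "d \<noteq> 0" "\<And>m. m \<le> M \<longleftrightarrow> m \<le> val a \<and> pdvd m b \<and> m \<le> val d"
  shows "cont (gl2_of a b 0 d) = M"
  by (rule cont_eqI) (use assms in \<open>simp add: pdvd_iff[of _ a] pdvd_iff[of _ d]\<close>)

text \<open>\<open>M\<close> is the content of the relative position; its description as a minimum
  is what has to be checked when an orbit is computed.\<close>

lemma orb_upper:
  assumes "a \<noteq> 0" "d \<noteq> 0" "\<And>m. m \<le> M \<longleftrightarrow> m \<le> val a - s \<and> pdvd (m + s) b \<and> m \<le> val d - t"
  shows "orb (gl2_of a b 0 d, gl2_of (pp powi s) 0 0 (pp powi t)) =
    (val d, t, val a - s - M, val d - t - M)"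
proof -
  have "inverse (gl2_of (pp powi s) 0 0 (pp powi t)) * gl2_of a b 0 d =
    gl2_of (a / pp powi s) (b / pp powi s) 0 (d / pp powi t)"
    using assms by (simp add: gl2_of_diag_inverse gl2_of_mult)
  moreover have "cont (gl2_of (a / pp powi s) (b / pp powi s) 0 (d / pp powi t)) = M"
    by (rule cont_upper) (use assms in \<open>simp_all add: val_divide pdvd_divide\<close>)
  ultimately show ?thesis using assms by (simp add: orb_def rcont_upper dval_upper Let_def)
qed

lemma orb_orep:
  assumes "0 \<le> i" "0 \<le> j"
  shows "orb (orep n m i j) = (n, m, i, j)"
  unfolding orep_def using assms by (subst orb_upper[where M = "n - m - j"]) (auto simp: pdvd_iff)

section \<open>Normal forms of pairs of balls under the mirabolic group\<close>

lemma gl2_unit_absorb: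
  fixes x :: "'p::prime_card padic"
  assumes "x \<noteq> 0" "d \<noteq> 0"
  shows "\<exists>k\<in>Hp0. gl2_of x b 0 d = gl2_of (pp powi (val x)) b 0 d * k"
proof -
  obtain t u where u: "x = pp powi t * to_fract u" "u dvd 1"
    using padic_decompose assms(1) by blast
  have t: "val x = t" using u val_unit by blast
  have vu: "to_fract u \<noteq> 0" "val (to_fract u) = 0" "pdvd 0 (to_fract u)"
    using val_unit[OF u(2), of 0] u assms by (auto simp: pdvd_iff)
  have "gl2_of (to_fract u) 0 0 1 \<in> Hp0" using vu by (intro Hp0_gl2_of) auto
  moreover have "gl2_of x b 0 d = gl2_of (pp powi t) b 0 d * gl2_of (to_fract u) 0 0 1"
    using vu u assms by (subst gl2_of_mult) auto
  ultimately show ?thesis using t by blast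
qed

text \<open>Column operations change \<open>b\<close> by multiples of \<open>x\<close>: any point of
  a ball can serve as its centre.\<close>

lemma gl2_translate_absorb:
  fixes x :: "'p::prime_card padic"
  assumes "x \<noteq> 0" "d \<noteq> 0" "pdvd (val x) (b - b')"
  shows "\<exists>k\<in>Hp0. gl2_of x b 0 d = gl2_of x b' 0 d * k"
proof -
  have "gl2_of 1 ((b - b') / x) 0 1 \<in> Hp0"
    using assms by (intro Hp0_gl2_of) (auto simp: pdvd_divide)
  moreover have "gl2_of x b 0 d = gl2_of x b' 0 d * gl2_of 1 ((b - b') / x) 0 1"
    using assms by (subst gl2_of_mult) (auto simp: field_simps)
  ultimately show ?thesis by blast
qed

definition orbit_equiv :: "'p::prime_card Gp \<Rightarrow> 'p Gp \<Rightarrow> bool" where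
  "orbit_equiv g h \<longleftrightarrow> (\<exists>u\<in>mirabolic. \<exists>k\<in>Gp0. g = u * h * k)"

lemma orbit_equiv_trans [trans]:
  assumes "orbit_equiv g h" "orbit_equiv h (l :: 'p::prime_card Gp)"
  shows "orbit_equiv g l"
proof -
  obtain u k where u: "u \<in> mirabolic" "k \<in> Gp0" "g = u * h * k"
    using assms(1) unfolding orbit_equiv_def by (elim bexE)
  obtain v m where v: "v \<in> mirabolic" "m \<in> Gp0" "h = v * l * m"
    using assms(2) unfolding orbit_equiv_def by (elim bexE)
  obtain a b where a: "a \<noteq> 0" "fst u = gl2_of a b 0 1" "snd u = gl2_of a b 0 1"
    using u(1) by (rule mirabolicE)
  obtain c d where c: "c \<noteq> 0" "fst v = gl2_of c d 0 1" "snd v = gl2_of c d 0 1"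
    using v(1) by (rule mirabolicE)
  have "u * v = (gl2_of (a * c) (a * d + b) 0 1, gl2_of (a * c) (a * d + b) 0 1)"
    by (rule prod_eqI) (use a c in \<open>simp_all add: gl2_of_mult\<close>)
  then have "u * v \<in> mirabolic" using a c by (simp add: mirabolicI)
  moreover have "g = (u * v) * l * (m * k)" unfolding u v by (simp only: mult.assoc)
  moreover have "m * k \<in> Gp0" using u v by (intro Gp0_mult)
  ultimately show ?thesis unfolding orbit_equiv_def by (intro bexI)
qed

lemma orbit_equiv_right:
  assumes "\<exists>k\<in>Hp0. g1 = h1 * k" "\<exists>k\<in>Hp0. g2 = h2 * (k :: 'p::prime_card Hp)"
  shows "orbit_equiv (g1, g2) (h1, h2)"
proof -
  obtain k l where "k \<in> Hp0" "g1 = h1 * k" "l \<in> Hp0" "g2 = h2 * l" using assms by (elim bexE)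
  then have "(g1, g2) = (1, 1) * (h1, h2) * (k, l)" "(k, l) \<in> Gp0"
    by (simp_all add: Gp_Pair_mult Gp0_iff)
  moreover have "((1, 1) :: 'p Gp) \<in> mirabolic"
  proof -
    have "(1 :: 'p Hp) = gl2_of 1 0 0 1" by (rule gl2_eqI) simp_all
    then show ?thesis using mirabolicI[of "1 :: 'p padic" 0] by simp
  qed
  ultimately show ?thesis unfolding orbit_equiv_def by (intro bexI)
qed

lemma orbit_equiv_left:
  assumes "a \<noteq> 0"
  shows "orbit_equiv (gl2_of a b 0 1 * h1, gl2_of a b 0 1 * h2) (h1, h2 :: 'p::prime_card Hp)"
  unfolding orbit_equiv_def
  by (rule bexI[OF _ mirabolicI[OF assms, of b]], rule bexI[of _ 1]) (simp_all add: Gp_Pair_mult Gp0_iff Gp_one)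

text \<open>Two balls around 0 are nested. Scaling makes the larger one Z_p, whose centre may be
  taken to be 0 or 1; if the second is larger, a translation moves the centre of the first to
  1.\<close>

lemma orbit_equiv_diag:
  fixes x y :: "'p::prime_card padic"
  assumes nz: "x \<noteq> 0" "y \<noteq> 0"
  shows "\<exists>i j. 0 \<le> i \<and> 0 \<le> j \<and>
    orbit_equiv (gl2_of (pp powi n * x) 0 0 (pp powi n), gl2_of (pp powi m * y) 0 0 (pp powi m))
      (orep n m i j)"
proof (cases "val x \<le> val y")
  case True
  let ?A = "gl2_of (pp powi n * x) 0 0 (pp powi n)"
  let ?B = "gl2_of (pp powi m * y) 0 0 (pp powi m)"
  have "(?A, ?B) = (gl2_of x 0 0 1 * gl2_of (pp powi n) 0 0 (pp powi n),
      gl2_of x 0 0 1 * gl2_of (pp powi m * y / x) 0 0 (pp powi m))"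
    using nz by (simp add: gl2_of_mult mult.commute)
  also have "orbit_equiv \<dots> (gl2_of (pp powi n) 0 0 (pp powi n), gl2_of (pp powi m * y / x) 0 0 (pp powi m))"
    by (rule orbit_equiv_left) (rule nz)
  also have "orbit_equiv \<dots> (orep n m 0 (val y - val x))"
    unfolding orep_def
  proof (rule orbit_equiv_right)
    show "\<exists>k\<in>Hp0. gl2_of (pp powi n) 0 0 (pp powi n) = gl2_of (pp powi (n + 0)) (pp powi n) 0 (pp powi n) * (k :: 'p Hp)"
      using gl2_translate_absorb[of "pp powi n :: 'p padic" "pp powi n" 0 "pp powi n"] by (simp add: pdvd_iff)
    show "\<exists>k\<in>Hp0. gl2_of (pp powi m * y / x) 0 0 (pp powi m) =
        gl2_of (pp powi (m + (val y - val x))) 0 0 (pp powi m) * k"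
      using gl2_unit_absorb[of "pp powi m * y / x" "pp powi m" 0] nz
      by (simp add: val_divide val_mult add_diff_eq)
  qed
  finally show ?thesis using True by (intro exI[of _ 0] exI[of _ "val y - val x"]) simp
next
  case False
  let ?A = "gl2_of (pp powi n * x) 0 0 (pp powi n)"
  let ?B = "gl2_of (pp powi m * y) 0 0 (pp powi m)"
  have "(?A, ?B) = (gl2_of y (- y) 0 1 * gl2_of (pp powi n * x / y) (pp powi n) 0 (pp powi n),
      gl2_of y (- y) 0 1 * gl2_of (pp powi m) (pp powi m) 0 (pp powi m))"
    using nz by (simp add: gl2_of_mult mult.commute)
  also have "orbit_equiv \<dots> (gl2_of (pp powi n * x / y) (pp powi n) 0 (pp powi n),
      gl2_of (pp powi m) (pp powi m) 0 (pp powi m))"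
    by (rule orbit_equiv_left) (rule nz)
  also have "orbit_equiv \<dots> (orep n m (val x - val y) 0)"
    unfolding orep_def
  proof (rule orbit_equiv_right)
    show "\<exists>k\<in>Hp0. gl2_of (pp powi m) (pp powi m) 0 (pp powi m) = gl2_of (pp powi (m + 0)) 0 0 (pp powi m) * (k :: 'p Hp)"
      using gl2_translate_absorb[of "pp powi m :: 'p padic" "pp powi m" "pp powi m" 0] by (simp add: pdvd_iff)
    show "\<exists>k\<in>Hp0. gl2_of (pp powi n * x / y) (pp powi n) 0 (pp powi n) =
        gl2_of (pp powi (n + (val x - val y))) (pp powi n) 0 (pp powi n) * k"
      using gl2_unit_absorb[of "pp powi n * x / y" "pp powi n" "pp powi n"] nz
      by (simp add: val_divide val_mult add_diff_eq)
  qed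
  finally show ?thesis using False by (intro exI[of _ "val x - val y"] exI[of _ 0]) simp
qed

text \<open>The two points \<open>c\<close> and \<open>0\<close> of the affine line become \<open>1\<close> and \<open>0\<close> after a dilation, or coincide.\<close>

lemma orbit_equiv_normalized:
  fixes x y c :: "'p::prime_card padic"
  assumes nz: "x \<noteq> 0" "y \<noteq> 0"
  shows "\<exists>i j. 0 \<le> i \<and> 0 \<le> j \<and>
    orbit_equiv (gl2_of (pp powi n * x) (pp powi n * c) 0 (pp powi n),
      gl2_of (pp powi m * y) 0 0 (pp powi m)) (orep n m i j)"
proof -
  let ?A = "gl2_of (pp powi n * x) (pp powi n * c) 0 (pp powi n)"
  let ?B = "gl2_of (pp powi m * y) 0 0 (pp powi m)"
  let ?D = "(gl2_of (pp powi n * x) 0 0 (pp powi n), gl2_of (pp powi m * y) 0 0 (pp powi m))"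
  have refl: "\<exists>k\<in>Hp0. h = h * k" for h :: "'p Hp" by (rule bexI[of _ 1]) simp_all
  \<comment> \<open>The first ball contains 0, or the second contains \<open>c\<close>, or the two
    are disjoint. In the first two cases the balls have a common centre.\<close>
  consider (x) "pdvd (val x) c" | (y) "pdvd (val y) c" | (c) "c \<noteq> 0" "val c < val x" "val c < val y"
    by (metis pdvd_iff linorder_not_le)
  then show ?thesis
  proof cases
    case x
    have "orbit_equiv (?A, ?B) ?D"
    proof (rule orbit_equiv_right[OF _ refl])
      show "\<exists>k\<in>Hp0. ?A = gl2_of (pp powi n * x) 0 0 (pp powi n) * k"
        by (rule gl2_translate_absorb) (use nz x in \<open>simp_all add: val_mult\<close>)
    qed
    then show ?thesis using orbit_equiv_diag[OF nz, of n m] orbit_equiv_trans by (elim exE conjE, intro exI conjI)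
  next
    case y
    have "(?A, ?B) = (gl2_of 1 c 0 1 * gl2_of (pp powi n * x) 0 0 (pp powi n),
        gl2_of 1 c 0 1 * gl2_of (pp powi m * y) (- (c * pp powi m)) 0 (pp powi m))"
      using nz by (simp add: gl2_of_mult mult.commute)
    also have "orbit_equiv \<dots> (gl2_of (pp powi n * x) 0 0 (pp powi n),
        gl2_of (pp powi m * y) (- (c * pp powi m)) 0 (pp powi m))"
      by (rule orbit_equiv_left) simp
    also have "orbit_equiv \<dots> ?D"
    proof (rule orbit_equiv_right[OF refl])
      show "\<exists>k\<in>Hp0. gl2_of (pp powi m * y) (- (c * pp powi m)) 0 (pp powi m) =
          gl2_of (pp powi m * y) 0 0 (pp powi m) * k"
        by (rule gl2_translate_absorb) (use nz y in \<open>simp_all add: val_mult mult.commute[of c]\<close>)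
    qed
    finally show ?thesis using orbit_equiv_diag[OF nz, of n m] orbit_equiv_trans by (elim exE conjE, intro exI conjI)
  next
    case c
    have "(?A, ?B) = (gl2_of c 0 0 1 * gl2_of (pp powi n * x / c) (pp powi n) 0 (pp powi n),
        gl2_of c 0 0 1 * gl2_of (pp powi m * y / c) 0 0 (pp powi m))"
      using nz c(1) by (simp add: gl2_of_mult mult.commute)
    also have "orbit_equiv \<dots> (gl2_of (pp powi n * x / c) (pp powi n) 0 (pp powi n),
        gl2_of (pp powi m * y / c) 0 0 (pp powi m))"
      by (rule orbit_equiv_left) (rule c)
    also have "orbit_equiv \<dots> (orep n m (val x - val c) (val y - val c))"
      unfolding orep_def
    proof (rule orbit_equiv_right)
      show "\<exists>k\<in>Hp0. gl2_of (pp powi n * x / c) (pp powi n) 0 (pp powi n) =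
          gl2_of (pp powi (n + (val x - val c))) (pp powi n) 0 (pp powi n) * k"
        using gl2_unit_absorb[of "pp powi n * x / c" "pp powi n" "pp powi n"] nz c(1)
        by (simp add: val_divide val_mult add_diff_eq)
      show "\<exists>k\<in>Hp0. gl2_of (pp powi m * y / c) 0 0 (pp powi m) =
          gl2_of (pp powi (m + (val y - val c))) 0 0 (pp powi m) * k"
        using gl2_unit_absorb[of "pp powi m * y / c" "pp powi m" 0] nz c(1)
        by (simp add: val_divide val_mult add_diff_eq)
    qed
    finally show ?thesis using c by (intro exI[of _ "val x - val c"] exI[of _ "val y - val c"]) simp
  qed
qed

lemma orbit_representative:
  fixes g :: "'p::prime_card Gp"
  shows "\<exists>n m i j. 0 \<le> i \<and> 0 \<le> j \<and> orbit_equiv g (orep n m i j)"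
proof -
  obtain x b n k where k: "x \<noteq> 0" "k \<in> Hp0" "fst g = gl2_of x b 0 (pp powi n) * k"
    by (rule Hp_bottom_row_reduce)
  obtain y c m l where l: "y \<noteq> 0" "l \<in> Hp0" "snd g = gl2_of y c 0 (pp powi m) * l"
    by (rule Hp_bottom_row_reduce)
  \<comment> \<open>The translation that moves the centre of the second ball to 0.\<close>
  let ?t = "c / pp powi m"
  let ?b = "b - ?t * pp powi n"
  have "orbit_equiv (fst g, snd g) (gl2_of x b 0 (pp powi n), gl2_of y c 0 (pp powi m))"
    by (rule orbit_equiv_right) (use k l in blast)+
  also have "(gl2_of x b 0 (pp powi n), gl2_of y c 0 (pp powi m)) =
      (gl2_of 1 ?t 0 1 * gl2_of x ?b 0 (pp powi n), gl2_of 1 ?t 0 1 * gl2_of y 0 0 (pp powi m))"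
    using k(1) l(1) by (simp add: gl2_of_mult)
  also have "orbit_equiv \<dots> (gl2_of x ?b 0 (pp powi n), gl2_of y 0 0 (pp powi m))"
    by (rule orbit_equiv_left) simp
  finally have eq: "orbit_equiv g (gl2_of x ?b 0 (pp powi n), gl2_of y 0 0 (pp powi m))" by simp
  have "x / pp powi n \<noteq> 0" "y / pp powi m \<noteq> 0" using k(1) l(1) by simp_all
  from orbit_equiv_normalized[OF this, of n "?b / pp powi n" m]
  obtain i j where ij: "0 \<le> i" "0 \<le> j"
    "orbit_equiv (gl2_of x ?b 0 (pp powi n), gl2_of y 0 0 (pp powi m)) (orep n m i j)"
    by auto
  show ?thesis
    using orbit_equiv_trans[OF eq ij(3)] ij(1,2)
    by (intro exI[of _ n] exI[of _ m] exI[of _ i] exI[of _ j]) simp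
qed

lemma orbit_equiv_orb: "orbit_equiv g h \<Longrightarrow> orb g = orb (h :: 'p::prime_card Gp)"
  unfolding orbit_equiv_def by (elim bexE) (simp add: orb_mult_Gp0 orb_mirabolic_mult mult.assoc)

text \<open>\<open>orb\<close> is constant on orbits and recovers its parameters from the
  representative, so it is a complete invariant.\<close>

lemma orbit_equiv_orep:
  fixes g :: "'p::prime_card Gp"
  assumes "orb g = (n, m, i, j)"
  shows "0 \<le> i" "0 \<le> j" "orbit_equiv g (orep n m i j)"
proof -
  obtain n' m' i' j' where *: "0 \<le> i'" "0 \<le> j'" "orbit_equiv g (orep n' m' i' j')"
    using orbit_representative[of g] by (elim exE conjE)
  then have "orb g = (n', m', i', j')" using orbit_equiv_orb[OF *(3)] by (simp add: orb_orep)
  then show "0 \<le> i" "0 \<le> j" "orbit_equiv g (orep n m i j)" using * assms by simp_all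
qed

definition orbit_fun :: "('p::prime_card Gp \<Rightarrow> real) \<Rightarrow> bool" where
  "orbit_fun f \<longleftrightarrow> (\<forall>u\<in>mirabolic. \<forall>k\<in>Gp0. \<forall>g. f (u * g * k) = f g)"

lemma orbit_funD: "orbit_fun f \<Longrightarrow> orbit_equiv g h \<Longrightarrow> f g = f h"
  unfolding orbit_fun_def orbit_equiv_def by (elim bexE) simp

lemma mirabolic_one: "(1 :: 'p::prime_card Gp) \<in> mirabolic"
proof -
  have "(1 :: 'p Hp) = gl2_of 1 0 0 1" by (rule gl2_eqI) simp_all
  then show ?thesis using mirabolicI[of "1 :: 'p padic" 0] by (simp add: Gp_one)
qed

lemma orbit_fun_rinv: "orbit_fun f \<Longrightarrow> rinv f"
  unfolding orbit_fun_def rinv_def using mirabolic_one by (metis mult_1)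

lemma orbit_fun_orb:
  fixes g h :: "'p::prime_card Gp"
  assumes f: "orbit_fun f" and "orb g = orb h"
  shows "f g = f h"
proof -
  obtain n m i j where "orb g = (n, m, i, j)" by (cases "orb g")
  then show ?thesis
    using orbit_funD[OF f orbit_equiv_orep(3)[of g n m i j]] orbit_funD[OF f orbit_equiv_orep(3)[of h n m i j]] assms(2)
    by simp
qed

lemma orbit_fun_eqI:
  fixes f h :: "'p::prime_card Gp \<Rightarrow> real"
  assumes "orbit_fun f" "orbit_fun h"
    "\<And>n m i j. 0 \<le> i \<Longrightarrow> 0 \<le> j \<Longrightarrow> f (orep n m i j) = h (orep n m i j)"
  shows "f = h"
proof
  fix g :: "'p Gp"
  obtain n m i j where o: "orb g = (n, m, i, j)" by (cases "orb g")
  show "f g = h g"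
    using orbit_funD[OF assms(1) orbit_equiv_orep(3)[OF o]] orbit_funD[OF assms(2) orbit_equiv_orep(3)[OF o]]
      assms(3)[OF orbit_equiv_orep(1,2)[OF o]] by simp
qed

definition orb_ind :: "int \<Rightarrow> int \<Rightarrow> int \<Rightarrow> int \<Rightarrow> 'p::prime_card Gp \<Rightarrow> real" where
  "orb_ind n m i j g = of_bool (orb g = (n, m, i, j))"

lemma orbit_fun_orb_ind: "orbit_fun (orb_ind n m i j)"
  by (simp add: orbit_fun_def orb_ind_def orb_mult_Gp0 orb_mirabolic_mult)

lemma orb_ind_orep:
  "0 \<le> i' \<Longrightarrow> 0 \<le> j' \<Longrightarrow> orb_ind n m i j (orep n' m' i' j') = of_bool (n' = n \<and> m' = m \<and> i' = i \<and> j' = j)"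
  by (simp add: orb_ind_def orb_orep)

lemma f0_eq: "f0 = (orb_ind 0 0 0 0 :: 'p::prime_card Gp \<Rightarrow> real)"
proof
  fix g :: "'p Gp"
  \<comment> \<open>The representative with zero parameters is not 1 itself: its first component is
    unipotent. This factor is pulled out on the left of both components, and its integral inverse
    remains on the right of the second.\<close>
  have "orep 0 0 0 0 = (gl2_of 1 1 0 1, gl2_of 1 1 0 1 * gl2_of 1 (- 1) 0 1 :: 'p Hp)"
    by (simp add: orep_def gl2_of_mult)
  also have "\<dots> = (gl2_of 1 1 0 1, gl2_of 1 1 0 1) * 1 * (1, gl2_of 1 (- 1) 0 1)"
    by (simp add: Gp_Pair_mult)
  also have "orbit_equiv \<dots> 1"
    unfolding orbit_equiv_def
  proof (rule bexI[OF _ mirabolicI[of 1 1]], rule bexI)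
    have "(gl2_of 1 (- 1) 0 1 :: 'p Hp) \<in> Hp0" by (rule Hp0_gl2_of) simp_all
    then show "(1, gl2_of 1 (- 1) 0 1) \<in> (Gp0 :: 'p Gp set)" by (simp add: Gp0_iff)
  qed simp_all
  finally have 1: "orbit_equiv (orep 0 0 0 0) (1 :: 'p Gp)" .
  then have 2: "orb (1 :: 'p Gp) = (0, 0, 0, 0)" using orbit_equiv_orb[OF 1] by (simp add: orb_orep)
  have "orbit_equiv g 1 \<longleftrightarrow> orb g = (0, 0, 0, 0)"
    using orbit_equiv_orb[of g 1] 2 orbit_equiv_trans[OF orbit_equiv_orep(3)[of g 0 0 0 0] 1] by auto
  moreover have "g \<in> {u * k | u k. u \<in> mirabolic \<and> k \<in> Gp0} \<longleftrightarrow> orbit_equiv g 1"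
    unfolding orbit_equiv_def by auto
  ultimately show "f0 g = orb_ind 0 0 0 0 g"
    unfolding f0_def orb_ind_def indicator_def by simp
qed

section \<open>The Hecke operators\<close>

definition zscal :: "int \<Rightarrow> 'p::prime_card Hp" where
  "zscal m = gl2_of (pp powi m) 0 0 (pp powi m)"

lemma zscal_entries [simp]:
  "m11 (zscal m) = pp powi m" "m12 (zscal m) = 0" "m21 (zscal m) = 0" "m22 (zscal m) = pp powi m"
  by (simp_all add: zscal_def)

lemma zscal_commute: "zscal m * h = h * (zscal m :: 'p::prime_card Hp)"
  by (rule gl2_eqI) (simp_all add: mult.commute)

lemma zscal_add: "zscal m * zscal n = (zscal (m + n) :: 'p::prime_card Hp)"
  by (rule gl2_eqI) (simp_all add: power_int_add)

lemma zscal_0 [simp]: "zscal 0 = 1"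
  by (rule gl2_eqI) simp_all

lemma dval_zscal: "dval (zscal m :: 'p::prime_card Hp) = 2 * m"
  unfolding zscal_def dval_diag by simp

lemma cont_mult_zscal: "cont (h * zscal m) = cont h + (m :: int)"
proof (rule cont_eqI)
  fix n
  have "n \<le> cont h + m \<longleftrightarrow> n - m \<le> cont h" by linarith
  then show "n \<le> cont h + m \<longleftrightarrow> pdvd n (m11 (h * zscal m)) \<and> pdvd n (m12 (h * zscal m)) \<and>
      pdvd n (m21 (h * zscal m)) \<and> pdvd n (m22 (h * zscal m))"
    by (simp add: le_cont_iff mult.commute[of _ "_ powi _"])
qed

lemma rcont_mult_zscal: "rcont (h * zscal m) = rcont h + (m :: int)"
proof (rule rcont_eqI)
  fix n
  have "n \<le> rcont h + m \<longleftrightarrow> n - m \<le> rcont h" by linarith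
  then show "n \<le> rcont h + m \<longleftrightarrow> pdvd n (m21 (h * zscal m)) \<and> pdvd n (m22 (h * zscal m))"
    by (simp add: le_rcont_iff mult.commute[of _ "_ powi _"])
qed

definition zpair :: "int \<Rightarrow> int \<Rightarrow> 'p::prime_card Gp" where
  "zpair m n = (zscal m, zscal n)"

lemma zpair_commute: "zpair m n * g = g * (zpair m n :: 'p::prime_card Gp)"
  by (rule prod_eqI) (simp_all add: zpair_def zscal_commute)

lemma zpair_add: "zpair m n * zpair m' n' = (zpair (m + m') (n + n') :: 'p::prime_card Gp)"
  by (simp add: zpair_def Gp_Pair_mult zscal_add)

lemma zpair_0 [simp]: "zpair 0 0 = 1"
  by (simp add: zpair_def Gp_one)

lemma zpair_inverse: "inverse (zpair m n) = (zpair (- m) (- n) :: 'p::prime_card Gp)"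
proof -
  have "inverse (zpair m n) * (zpair m n * zpair (- m) (- n)) = (inverse (zpair m n) :: 'p Gp)"
    by (simp add: zpair_add)
  then show ?thesis by simp
qed

definition hecke_z :: "int \<Rightarrow> int \<Rightarrow> 'p::prime_card Gp \<Rightarrow> real" where
  "hecke_z m n = indicat_real (coset (zpair m n))"

lemma hecke_z_eq: "hecke_z m n g = hecke_const 1 (zpair (- m) (- n) * (g :: 'p::prime_card Gp))"
  by (simp add: hecke_z_def hecke_const_def indicator_def coset_iff zpair_inverse)

lemma S1_eq: "S1 = (hecke_z 1 0 :: 'p::prime_card Gp \<Rightarrow> real)"
proof -
  have "(zscal 1 :: 'p Hp) = gl2_of pp 0 0 pp" by (simp add: zscal_def)
  then show ?thesis
    unfolding S1_def hecke_z_def Let_def coset_def zpair_def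
    by (simp add: Setcompr_eq_image)
qed

lemma S2_eq: "S2 = (hecke_z 0 1 :: 'p::prime_card Gp \<Rightarrow> real)"
proof -
  have "(zscal 1 :: 'p Hp) = gl2_of pp 0 0 pp" by (simp add: zscal_def)
  then show ?thesis
    unfolding S2_def hecke_z_def Let_def coset_def zpair_def
    by (simp add: Setcompr_eq_image)
qed

section \<open>Neighbours in the tree and the operators \<open>T1\<close> and
  \<open>T2\<close>\<close>

lemma val_pp1 [simp]: "val (pp :: 'p::prime_card padic) = 1"
  using val_pp[of 1] by simp

text \<open>\<open>t_fin c\<close> and \<open>t_inf\<close> represent the p + 1 neighbours of the
  vertex Z_p: the balls c + p Z_p away from the fixed end, and the ball p^(-1) Z_p towards it. The
  latter is scaled by p, so steps towards the end raise the scaling index.\<close>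

definition t_fin :: "nat \<Rightarrow> 'p::prime_card Hp" where
  "t_fin c = gl2_of pp (of_nat c) 0 1"

definition t_inf :: "'p::prime_card Hp" where
  "t_inf = gl2_of 1 0 0 pp"

definition t_reps :: "'p::prime_card Gp set" where
  "t_reps = insert (t_inf, 1) ((\<lambda>c. (t_fin c, 1)) ` {..<CARD('p)})"

lemma t_fin_invariants: "dval (t_fin c) = 1" "cont (t_fin c) = 0" "rcont (t_fin c) = 0"
proof -
  show "dval (t_fin c) = 1" unfolding t_fin_def by (subst dval_upper) simp_all
  show "rcont (t_fin c) = 0" unfolding t_fin_def by (subst rcont_upper) simp_all
  show "cont (t_fin c) = 0" unfolding t_fin_def
    by (rule cont_upper) (auto intro: pdvd_mono[OF pdvd_of_nat])
qed

lemma t_inf_invariants: "dval t_inf = 1" "cont t_inf = 0" "rcont t_inf = 1"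
proof -
  show "dval t_inf = 1" unfolding t_inf_def by (subst dval_upper) simp_all
  show "rcont t_inf = 1" unfolding t_inf_def by (subst rcont_upper) simp_all
  show "cont t_inf = 0" unfolding t_inf_def by (rule cont_upper) auto
qed

lemma of_nat_cong_padic:
  assumes "c < CARD('p)" "d < CARD('p)" "pdvd 1 (of_nat c - of_nat d :: 'p::prime_card padic)"
  shows "c = d"
proof -
  have False if "a < b" "b < CARD('p)" "pdvd 1 (of_nat b - of_nat a :: 'p padic)" for a b
  proof -
    have "of_nat b - of_nat a = (of_nat (b - a) :: 'p padic)" using that by (simp add: of_nat_diff)
    then show False using val_of_nat_coprime[of "b - a", where ?'p = 'p] that by (simp add: pdvd_iff)
  qed
  from this[of c d] this[of d c] show ?thesis
    using assms pdvd_minus[of 1 "of_nat c - of_nat d :: 'p padic"] by (cases c d rule: linorder_cases) simp_all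
qed

text \<open>\<open>rcont\<close> separates \<open>t_inf\<close> from the others, and these are
  separated by their residues modulo p.\<close>

lemma t_reps_inj: "inj_on coset (t_reps :: 'p::prime_card Gp set)"
proof (rule inj_onI)
  fix s t :: "'p Gp"
  assume s: "s \<in> t_reps" and t: "t \<in> t_reps" and eq: "coset s = coset t"
  have k: "inverse t * s \<in> Gp0" using eq coset_self[of s] by (simp add: coset_iff)
  have "s = t * (inverse t * s)" by simp
  then have "fst s = fst t * fst (inverse t * s)" by (metis Gp_fst_snd(1))
  then have r: "rcont (fst s) = rcont (fst t)" using k rcont_mult_Hp0 Gp0_iff by metis
  have fin: "c = d" if cd: "s = (t_fin c, 1)" "t = (t_fin d, 1)" "c < CARD('p)" "d < CARD('p)" for c d
  proof -
    have "inverse (t_fin d) * t_fin c \<in> (Hp0 :: 'p Hp set)" using k cd by (simp add: Gp0_iff)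
    then have "pdvd 0 (m12 (inverse (t_fin d) * t_fin c :: 'p Hp))"
      unfolding Hp0_iff le_cont_iff by simp
    moreover have "m12 (inverse (t_fin d) * t_fin c :: 'p Hp) = (of_nat c - of_nat d) / pp"
      by (simp add: gl2_inverse_entries t_fin_def det2_gl2_of diff_divide_distrib)
    ultimately have "pdvd 1 (of_nat c - of_nat d :: 'p padic)" by (simp add: pdvd_divide)
    then show ?thesis by (rule of_nat_cong_padic[OF cd(3,4)])
  qed
  consider "s = (t_inf, 1)" "t = (t_inf, 1)"
    | c where "s = (t_inf, 1)" "t = (t_fin c, 1)"
    | c where "s = (t_fin c, 1)" "t = (t_inf, 1)"
    | c d where "s = (t_fin c, 1)" "t = (t_fin d, 1)" "c < CARD('p)" "d < CARD('p)"
    using s t unfolding t_reps_def by auto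
  then show "s = t"
  proof cases
    case 4
    from fin[OF 4] 4 show ?thesis by (simp only:)
  qed (use r in \<open>simp_all add: t_fin_invariants t_inf_invariants\<close>)
qed

lemma t_reps_sum:
  "(\<Sum>s\<in>t_reps. f s) = (\<Sum>c<CARD('p). f (t_fin c, 1)) + (f (t_inf, 1 :: 'p::prime_card Hp) :: real)"
proof -
  have inj: "inj_on (\<lambda>c. (t_fin c, 1) :: 'p Gp) {..<CARD('p)}"
  proof (rule inj_onI)
    fix c d assume cd: "c \<in> {..<CARD('p)}" "d \<in> {..<CARD('p)}" "(t_fin c :: 'p Hp, 1 :: 'p Hp) = (t_fin d, 1)"
    have "m12 (t_fin c :: 'p Hp) = m12 (t_fin d)" using cd(3) by simp
    then have "(of_nat c :: 'p padic) = of_nat d" by (simp add: t_fin_def)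
    then have "pdvd 1 (of_nat c - of_nat d :: 'p padic)" by simp
    with cd(1,2) show "c = d" using of_nat_cong_padic by simp
  qed
  have "(t_inf :: 'p Hp) \<noteq> t_fin c" for c
  proof
    assume "(t_inf :: 'p Hp) = t_fin c"
    then have "rcont (t_inf :: 'p Hp) = rcont (t_fin c :: 'p Hp)" by simp
    then show False by (simp add: t_fin_invariants t_inf_invariants)
  qed
  then have "(t_inf :: 'p Hp, 1 :: 'p Hp) \<notin> (\<lambda>c. (t_fin c, 1)) ` {..<CARD('p)}" by auto
  then show ?thesis unfolding t_reps_def by (simp add: sum.reindex[OF inj] add.commute)
qed

text \<open>By the Cartan decomposition the double coset is cut out by its invariants; bi-invariance
  is then immediate.\<close>

lemma T1_eq:
  "T1 g = of_bool (dval (fst g) = 1 \<and> cont (fst g) = 0 \<and> snd (g :: 'p::prime_card Gp) \<in> Hp0)"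
proof -
  let ?d = "(gl2_of pp 0 0 1, 1) :: 'p Gp"
  have d: "dval (gl2_of pp 0 0 1 :: 'p Hp) = 1" "cont (gl2_of pp 0 0 1 :: 'p Hp) = 0"
    using dval_diag[of 1 0, where ?'p = 'p] cont_diag[of 1 0, where ?'p = 'p] by simp_all
  have "(\<exists>k\<in>Gp0. \<exists>l\<in>Gp0. g = k * ?d * l) \<longleftrightarrow> dval (fst g) = 1 \<and> cont (fst g) = 0 \<and> snd g \<in> Hp0"
  proof (intro iffI)
    assume "\<exists>k\<in>Gp0. \<exists>l\<in>Gp0. g = k * ?d * l"
    then obtain k l where k: "k \<in> Gp0" "l \<in> Gp0" "g = k * ?d * l" by (elim bexE)
    then show "dval (fst g) = 1 \<and> cont (fst g) = 0 \<and> snd g \<in> Hp0"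
      unfolding Gp0_iff by (simp add: d Hp0_mult)
  next
    assume g: "dval (fst g) = 1 \<and> cont (fst g) = 0 \<and> snd g \<in> Hp0"
    obtain k l where k: "k \<in> Hp0" "l \<in> Hp0"
      "fst g = k * gl2_of (pp powi (dval (fst g) - cont (fst g))) 0 0 (pp powi cont (fst g)) * l"
      by (rule Hp_cartan)
    then have "g = (k, 1) * ?d * (l, snd g)" by (intro prod_eqI) (simp_all add: g)
    moreover have "(k, 1) \<in> Gp0" "(l, snd g) \<in> Gp0" using k g by (simp_all add: Gp0_iff)
    ultimately show "\<exists>k\<in>Gp0. \<exists>l\<in>Gp0. g = k * ?d * l" by (intro bexI)
  qed
  moreover have "{k * ?d * l | k l. k \<in> Gp0 \<and> l \<in> Gp0} = {g. \<exists>k\<in>Gp0. \<exists>l\<in>Gp0. g = k * ?d * l}"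
    by blast
  then have "T1 g = of_bool (\<exists>k\<in>Gp0. \<exists>l\<in>Gp0. g = k * ?d * l)"
    unfolding T1_def Let_def by (simp add: indicator_def)
  ultimately show ?thesis by simp
qed

text \<open>In the Iwasawa form the diagonal exponents are nonnegative with sum 1. Either the first
  is 0, or the off-diagonal entry matters only modulo p.\<close>

lemma T1_support: "{g. T1 g \<noteq> 0} \<subseteq> (\<Union>s\<in>t_reps. coset (s :: 'p::prime_card Gp))"
proof
  fix g :: "'p Gp"
  assume "g \<in> {g. T1 g \<noteq> 0}"
  then have g: "dval (fst g) = 1" "cont (fst g) = 0" "snd g \<in> Hp0" by (simp_all add: T1_eq)
  obtain m x n k where k: "k \<in> Hp0" and hk: "fst g = gl2_of (pp powi m) x 0 (pp powi n) * k"
    by (rule Hp_iwasawa)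
  let ?u = "gl2_of (pp powi m) x 0 (pp powi n) :: 'p Hp"
  have u: "dval ?u = 1" "cont ?u = 0" using g k hk by simp_all
  have mn: "m + n = 1" using u(1) by (simp add: dval_upper)
  have "pdvd 0 (pp powi m :: 'p padic)" "pdvd 0 x" "pdvd 0 (pp powi n :: 'p padic)"
    using le_cont_iff[of 0 ?u] u(2) by simp_all
  then have b: "0 \<le> m" "0 \<le> n" "pdvd 0 x"
    by (simp_all add: pdvd_iff[of 0 "_ powi _"])
  have "\<exists>t. (t, 1) \<in> (t_reps :: 'p Gp set) \<and> (\<exists>l\<in>Hp0. ?u = t * l)"
  proof (cases "m = 0")
    case True
    then have "n = 1" using mn by simp
    then have "?u = t_inf * gl2_of 1 x 0 1" using True by (simp add: t_inf_def gl2_of_mult)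
    moreover have "gl2_of 1 x 0 1 \<in> (Hp0 :: 'p Hp set)" using b by (intro Hp0_gl2_of) simp_all
    ultimately show ?thesis unfolding t_reps_def by blast
  next
    case False
    then have m: "m = 1" "n = 0" using mn b by simp_all
    obtain c where c: "c < CARD('p) ^ 1" "pdvd (int 1) (x - of_nat c)"
      by (rule padic_residue[OF b(3)])
    have "?u = t_fin c * gl2_of 1 ((x - of_nat c) / pp) 0 1"
      using m by (simp add: t_fin_def gl2_of_mult)
    moreover have "gl2_of 1 ((x - of_nat c) / pp) 0 1 \<in> (Hp0 :: 'p Hp set)"
      using c by (intro Hp0_gl2_of) (simp_all add: pdvd_divide)
    ultimately show ?thesis using c(1) unfolding t_reps_def by auto
  qed
  then obtain t l where t: "(t, 1) \<in> (t_reps :: 'p Gp set)" "l \<in> Hp0" "?u = t * l" by (elim exE conjE bexE)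
  have "g \<in> coset (t, 1)" unfolding coset_iff
    using t hk k g(3) by (simp add: Gp0_iff gl2_inverse_unique Hp0_mult mult.assoc)
  with t(1) show "g \<in> (\<Union>s\<in>t_reps. coset s)" by (rule UN_I)
qed

lemma T1_carrier: "T1 \<in> (hecke_carrier :: ('p::prime_card Gp \<Rightarrow> real) set)"
proof (rule hecke_carrierI)
  show "coset_finite {g :: 'p Gp. T1 g \<noteq> 0}"
    unfolding coset_finite_def using T1_support by (intro exI[of _ t_reps]) (simp add: t_reps_def)
  have snd: "k * h \<in> Hp0 \<longleftrightarrow> h \<in> Hp0" "h * k \<in> Hp0 \<longleftrightarrow> h \<in> Hp0" if "k \<in> Hp0" for k h :: "'p Hp"
    using that by (simp_all add: Hp0_iff[of "_ * _"] Hp0_iff[of h])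
  show "T1 (k * g) = T1 g" "T1 (g * k) = T1 g" if "k \<in> Gp0" for k g :: "'p Gp"
    using that by (simp_all add: T1_eq Gp0_iff snd)
qed (simp add: T1_eq)

lemma T1_reps: "s \<in> t_reps \<Longrightarrow> T1 (s :: 'p::prime_card Gp) = 1"
  unfolding t_reps_def by (auto simp: T1_eq t_fin_invariants t_inf_invariants)

lemma swap_mult: "prod.swap (g * h) = prod.swap g * prod.swap (h :: 'p::prime_card Gp)"
  by (rule prod_eqI) simp_all

lemma swap_inverse: "prod.swap (inverse g) = inverse (prod.swap (g :: 'p::prime_card Gp))"
  by (rule prod_eqI) simp_all

lemma swap_Gp0: "prod.swap g \<in> Gp0 \<longleftrightarrow> (g :: 'p::prime_card Gp) \<in> Gp0"
  by (auto simp: Gp0_iff)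

lemma swap_coset: "prod.swap x \<in> coset (prod.swap s) \<longleftrightarrow> x \<in> coset (s :: 'p::prime_card Gp)"
  by (simp only: coset_iff swap_inverse[symmetric] swap_mult[symmetric] swap_Gp0)

text \<open>Exchanging the two factors reduces statements on \<open>T2\<close> to statements on
  \<open>T1\<close>.\<close>

lemma T2_eq: "T2 g = T1 (prod.swap (g :: 'p::prime_card Gp))"
proof -
  let ?d = "(gl2_of pp 0 0 1, 1) :: 'p Gp"
  have "(\<exists>k l. g = k * prod.swap ?d * l \<and> k \<in> Gp0 \<and> l \<in> Gp0) \<longleftrightarrow>
    (\<exists>k l. prod.swap g = k * ?d * l \<and> k \<in> Gp0 \<and> l \<in> Gp0)"
    by (metis swap_Gp0 swap_mult swap_swap)
  then show ?thesis by (simp add: T1_def T2_def Let_def indicator_def)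
qed

lemma rinv_swap: "rinv f \<Longrightarrow> rinv (\<lambda>g. f (prod.swap (g :: 'p::prime_card Gp)))"
  unfolding rinv_def by (simp add: swap_mult swap_Gp0)

lemma T2_support: "{g. T2 g \<noteq> 0} \<subseteq> (\<Union>s\<in>prod.swap ` t_reps. coset (s :: 'p::prime_card Gp))"
proof
  fix g :: "'p Gp" assume "g \<in> {g. T2 g \<noteq> 0}"
  then have "prod.swap g \<in> {g. T1 g \<noteq> 0}" by (simp add: T2_eq)
  then have "prod.swap g \<in> (\<Union>s\<in>t_reps. coset s)" by (rule subsetD[OF T1_support])
  then obtain s where "s \<in> t_reps" "prod.swap g \<in> coset s" by (elim UN_E)
  then show "g \<in> (\<Union>s\<in>prod.swap ` t_reps. coset s)"
    using swap_coset[of g "prod.swap s"] by (intro UN_I[of "prod.swap s"]) simp_all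
qed

lemma T2_carrier: "T2 \<in> (hecke_carrier :: ('p::prime_card Gp \<Rightarrow> real) set)"
proof (rule hecke_carrierI)
  show "coset_finite {g :: 'p Gp. T2 g \<noteq> 0}"
    unfolding coset_finite_def using T2_support by (intro exI[of _ "prod.swap ` t_reps"]) (simp add: t_reps_def)
  show "T2 (k * g) = T2 g" "T2 (g * k) = T2 g" if "k \<in> Gp0" for k g :: "'p Gp"
    using that
    by (simp_all add: T2_eq swap_mult swap_Gp0 rinvD[OF hecke_carrierD(3)[OF T1_carrier]]
        hecke_carrierD(2)[OF T1_carrier])
qed (use hecke_carrierD(1)[OF T1_carrier] in \<open>simp add: T2_eq\<close>)

lemma T2_reps_inj: "inj_on coset (prod.swap ` t_reps :: 'p::prime_card Gp set)"
proof (rule inj_onI, elim imageE)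
  fix x y s t :: "'p Gp"
  assume *: "coset x = coset y" "x = prod.swap s" "s \<in> t_reps" "y = prod.swap t" "t \<in> t_reps"
  have "x \<in> coset y" using *(1) coset_self[of x] by simp
  then have "s \<in> coset t" using * swap_coset[of s t] by simp
  then have "s = t" using inj_coset_unique[OF t_reps_inj *(3) *(5) coset_self] by simp
  with * show "x = y" by simp
qed

lemma hecke_z_carrier: "hecke_z m n \<in> (hecke_carrier :: ('p::prime_card Gp \<Rightarrow> real) set)"
proof (rule hecke_carrierI)
  have c: "hecke_const 1 \<in> (hecke_carrier :: ('p Gp \<Rightarrow> real) set)"
    by (rule hecke_const_carrier) simp
  show "hecke_z m n g \<in> Z_inv CARD('p)" for g :: "'p Gp" by (simp add: hecke_z_def indicator_def)
  show "hecke_z m n (k * g) = hecke_z m n g" if "k \<in> Gp0" for k g :: "'p Gp"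
  proof -
    have "zpair (- m) (- n) * (k * g) = k * (zpair (- m) (- n) * g)"
      by (simp add: zpair_commute mult.assoc)
    then show ?thesis by (simp add: hecke_z_eq hecke_carrierD(2)[OF c that])
  qed
  show "hecke_z m n (g * k) = hecke_z m n g" if "k \<in> Gp0" for k g :: "'p Gp"
    by (simp add: hecke_z_eq mult.assoc[symmetric] rinvD[OF hecke_carrierD(3)[OF c] that])
  have "{g. hecke_z m n g \<noteq> 0} = coset (zpair m n :: 'p Gp)"
    by (intro Set.set_eqI) (simp add: hecke_z_def indicator_def)
  then show "coset_finite {g :: 'p Gp. hecke_z m n g \<noteq> 0}" by simp
qed

lemma hecke_dual_z: "hecke_dual (hecke_z m n) = (hecke_z (- m) (- n) :: 'p::prime_card Gp \<Rightarrow> real)"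
proof
  fix g :: "'p Gp"
  have "hecke_dual (hecke_z m n) g = hecke_const 1 (inverse (g * zpair m n))"
    by (simp add: hecke_dual_def hecke_z_eq Gp_inverse_mult zpair_inverse)
  also have "\<dots> = hecke_const 1 (zpair m n * g)"
    using fun_cong[OF hecke_dual_const[of 1, where ?'p = 'p], of "g * zpair m n"]
    by (simp add: hecke_dual_def zpair_commute)
  finally show "hecke_dual (hecke_z m n) g = hecke_z (- m) (- n) g" by (simp add: hecke_z_eq)
qed

definition zshift :: "int \<Rightarrow> int \<Rightarrow> ('p::prime_card Gp \<Rightarrow> real) \<Rightarrow> 'p Gp \<Rightarrow> real" where
  "zshift m n f = (\<lambda>g. f (g * zpair m n))"

lemma rinv_zshift: "rinv f \<Longrightarrow> rinv (zshift m n f)"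
  unfolding rinv_def zshift_def by (simp add: mult.assoc flip: zpair_commute) (simp flip: mult.assoc)

context haar
begin

lemma hecke_action_T1:
  assumes "rinv f"
  shows "hecke_action \<mu> T1 f x = (\<Sum>c<CARD('p). f (x * (t_fin c, 1))) + f (x * (t_inf, 1))"
proof -
  have "hecke_action \<mu> T1 f x = (\<Sum>s\<in>t_reps. T1 s * f (x * s))"
    by (rule hecke_action_sum[OF hecke_carrierD(3)[OF T1_carrier] assms _ t_reps_inj T1_support])
      (simp add: t_reps_def)
  also have "\<dots> = (\<Sum>s\<in>t_reps. f (x * s))" by (rule sum.cong) (simp_all add: T1_reps)
  finally show ?thesis by (simp add: t_reps_sum)
qed

lemma hecke_action_T2:
  assumes "rinv f"
  shows "hecke_action \<mu> T2 f x = hecke_action \<mu> T1 (\<lambda>g. f (prod.swap g)) (prod.swap x)"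
proof -
  have "hecke_action \<mu> T2 f x = (\<Sum>s\<in>prod.swap ` t_reps. T2 s * f (x * s))"
    by (rule hecke_action_sum[OF hecke_carrierD(3)[OF T2_carrier] assms _ T2_reps_inj T2_support])
      (simp add: t_reps_def)
  also have "\<dots> = (\<Sum>s\<in>t_reps. f (prod.swap (prod.swap x * s)))"
    by (subst sum.reindex) (simp_all add: T2_eq T1_reps swap_mult)
  also have "\<dots> = hecke_action \<mu> T1 (\<lambda>g. f (prod.swap g)) (prod.swap x)"
    by (simp add: t_reps_sum hecke_action_T1[OF rinv_swap[OF assms]])
  finally show ?thesis .
qed

lemma hecke_action_z:
  assumes "rinv f"
  shows "hecke_action \<mu> (hecke_z m n) f = zshift m n f"
proof
  fix x
  have "hecke_action \<mu> (hecke_z m n) f x = (\<Sum>s\<in>{zpair m n}. hecke_z m n s * f (x * s))"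
  proof (rule hecke_action_sum[OF hecke_carrierD(3)[OF hecke_z_carrier] assms])
    show "{g :: 'p Gp. hecke_z m n g \<noteq> 0} \<subseteq> (\<Union>s\<in>{zpair m n}. coset s)"
      by (rule subsetI) (simp add: hecke_z_def indicator_def split: if_splits)
  qed simp_all
  then show "hecke_action \<mu> (hecke_z m n) f x = zshift m n f x" by (simp add: hecke_z_def zshift_def)
qed

end

section \<open>The action on orbits\<close>

lemma orbit_fun_add: "orbit_fun f \<Longrightarrow> orbit_fun h \<Longrightarrow> orbit_fun (\<lambda>g. f g + h g)"
  by (simp add: orbit_fun_def)

lemma orbit_fun_scale: "orbit_fun f \<Longrightarrow> orbit_fun (\<lambda>g. c * f g)"
  by (simp add: orbit_fun_def)

lemma orbit_fun_zero: "orbit_fun (\<lambda>g. 0)"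
  by (simp add: orbit_fun_def)

lemma orbit_fun_if: "orbit_fun f \<Longrightarrow> orbit_fun h \<Longrightarrow> orbit_fun (\<lambda>g. if b then f g else h g)"
  by (cases b) simp_all

lemma val_one_plus:
  assumes "0 < i"
  shows "1 + pp powi i * of_nat c \<noteq> (0 :: 'p::prime_card padic)"
    "val (1 + pp powi i * of_nat c :: 'p padic) = 0"
proof -
  let ?w = "1 + pp powi i * of_nat c :: 'p padic"
  have d: "pdvd 1 (pp powi i * of_nat c :: 'p padic)"
    using pdvd_mono[OF pdvd_of_nat, of "1 - i" c] assms by simp
  have "\<not> pdvd 1 ?w"
  proof
    assume "pdvd 1 ?w"
    from pdvd_diff[OF this d] have "pdvd 1 (1 :: 'p padic)" by simp
    then show False by (simp add: pdvd_iff)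
  qed
  moreover have "pdvd 0 ?w" using pdvd_add[OF pdvd_1 pdvd_mono[OF d]] by simp
  ultimately show "?w \<noteq> 0" "val ?w = 0" by (auto simp: pdvd_iff)
qed

section \<open>Moving the first vertex to a neighbour\<close>

lemma orep_t_fin:
  "orep n m i j * (t_fin c, 1) =
    (gl2_of (pp powi (n + i + 1)) (pp powi n * (1 + pp powi i * of_nat c)) 0 (pp powi n),
      gl2_of (pp powi (m + j)) 0 0 (pp powi m) :: 'p::prime_card Hp)"
proof -
  have "gl2_of (pp powi (n + i)) (pp powi n) 0 (pp powi n) * t_fin c =
    gl2_of (pp powi (n + i + 1)) (pp powi n * (1 + pp powi i * of_nat c)) 0 (pp powi n :: 'p padic)"
    unfolding t_fin_def
    by (subst gl2_of_mult) (simp_all add: power_int_add algebra_simps)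
  then show ?thesis by (simp add: orep_def Gp_Pair_mult)
qed

lemma orep_t_inf:
  "orep n m i j * (t_inf, 1) =
    (gl2_of (pp powi (n + i)) (pp powi (n + 1)) 0 (pp powi (n + 1)),
      gl2_of (pp powi (m + j)) 0 0 (pp powi m) :: 'p::prime_card Hp)"
proof -
  have "gl2_of (pp powi (n + i)) (pp powi n) 0 (pp powi n) * t_inf =
    gl2_of (pp powi (n + i)) (pp powi (n + 1)) 0 (pp powi (n + 1) :: 'p padic)"
    unfolding t_inf_def
    by (subst gl2_of_mult) (simp_all add: power_int_add)
  then show ?thesis by (simp add: orep_def Gp_Pair_mult)
qed

text \<open>The child of the ball 1 + p^i Z_p is again a ball around a unit, so its ray still meets
  the other one in Z_p, one step further away.\<close>

lemma orb_t_fin_unit: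
  assumes "0 \<le> i" "0 \<le> j"
    and w: "1 + pp powi i * of_nat c \<noteq> (0 :: 'p::prime_card padic)"
      "val (1 + pp powi i * of_nat c :: 'p padic) = 0"
  shows "orb (orep n m i j * (t_fin c, 1) :: 'p Gp) = (n, m, i + 1, j)"
  unfolding orep_t_fin using assms
  by (subst orb_upper[where M = "n - m - j"]) (auto simp: pdvd_iff val_mult)

text \<open>For \<open>i = 0\<close> the first ball is Z_p, and the residue p - 1 gives the centre 1
  + (p - 1) = p. This is the child p Z_p that contains 0; it lies on the way to the second vertex
  unless \<open>j = 0\<close>.\<close>

lemma orb_t_fin_last:
  assumes "0 \<le> j"
  shows "orb (orep n m 0 j * (t_fin (CARD('p) - 1), 1) :: 'p::prime_card Gp) =
    (if j = 0 then (n, m, 1, 0) else (n, m, 0, j - 1))"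
proof -
  have "(1 + of_nat (CARD('p) - 1) :: 'p padic) = pp"
    using card_pos[where ?'p = 'p] by (simp add: of_nat_diff)
  then have "pp powi n * (1 + pp powi 0 * of_nat (CARD('p) - 1) :: 'p padic) = pp powi (n + 1)"
    by (simp add: power_int_add)
  then show ?thesis
    unfolding orep_t_fin using assms
    by (subst orb_upper[where M = "n - m + min (1 - j) 0"]) (auto simp: pdvd_iff)
qed

text \<open>A step to the parent shortens the first ray; for \<open>i = 0\<close> it moves the
  meeting point along and lengthens the other ray.\<close>

lemma orb_t_inf:
  assumes "0 \<le> i" "0 \<le> j"
  shows "orb (orep n m i j * (t_inf, 1) :: 'p::prime_card Gp) =
    (if i = 0 then (n + 1, m, 0, j + 1) else (n + 1, m, i - 1, j))"
  unfolding orep_t_inf using assms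
  by (subst orb_upper[where M = "n - m + (if i = 0 then - j else 1 - j)"]) (auto simp: pdvd_iff)

lemma orb_zpair: "orb g = (n, m, i, j) \<Longrightarrow> orb (g * zpair a b :: 'p::prime_card Gp) = (n + a, m + b, i, j)"
proof -
  assume o: "orb g = (n, m, i, j)"
  have "inverse (snd (g * zpair a b)) * fst (g * zpair a b) =
    inverse (snd g) * fst g * (zscal (- b) * zscal a)"
  proof -
    have "inverse (zscal b) = (zscal (- b) :: 'p Hp)"
      by (rule gl2_inverse_unique) (simp add: zscal_add)
    then show ?thesis by (simp add: zpair_def gl2_inverse_mult mult.assoc zscal_commute[of "- b"])
  qed
  then have "cont (inverse (snd (g * zpair a b)) * fst (g * zpair a b)) =
    cont (inverse (snd g) * fst g) + (a - b)"
    by (simp add: zscal_add cont_mult_zscal)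
  then show ?thesis
    using o by (auto simp: orb_def Let_def zpair_def rcont_mult_zscal dval_mult dval_zscal)
qed

lemma zshift_orb_ind:
  "zshift a b (orb_ind n m i j) = (orb_ind (n - a) (m - b) i j :: 'p::prime_card Gp \<Rightarrow> real)"
proof
  fix g :: "'p Gp"
  obtain n' m' i' j' where "orb g = (n', m', i', j')" by (cases "orb g")
  then show "zshift a b (orb_ind n m i j) g = orb_ind (n - a) (m - b) i j g"
    by (auto simp: zshift_def orb_ind_def orb_zpair)
qed

lemma orb_swap: "orb g = (n, m, i, j) \<Longrightarrow> orb (prod.swap g :: 'p::prime_card Gp) = (m, n, j, i)"
proof -
  let ?h = "inverse (snd g) * fst g"
  have "inverse (fst g) * snd g = inverse ?h" by (simp add: gl2_inverse_mult)
  then have "cont (inverse (fst g) * snd g) = cont ?h - (dval (fst g) - dval (snd g))"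
    by (simp add: cont_inverse dval_mult dval_inverse)
  then show "orb g = (n, m, i, j) \<Longrightarrow> ?thesis" by (auto simp: orb_def Let_def)
qed

lemma orb_ind_swap: "orb_ind n m i j (prod.swap g) = orb_ind m n j i (g :: 'p::prime_card Gp)"
proof -
  obtain n' m' i' j' where "orb g = (n', m', i', j')" by (cases "orb g")
  then show ?thesis by (auto simp: orb_ind_def orb_swap)
qed

text \<open>The left side runs over the neighbours of the orbit \<open>(n, m, i, j)\<close>, the
  right side over the orbits that have \<open>(a, b, c, d)\<close> as a neighbour: the identity
  transposes the neighbour relation.\<close>

lemma neighbour_identity:
  fixes p :: real and a b c d n m i j :: int
  assumes "0 \<le> c" "0 \<le> d" "0 \<le> i" "0 \<le> j" and E: "\<And>n m i j a b c d. E n m i j a b c d = (of_bool (a = n \<and> b = m \<and> c = i \<and> d = j) :: real)"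
  shows "(if 0 < i then p * E a b c d n m (i + 1) j + E a b c d (n + 1) m (i - 1) j
     else if j = 0 then p * E a b c d n m 1 0 + E a b c d (n + 1) m 0 1
     else (p - 1) * E a b c d n m 1 j + E a b c d n m 0 (j - 1) + E a b c d (n + 1) m 0 (j + 1)) = 
  (if c = 0 then 0 else if c = 1 \<and> 0 < d then (p - 1) * E a b 0 d n m i j
      else p * E a b (c - 1) d n m i j)
    + E (a - 1) b (c + 1) d n m i j
    + (if c = 0 then E a b 0 (d + 1) n m i j else 0)
    + (if c = 0 \<and> 0 < d then E (a - 1) b 0 (d - 1) n m i j else 0)"
proof -
  \<comment> \<open>Terms are sorted by the scaling index, \<open>\<alpha>\<close> for
    \<open>n\<close> unchanged and \<open>\<beta>\<close> for \<open>n\<close> raised by one. Each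
    half is then a case distinction on the distances alone.\<close>
  define \<alpha> \<beta> :: real where "\<alpha> = of_bool (n = a \<and> m = b)" and "\<beta> = of_bool (n = a - 1 \<and> m = b)"
  have E1: "E a b c d n m i j = \<alpha> * of_bool (i = c \<and> j = d)" for c d i j
    unfolding E \<alpha>_def by (simp add: of_bool_conj[symmetric] conj_assoc del: of_bool_conj)
  have E2: "E a b c d (n + 1) m i j = \<beta> * of_bool (i = c \<and> j = d)" for c d i j
    unfolding E \<beta>_def by (simp add: of_bool_conj[symmetric] conj_assoc eq_diff_eq del: of_bool_conj)
  have E3: "E (a - 1) b c d n m i j = \<beta> * of_bool (i = c \<and> j = d)" for c d i j
    unfolding E \<beta>_def by (simp add: of_bool_conj[symmetric] conj_assoc del: of_bool_conj)
  have A: "(if 0 < i then p * of_bool (i + 1 = c \<and> j = d)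
     else if j = 0 then p * of_bool (1 = c \<and> 0 = d)
     else (p - 1) * of_bool (1 = c \<and> j = d) + of_bool (0 = c \<and> j - 1 = d)) = 
    (if c = 0 then 0 else if c = 1 \<and> 0 < d then (p - 1) * of_bool (i = 0 \<and> j = d)
      else p * of_bool (i = c - 1 \<and> j = d))
    + (if c = 0 then of_bool (i = 0 \<and> j = d + 1) else 0)"
    using assms(1-4) by auto
  have B: "(if 0 < i then of_bool (i - 1 = c \<and> j = d)
     else if j = 0 then of_bool (0 = c \<and> 1 = d)
     else of_bool (0 = c \<and> j + 1 = d)) = 
    (of_bool (i = c + 1 \<and> j = d) :: real)
    + (if c = 0 \<and> 0 < d then of_bool (i = 0 \<and> j = d - 1) else 0)"
    using assms(1-4) by auto
  have pull: "(if P then p * (\<alpha> * x1) + \<beta> * y1 else if Q then p * (\<alpha> * x2) + \<beta> * y2 else (p - 1) * (\<alpha> * x3) + \<alpha> * x4 + \<beta> * y3) =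
    \<alpha> * (if P then p * x1 else if Q then p * x2 else (p - 1) * x3 + x4) + \<beta> * (if P then y1 else if Q then y2 else y3)"
    for P Q x1 x2 x3 x4 y1 y2 y3
    by (simp add: algebra_simps)
  show ?thesis
    unfolding E1 E2 E3 pull A B by (simp add: algebra_simps)
qed

context haar
begin

lemma hecke_action_orbit_fun:
  assumes "\<theta> \<in> hecke_carrier" "orbit_fun f"
  shows "orbit_fun (hecke_action \<mu> \<theta> f)"
proof -
  have "hecke_action \<mu> \<theta> f (u * x) = hecke_action \<mu> \<theta> f x" if "u \<in> mirabolic" for u x
  proof -
    have "f (u * y) = f y" for y
      using assms(2) that Gp0_one unfolding orbit_fun_def by (metis mult.right_neutral)
    then show ?thesis by (simp add: hecke_action_def mult.assoc)
  qed
  moreover have "rinv (hecke_action \<mu> \<theta> f)"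
    using assms orbit_fun_rinv by (intro hecke_action_rinv)
  ultimately show ?thesis unfolding orbit_fun_def rinv_def by simp
qed

text \<open>The p neighbours away from the end lie in one orbit unless \<open>i = 0\<close> and
  \<open>0 < j\<close>; then one of them leads towards the second vertex, and p - 1 remain.\<close>

lemma hecke_action_T1_orep:
  assumes f: "orbit_fun f" and ij: "0 \<le> i" "0 \<le> j"
  shows "hecke_action \<mu> T1 f (orep n m i j) =
    (if 0 < i then real CARD('p) * f (orep n m (i + 1) j) + f (orep (n + 1) m (i - 1) j)
     else if j = 0 then real CARD('p) * f (orep n m 1 0) + f (orep (n + 1) m 0 1)
     else (real CARD('p) - 1) * f (orep n m 1 j) + f (orep n m 0 (j - 1)) + f (orep (n + 1) m 0 (j + 1)))"
proof -
  let ?x = "orep n m i j :: 'p Gp"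
  have val: "f g = f (orep n' m' i' j')" if "orb g = (n', m', i', j')" "0 \<le> i'" "0 \<le> j'" for g n' m' i' j'
    by (rule orbit_fun_orb[OF f]) (use that in \<open>simp add: orb_orep\<close>)
  have inf: "f (?x * (t_inf, 1)) = (if i = 0 then f (orep (n + 1) m 0 (j + 1)) else f (orep (n + 1) m (i - 1) j))"
    using val[OF trans[OF orb_t_inf[OF ij, of n m]]] ij by (cases "i = 0") simp_all
  have fin: "f (?x * (t_fin c, 1)) = f (orep n m (i + 1) j)" if c: "c < CARD('p)" "0 < i \<or> c < CARD('p) - 1" for c
  proof (rule val[OF orb_t_fin_unit])
    have "0 < i \<or> i = 0 \<and> 0 < Suc c \<and> Suc c < CARD('p)" using ij c by auto
    then have "1 + pp powi i * of_nat c \<noteq> (0 :: 'p padic) \<and> val (1 + pp powi i * of_nat c :: 'p padic) = 0"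
    proof (elim disjE conjE)
      assume "i = 0" "0 < Suc c" "Suc c < CARD('p)"
      then show ?thesis using val_of_nat_coprime[of "Suc c", where ?'p = 'p] by simp
    qed (simp add: val_one_plus)
    then show "1 + pp powi i * of_nat c \<noteq> (0 :: 'p padic)" "val (1 + pp powi i * of_nat c :: 'p padic) = 0"
      by simp_all
  qed (use ij in simp_all)
  obtain q where q: "CARD('p) = Suc q" using card_pos[where ?'p = 'p] gr0_implies_Suc by blast
  have sum: "(\<Sum>c<CARD('p). f (?x * (t_fin c, 1))) =
      (\<Sum>c<q. f (?x * (t_fin c, 1))) + f (?x * (t_fin (CARD('p) - 1), 1))"
    unfolding q by simp
  have sumq: "(\<Sum>c<q. f (?x * (t_fin c, 1))) = real q * f (orep n m (i + 1) j)"
    using fin q by simp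
  have last: "f (?x * (t_fin (CARD('p) - 1), 1)) =
      (if 0 < i then f (orep n m (i + 1) j) else if j = 0 then f (orep n m 1 0) else f (orep n m 0 (j - 1)))"
  proof (cases "0 < i")
    case True
    then show ?thesis using fin[of "CARD('p) - 1"] card_pos[where ?'p = 'p] by simp
  next
    case False
    then have "i = 0" using ij by simp
    then show ?thesis using val[OF trans[OF orb_t_fin_last[OF ij(2), of n m]]] ij(2) by (cases "j = 0") simp_all
  qed
  have "hecke_action \<mu> T1 f ?x = (\<Sum>c<CARD('p). f (?x * (t_fin c, 1))) + f (?x * (t_inf, 1))"
    by (rule hecke_action_T1[OF orbit_fun_rinv[OF f]])
  then show ?thesis
    unfolding sum sumq last inf using q ij by (auto simp: algebra_simps)
qed

text \<open>The coefficient p - 1 for \<open>c = 1\<close> and \<open>0 < d\<close> is where this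
  generator of the ideal comes from: the step from the boundary orbit into the interior involves the
  boundary function with this factor only.\<close>

lemma hecke_action_T1_orb_ind:
  assumes "0 \<le> c" "0 \<le> d"
  shows "hecke_action \<mu> T1 (orb_ind a b c d) = (\<lambda>g.
    (if c = 0 then 0 else if c = 1 \<and> 0 < d then (real CARD('p) - 1) * orb_ind a b 0 d g
      else real CARD('p) * orb_ind a b (c - 1) d g)
    + orb_ind (a - 1) b (c + 1) d g
    + (if c = 0 then orb_ind a b 0 (d + 1) g else 0)
    + (if c = 0 \<and> 0 < d then orb_ind (a - 1) b 0 (d - 1) g else 0))"
    (is "_ = ?r")
proof (rule orbit_fun_eqI)
  show "orbit_fun (hecke_action \<mu> T1 (orb_ind a b c d))"
    by (rule hecke_action_orbit_fun[OF T1_carrier orbit_fun_orb_ind])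
  show "orbit_fun ?r"
    by (intro orbit_fun_add orbit_fun_scale orbit_fun_if orbit_fun_zero orbit_fun_orb_ind)
  fix n m i j :: int
  assume ij: "0 \<le> i" "0 \<le> j"
  show "hecke_action \<mu> T1 (orb_ind a b c d) (orep n m i j) = ?r (orep n m i j)"
  proof -
    let ?E = "\<lambda>a b c d n m i j :: int. of_bool (n = a \<and> m = b \<and> i = c \<and> j = d) :: real"
    have "hecke_action \<mu> T1 (orb_ind a b c d) (orep n m i j) =
      (if 0 < i then real CARD('p) * ?E a b c d n m (i + 1) j + ?E a b c d (n + 1) m (i - 1) j
       else if j = 0 then real CARD('p) * ?E a b c d n m 1 0 + ?E a b c d (n + 1) m 0 1
       else (real CARD('p) - 1) * ?E a b c d n m 1 j + ?E a b c d n m 0 (j - 1) + ?E a b c d (n + 1) m 0 (j + 1))"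
      unfolding hecke_action_T1_orep[OF orbit_fun_orb_ind ij]
    proof (intro if_cong refl)
      assume "0 < i"
      then have "0 \<le> i + 1" "0 \<le> i - 1" by simp_all
      then show "real CARD('p) * orb_ind a b c d (orep n m (i + 1) j :: 'p Gp) + orb_ind a b c d (orep (n + 1) m (i - 1) j :: 'p Gp) =
          real CARD('p) * ?E a b c d n m (i + 1) j + ?E a b c d (n + 1) m (i - 1) j"
        using ij by (simp only: orb_ind_orep)
    next
      show "real CARD('p) * orb_ind a b c d (orep n m 1 0 :: 'p Gp) + orb_ind a b c d (orep (n + 1) m 0 1 :: 'p Gp) =
          real CARD('p) * ?E a b c d n m 1 0 + ?E a b c d (n + 1) m 0 1"
        by (simp only: orb_ind_orep zero_le_one order_refl)
    next
      assume "j \<noteq> 0"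
      then have "0 \<le> j + 1" "0 \<le> j - 1" using ij by simp_all
      then show "(real CARD('p) - 1) * orb_ind a b c d (orep n m 1 j :: 'p Gp) + orb_ind a b c d (orep n m 0 (j - 1) :: 'p Gp)
          + orb_ind a b c d (orep (n + 1) m 0 (j + 1) :: 'p Gp) =
          (real CARD('p) - 1) * ?E a b c d n m 1 j + ?E a b c d n m 0 (j - 1) + ?E a b c d (n + 1) m 0 (j + 1)"
        using ij by (simp only: orb_ind_orep zero_le_one order_refl)
    qed
    also have "\<dots> = ?r (orep n m i j)"
      unfolding orb_ind_orep[OF ij] by (rule neighbour_identity[where E = ?E, OF assms ij refl])
    finally show ?thesis .
  qed
qed

lemma hecke_action_T2_orb_ind:
  assumes "0 \<le> c" "0 \<le> d"
  shows "hecke_action \<mu> T2 (orb_ind b a d c) = (\<lambda>g.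
    (if c = 0 then 0 else if c = 1 \<and> 0 < d then (real CARD('p) - 1) * orb_ind b a d 0 g
      else real CARD('p) * orb_ind b a d (c - 1) g)
    + orb_ind b (a - 1) d (c + 1) g
    + (if c = 0 then orb_ind b a (d + 1) 0 g else 0)
    + (if c = 0 \<and> 0 < d then orb_ind b (a - 1) (d - 1) 0 g else 0))"
proof
  fix g
  have "hecke_action \<mu> T2 (orb_ind b a d c) g = hecke_action \<mu> T1 (orb_ind a b c d) (prod.swap g)"
    by (simp add: hecke_action_T2 orbit_fun_rinv orbit_fun_orb_ind orb_ind_swap)
  then show "hecke_action \<mu> T2 (orb_ind b a d c) g =
    (if c = 0 then 0 else if c = 1 \<and> 0 < d then (real CARD('p) - 1) * orb_ind b a d 0 g
      else real CARD('p) * orb_ind b a d (c - 1) g)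
    + orb_ind b (a - 1) d (c + 1) g
    + (if c = 0 then orb_ind b a (d + 1) 0 g else 0)
    + (if c = 0 \<and> 0 < d then orb_ind b (a - 1) (d - 1) 0 g else 0)"
    by (simp only: hecke_action_T1_orb_ind[OF assms] orb_ind_swap)
qed

end

section \<open>The Rankin--Selberg polynomial at one\<close>

lemma (in ring) eval_degree_4_one:
  assumes "a \<in> carrier R" "b \<in> carrier R" "c \<in> carrier R" "d \<in> carrier R" "e \<in> carrier R"
  shows "eval [a, b, c, d, e] \<one> = a \<oplus> (b \<oplus> (c \<oplus> (d \<oplus> e)))"
  using assms by simp

lemma rinv_add: "rinv f \<Longrightarrow> rinv h \<Longrightarrow> rinv (\<lambda>g. f g + h g)"
  and rinv_scale: "rinv f \<Longrightarrow> rinv (\<lambda>g. c * f g)"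
  and rinv_uminus: "rinv f \<Longrightarrow> rinv (\<lambda>g. - f g)"
  by (simp_all add: rinv_def)

lemma rinv_orb_ind: "rinv (orb_ind n m i j)"
  by (rule orbit_fun_rinv[OF orbit_fun_orb_ind])

text \<open>The inverse of diag(p, 1) is p^(-1) times an element of the same double coset, so the
  dual of \<open>T1\<close> is \<open>T1\<close> divided by \<open>S1\<close>.\<close>

lemma hecke_dual_T1: "hecke_dual T1 g = T1 (g * zpair 1 0 :: 'p::prime_card Gp)"
proof -
  have "inverse (snd g) \<in> Hp0 \<longleftrightarrow> snd g \<in> Hp0"
    using Hp0_inverse[of "snd g"] Hp0_inverse[of "inverse (snd g)"] by (metis gl2_inverse_inverse)
  then show ?thesis
    by (auto simp: hecke_dual_def T1_eq dval_inverse cont_inverse zpair_def dval_mult dval_zscal cont_mult_zscal)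
qed

lemma hecke_dual_T2: "hecke_dual T2 g = T2 (g * zpair 0 1 :: 'p::prime_card Gp)"
proof -
  have "hecke_dual T2 g = hecke_dual T1 (prod.swap g)"
    by (simp add: hecke_dual_def T2_eq swap_inverse)
  also have "\<dots> = T2 (g * zpair 0 1)"
    unfolding hecke_dual_T1 T2_eq swap_mult by (simp add: zpair_def)
  finally show ?thesis .
qed

lemma zshift_add: "zshift a b (\<lambda>g. f g + h g) = (\<lambda>g. zshift a b f g + zshift a b h g)"
  and zshift_scale: "zshift a b (\<lambda>g. c * f g) = (\<lambda>g. c * zshift a b f g)"
  and zshift_diff: "zshift a b (\<lambda>g. f g - h g) = (\<lambda>g. zshift a b f g - zshift a b h g)"
  and zshift_uminus: "zshift a b (\<lambda>g. - f g) = (\<lambda>g. - zshift a b f g)"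
  by (simp_all add: zshift_def)

context haar
begin

lemma hecke_z_convolution:
  assumes "\<theta> \<in> hecke_carrier"
  shows "convolution \<mu> (hecke_z m n) \<theta> g = \<theta> (g * zpair (- m) (- n))"
  unfolding convolution_eq_action hecke_action_z[OF hecke_carrierD(3)[OF hecke_dual_carrier[OF assms]]]
  by (simp add: zshift_def hecke_dual_def Gp_inverse_mult zpair_inverse zpair_commute)

text \<open>The ideal involves the dual of the polynomial. Acting through duals allows it to be
  expanded monomial by monomial, the factors of a product being applied in reverse order.\<close>

definition dual_action :: "('p Gp \<Rightarrow> real) \<Rightarrow> ('p Gp \<Rightarrow> real) \<Rightarrow> 'p Gp \<Rightarrow> real" where
  "dual_action \<theta> = hecke_action \<mu> (hecke_dual \<theta>)"

lemma dual_action_add: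
  assumes "\<theta> \<in> hecke_carrier" "\<eta> \<in> hecke_carrier" "rinv f"
  shows "dual_action (\<lambda>g. \<theta> g + \<eta> g) f = (\<lambda>g. dual_action \<theta> f g + dual_action \<eta> f g)"
  using hecke_action_add_left[OF hecke_dual_carrier[OF assms(1)] hecke_dual_carrier[OF assms(2)] assms(3)]
  by (simp add: dual_action_def hecke_dual_def)

lemma dual_action_uminus: "dual_action (\<lambda>g. - \<theta> g) f = (\<lambda>g. - dual_action \<theta> f g)"
  using hecke_action_scale_left[of "- 1" "hecke_dual \<theta>" f] by (simp add: dual_action_def hecke_dual_def)

lemma dual_action_convolution:
  assumes "\<theta> \<in> hecke_carrier" "\<eta> \<in> hecke_carrier" "rinv f"
  shows "dual_action (convolution \<mu> \<theta> \<eta>) f = dual_action \<eta> (dual_action \<theta> f)"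
  using assms by (simp add: dual_action_def hecke_dual_antimult hecke_action_convolution hecke_dual_carrier)

lemma dual_action_const: "rinv f \<Longrightarrow> dual_action (hecke_const c) f = (\<lambda>g. c * f g)"
  by (simp add: dual_action_def hecke_action_const)

lemma dual_action_z: "rinv f \<Longrightarrow> dual_action (hecke_z m n) f = zshift (- m) (- n) f"
  by (simp add: dual_action_def hecke_dual_z hecke_action_z)

lemma dual_action_shift:
  assumes \<theta>: "\<theta> \<in> hecke_carrier" and f: "rinv f" and "\<And>g. hecke_dual \<theta> g = \<theta> (g * zpair m n)"
  shows "dual_action \<theta> f = zshift (- m) (- n) (hecke_action \<mu> \<theta> f)"
proof -
  have "hecke_dual \<theta> = convolution \<mu> (hecke_z (- m) (- n)) \<theta>"
    using assms(3) by (simp add: fun_eq_iff hecke_z_convolution[OF \<theta>])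
  then show ?thesis unfolding dual_action_def
    by (simp add: hecke_action_convolution[OF hecke_z_carrier \<theta> f] hecke_action_z hecke_action_rinv \<theta> f)
qed

lemma dual_action_T1: "rinv f \<Longrightarrow> dual_action T1 f = zshift (- 1) 0 (hecke_action \<mu> T1 f)"
  using dual_action_shift[OF T1_carrier _ hecke_dual_T1] by simp

lemma dual_action_T2: "rinv f \<Longrightarrow> dual_action T2 f = zshift 0 (- 1) (hecke_action \<mu> T2 f)"
  using dual_action_shift[OF T2_carrier _ hecke_dual_T2] by simp

text \<open>Unfolds the evaluation in the abstract ring into functions. The nesting of the sum is
  that of \<open>eval\<close> on a list of coefficients, and \<open>dual_action_expand\<close> is
  shaped to match it.\<close>

lemma hecke_poly_at_1_eq:
  fixes q :: "'p Gp \<Rightarrow> real"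
  defines "q \<equiv> hecke_const (1 / of_nat CARD('p))"
  shows "hecke_poly_at_1 \<mu> =
    (\<lambda>g. convolution \<mu> (convolution \<mu> S1 S1) (convolution \<mu> S2 S2) g
      + (- convolution \<mu> (convolution \<mu> (convolution \<mu> (convolution \<mu> q S1) S2) T1) T2 g
      + ((convolution \<mu> (convolution \<mu> q S1) (convolution \<mu> T2 T2) g
          + convolution \<mu> (convolution \<mu> q S2) (convolution \<mu> T1 T1) g
          + - convolution \<mu> (convolution \<mu> (hecke_const 2) S1) S2 g)
      + (- convolution \<mu> (convolution \<mu> q T1) T2 g + hecke_const 1 g))))" (is ?eq)
    and "hecke_poly_at_1 \<mu> \<in> hecke_carrier" (is ?car)
proof -
  interpret R: ring "hecke \<mu>" by (rule ring_hecke)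
  have q: "q \<in> carrier (hecke \<mu>)" "hecke_const 2 \<in> carrier (hecke \<mu>)"
    unfolding q_def hecke_sel
    using hecke_const_carrier[OF Z_inv_inverse, where ?'p = 'p] hecke_const_carrier[OF Z_inv_of_int[of 2], where ?'p = 'p]
    by simp_all
  have ST: "S1 \<in> carrier (hecke \<mu>)" "S2 \<in> carrier (hecke \<mu>)" "T1 \<in> carrier (hecke \<mu>)" "T2 \<in> carrier (hecke \<mu>)"
    by (simp_all add: S1_eq S2_eq hecke_z_carrier T1_carrier T2_carrier)
  have sq: "x [^]\<^bsub>hecke \<mu>\<^esub> (2::nat) = x \<otimes>\<^bsub>hecke \<mu>\<^esub> x" if "x \<in> carrier (hecke \<mu>)" for x
    using that by (simp add: numeral_2_eq_2 del: hecke_sel)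
  have *: "hecke_poly_at_1 \<mu> =
      (S1 \<otimes>\<^bsub>hecke \<mu>\<^esub> S1) \<otimes>\<^bsub>hecke \<mu>\<^esub> (S2 \<otimes>\<^bsub>hecke \<mu>\<^esub> S2) \<oplus>\<^bsub>hecke \<mu>\<^esub>
      (\<ominus>\<^bsub>hecke \<mu>\<^esub> (q \<otimes>\<^bsub>hecke \<mu>\<^esub> S1 \<otimes>\<^bsub>hecke \<mu>\<^esub> S2 \<otimes>\<^bsub>hecke \<mu>\<^esub> T1 \<otimes>\<^bsub>hecke \<mu>\<^esub> T2) \<oplus>\<^bsub>hecke \<mu>\<^esub>
      ((q \<otimes>\<^bsub>hecke \<mu>\<^esub> S1 \<otimes>\<^bsub>hecke \<mu>\<^esub> (T2 \<otimes>\<^bsub>hecke \<mu>\<^esub> T2) \<oplus>\<^bsub>hecke \<mu>\<^esub>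
        q \<otimes>\<^bsub>hecke \<mu>\<^esub> S2 \<otimes>\<^bsub>hecke \<mu>\<^esub> (T1 \<otimes>\<^bsub>hecke \<mu>\<^esub> T1) \<oplus>\<^bsub>hecke \<mu>\<^esub>
        \<ominus>\<^bsub>hecke \<mu>\<^esub> (hecke_const 2 \<otimes>\<^bsub>hecke \<mu>\<^esub> S1 \<otimes>\<^bsub>hecke \<mu>\<^esub> S2)) \<oplus>\<^bsub>hecke \<mu>\<^esub>
      (\<ominus>\<^bsub>hecke \<mu>\<^esub> (q \<otimes>\<^bsub>hecke \<mu>\<^esub> T1 \<otimes>\<^bsub>hecke \<mu>\<^esub> T2) \<oplus>\<^bsub>hecke \<mu>\<^esub> \<one>\<^bsub>hecke \<mu>\<^esub>)))"
    unfolding hecke_poly_at_1_def hecke_poly_def Let_def q_def[symmetric] a_minus_def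
    by (subst R.eval_degree_4_one) (simp_all add: q ST sq del: hecke_sel)
  have "hecke_poly_at_1 \<mu> \<in> carrier (hecke \<mu>)"
    unfolding * by (intro R.a_closed R.m_closed R.a_inv_closed R.one_closed q ST)
  then show ?car by simp
  show ?eq unfolding * using q ST
    by (simp add: hecke_a_inv convolution_carrier)
qed

lemma hecke_action_zshift: "hecke_action \<mu> \<theta> (zshift m n f) = zshift m n (hecke_action \<mu> \<theta> f)"
  by (simp add: hecke_action_def zshift_def fun_eq_iff mult.assoc zpair_commute)

lemma convolution_scale_right: "convolution \<mu> \<theta> (\<lambda>g. c * \<eta> g) = (\<lambda>g. c * convolution \<mu> \<theta> \<eta> g)"
  by (simp add: convolution_def mult.left_commute)

lemma hecke_uminus_carrier: "\<theta> \<in> hecke_carrier \<Longrightarrow> (\<lambda>g. - \<theta> g) \<in> (hecke_carrier :: ('p Gp \<Rightarrow> real) set)"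
  using hecke_scale_carrier[of \<theta> "- 1"] Z_inv_of_int[of "- 1"] by simp

lemma dual_action_expand:
  assumes "a \<in> hecke_carrier" "b \<in> hecke_carrier" "c1 \<in> hecke_carrier" "c2 \<in> hecke_carrier"
    "c3 \<in> hecke_carrier" "d \<in> hecke_carrier" "e \<in> hecke_carrier" "rinv f"
  shows "dual_action (\<lambda>g. a g + (- b g + ((c1 g + c2 g + - c3 g) + (- d g + e g)))) f =
    (\<lambda>g. dual_action a f g + (- dual_action b f g + ((dual_action c1 f g + dual_action c2 f g
      + - dual_action c3 f g) + (- dual_action d f g + dual_action e f g))))"
proof -
  note um = hecke_uminus_carrier[OF assms(2)] hecke_uminus_carrier[OF assms(5)] hecke_uminus_carrier[OF assms(6)]
  note c12 = hecke_add_carrier[OF assms(3,4)]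
  note c = hecke_add_carrier[OF c12 um(2)]
  note de = hecke_add_carrier[OF um(3) assms(7)]
  note cde = hecke_add_carrier[OF c de]
  note bcde = hecke_add_carrier[OF um(1) cde]
  show ?thesis
    unfolding dual_action_add[OF assms(1) bcde assms(8)] dual_action_add[OF um(1) cde assms(8)]
      dual_action_add[OF c de assms(8)] dual_action_add[OF c12 um(2) assms(8)]
      dual_action_add[OF assms(3,4,8)] dual_action_add[OF um(3) assms(7,8)] dual_action_uminus ..
qed

text \<open>
  With \<open>e\<^sub>i\<^sub>j\<close> for the indicator function of the orbit \<open>(0, 0, i, j)\<close>, so that \<open>e\<^sub>0\<^sub>0 = f\<^sub>0\<close>, this reads
  \<open>p \<S>\<^sub>p \<P>\<^sub>p(1)' \<cdot> f\<^sub>0 = (1 - \<S>\<^sub>p) \<cdot> (e\<^sub>1\<^sub>1 - (p - 1) e\<^sub>0\<^sub>0)\<close>.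
\<close>

lemma dual_poly_action_f0:
  "real CARD('p) * zshift 1 1 (hecke_action \<mu> (hecke_dual (hecke_poly_at_1 \<mu>)) (orb_ind 0 0 0 0)) g =
    (orb_ind 0 0 1 1 g - orb_ind (- 1) (- 1) 1 1 g)
    - (real CARD('p) - 1) * (orb_ind 0 0 0 0 g - orb_ind (- 1) (- 1) 0 0 g)"
proof -
  have q: "hecke_const (1 / real CARD('p)) \<in> (hecke_carrier :: ('p Gp \<Rightarrow> real) set)"
    "hecke_const 2 \<in> (hecke_carrier :: ('p Gp \<Rightarrow> real) set)" "hecke_const 1 \<in> (hecke_carrier :: ('p Gp \<Rightarrow> real) set)"
    using hecke_const_carrier[OF Z_inv_inverse, where ?'p = 'p] hecke_const_carrier[OF Z_inv_of_int[of 2], where ?'p = 'p]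
      hecke_const_carrier[OF Z_inv_1, where ?'p = 'p]
    by simp_all
  have p: "real CARD('p) \<noteq> 0" using card_pos[where ?'p = 'p] by simp
  note car = q convolution_carrier hecke_z_carrier T1_carrier T2_carrier
  note ri = rinv_add rinv_scale rinv_uminus rinv_orb_ind rinv_zshift hecke_action_rinv
  define r where "r = 1 / real CARD('p)"
  have r: "real CARD('p) * (r * x) = x" for x using p by (simp add: r_def)
  have r': "r * (real CARD('p) * x) = x" for x using p by (simp add: r_def)
  \<comment> \<open>The dual of S_p shifts by (-1, -1), so after the shift by (1, 1) the leading
    term of the polynomial gives the orbit function at (1, 1) and the constant term the one at (-1,
    -1).\<close>
  have Z: "zshift 1 1 (dual_action (hecke_poly_at_1 \<mu>) (orb_ind 0 0 0 0)) g =
    orb_ind 1 1 0 0 g - r * (hecke_action \<mu> T2 (hecke_action \<mu> T1 (orb_ind 1 1 0 0)) g)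
    + (r * hecke_action \<mu> T2 (hecke_action \<mu> T2 (orb_ind 0 1 0 0)) g
      + r * hecke_action \<mu> T1 (hecke_action \<mu> T1 (orb_ind 1 0 0 0)) g - 2 * orb_ind 0 0 0 0 g)
    - r * hecke_action \<mu> T2 (hecke_action \<mu> T1 (orb_ind 0 0 0 0)) g + orb_ind (- 1) (- 1) 0 0 g"
    unfolding hecke_poly_at_1_eq S1_eq S2_eq r_def[symmetric]
  proof (subst dual_action_expand)
  qed (simp_all only: car[folded r_def] rinv_orb_ind, simp add: car[folded r_def] ri dual_action_convolution dual_action_const
        dual_action_z dual_action_T1 dual_action_T2 zshift_add zshift_scale zshift_uminus zshift_diff zshift_orb_ind
        hecke_action_scale_right hecke_action_zshift[symmetric])
  \<comment> \<open>The recursions evaluate the products of two operators. The functions of the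
    orbits with distances (2, 0) and (0, 2) cancel, and those with (0, 0) and (1, 1) remain.\<close>
  show ?thesis
    unfolding dual_action_def[symmetric] Z
    by (simp add: ri T1_carrier T2_carrier hecke_action_T1_orb_ind hecke_action_T2_orb_ind
        hecke_action_add_right hecke_action_scale_right) (simp add: r r' algebra_simps)
qed

section \<open>Divisibility by the generators\<close>

definition left_ideal :: "('p Gp \<Rightarrow> real) set \<Rightarrow> bool" where
  "left_ideal J \<longleftrightarrow> J \<subseteq> hecke_carrier \<and> (\<lambda>_. 0) \<in> J \<and> (\<forall>a\<in>J. \<forall>b\<in>J. (\<lambda>g. a g + b g) \<in> J) \<and>
     (\<forall>\<theta>\<in>hecke_carrier. \<forall>a\<in>J. convolution \<mu> \<theta> a \<in> J)"

text \<open>\<open>good J f\<close> means that \<open>(1 - \<S>\<^sub>p) \<cdot> f\<close> lies in \<open>J \<cdot> f0\<close>.\<close>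

definition good :: "('p Gp \<Rightarrow> real) set \<Rightarrow> ('p Gp \<Rightarrow> real) \<Rightarrow> bool" where
  "good J f \<longleftrightarrow> rinv f \<and> (\<exists>a\<in>J. (\<lambda>g. f g - zshift 1 1 f g) = hecke_action \<mu> a f0)"

lemma rinv_f0: "rinv f0"
  unfolding f0_eq by (rule rinv_orb_ind)

lemma good_add:
  assumes J: "left_ideal J" and "good J f" "good J h"
  shows "good J (\<lambda>g. f g + h g)"
proof -
  obtain a b where a: "a \<in> J" "(\<lambda>g. f g - zshift 1 1 f g) = hecke_action \<mu> a f0"
    and b: "b \<in> J" "(\<lambda>g. h g - zshift 1 1 h g) = hecke_action \<mu> b f0"
    using assms(2,3) unfolding good_def by (elim conjE bexE)
  have "a \<in> hecke_carrier" "b \<in> hecke_carrier" "(\<lambda>g. a g + b g) \<in> J"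
    using J a(1) b(1) unfolding left_ideal_def by blast+
  moreover have "(\<lambda>g. f g + h g - zshift 1 1 (\<lambda>g. f g + h g) g) =
      (\<lambda>g. hecke_action \<mu> a f0 g + hecke_action \<mu> b f0 g)"
    unfolding a(2)[symmetric] b(2)[symmetric] by (simp add: zshift_def algebra_simps)
  ultimately show ?thesis
    using assms(2,3) unfolding good_def
    by (intro conjI bexI[of _ "\<lambda>g. a g + b g"]) (simp_all add: rinv_add hecke_action_add_left rinv_f0)
qed

text \<open>Left ideals fit here: acting by \<open>\<theta>\<close> multiplies the coefficient of
  \<open>f0\<close> from the left, and the shift commutes with the action.\<close>

lemma good_action:
  assumes J: "left_ideal J" and \<theta>: "\<theta> \<in> hecke_carrier" and "good J f"
  shows "good J (hecke_action \<mu> \<theta> f)"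
proof -
  obtain a where f: "rinv f" and a: "a \<in> J" "(\<lambda>g. f g - zshift 1 1 f g) = hecke_action \<mu> a f0"
    using assms(3) unfolding good_def by (elim conjE bexE)
  have car: "a \<in> hecke_carrier" "convolution \<mu> \<theta> a \<in> J"
    using J a(1) \<theta> unfolding left_ideal_def by blast+
  have "hecke_action \<mu> \<theta> (\<lambda>g. f g + - 1 * zshift 1 1 f g) =
      (\<lambda>g. hecke_action \<mu> \<theta> f g + - 1 * zshift 1 1 (hecke_action \<mu> \<theta> f) g)"
    unfolding hecke_action_add_right[OF \<theta> f rinv_scale[OF rinv_zshift[OF f]]]
      hecke_action_scale_right hecke_action_zshift ..
  then have "(\<lambda>g. hecke_action \<mu> \<theta> f g - zshift 1 1 (hecke_action \<mu> \<theta> f) g) =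
      hecke_action \<mu> \<theta> (hecke_action \<mu> a f0)"
    unfolding a(2)[symmetric] by simp
  also have "\<dots> = hecke_action \<mu> (convolution \<mu> \<theta> a) f0"
    by (rule hecke_action_convolution[OF \<theta> car(1) rinv_f0, symmetric])
  finally show ?thesis
    unfolding good_def using car(2) hecke_action_rinv[OF \<theta> f] by (intro conjI bexI)
qed

lemma good_rinv: "good J f \<Longrightarrow> rinv f"
  by (simp add: good_def)

lemma good_scale: "left_ideal J \<Longrightarrow> c \<in> Z_inv CARD('p) \<Longrightarrow> good J f \<Longrightarrow> good J (\<lambda>g. c * f g)"
  using good_action[of J "hecke_const c" f] hecke_const_carrier[of c, where ?'p = 'p]
  by (simp add: hecke_action_const good_rinv)

lemma good_diff: "left_ideal J \<Longrightarrow> good J f \<Longrightarrow> good J h \<Longrightarrow> good J (\<lambda>g. f g - h g)"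
  using good_add[of J f "\<lambda>g. - 1 * h g"] good_scale[of J "- 1" h] Z_inv_of_int[of "- 1" "CARD('p)"] by simp

lemma good_zshift: "left_ideal J \<Longrightarrow> good J f \<Longrightarrow> good J (zshift m n f)"
  using good_action[of J "hecke_z m n" f] by (simp add: hecke_z_carrier hecke_action_z good_rinv)

lemma good_zero: "left_ideal J \<Longrightarrow> good J (\<lambda>_. 0)"
  unfolding good_def left_ideal_def
  by (intro conjI bexI[of _ "\<lambda>_. 0"]) (simp_all add: rinv_def zshift_def hecke_action_def)

lemma good_sum:
  assumes "left_ideal J" "finite I" "\<And>i. i \<in> I \<Longrightarrow> good J (F i)"
  shows "good J (\<lambda>g. \<Sum>i\<in>I. F i g)"
  using assms(2,3) by (induction I rule: finite_induct) (simp_all add: good_zero good_add assms(1))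

lemma good_orb_ind_shift: "left_ideal J \<Longrightarrow> good J (\<lambda>g. c * orb_ind n m i j g) \<Longrightarrow> good J (\<lambda>g. c * orb_ind n' m' i j g)"
  using good_zshift[of J "\<lambda>g. c * orb_ind n m i j g" "n - n'" "m - m'"]
  by (simp add: zshift_scale zshift_orb_ind)

lemma Z_inv_card: "real CARD('p) \<in> Z_inv CARD('p)" "real CARD('p) - 1 \<in> Z_inv CARD('p)"
  using Z_inv_of_int[of "int CARD('p)" "CARD('p)"] Z_inv_of_int[of "int CARD('p) - 1" "CARD('p)"] by simp_all

text \<open>For i > 0, \<open>T1\<close> maps the function of (i, d) to a combination of its two
  neighbours in the row, and the next one has coefficient 1; hence the induction over two
  consecutive members. Only the first step meets the boundary orbit, with p - 1 for
  \<open>0 < d\<close> and p for \<open>d = 0\<close>, and \<open>base0\<close> asks for just this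
  multiple.\<close>

lemma good_ladder_T1:
  assumes J: "left_ideal J" and d: "0 \<le> d"
    and base0: "good J (\<lambda>g. (if 0 < d then real CARD('p) - 1 else real CARD('p)) * orb_ind 0 0 0 d g)"
    and base1: "good J (orb_ind 0 0 1 d)"
  shows "good J (orb_ind 0 0 (1 + int i) d)"
proof -
  have shift: "good J (orb_ind n m i d)" if "good J (orb_ind 0 0 i d)" for n m i
    using good_orb_ind_shift[OF J, of 1 0 0 i d n m] that by simp
  have "good J (orb_ind 0 0 (1 + int i) d) \<and> good J (orb_ind 0 0 (2 + int i) d)"
  proof (induction i)
    case 0
    have "orb_ind 0 0 2 d = (\<lambda>g. hecke_action \<mu> T1 (orb_ind 1 0 1 d) g -
        (if 0 < d then real CARD('p) - 1 else real CARD('p)) * orb_ind 1 0 0 d g)"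
      by (cases "0 < d") (simp_all add: hecke_action_T1_orb_ind d)
    moreover have "good J \<dots>"
      by (rule good_diff[OF J good_action[OF J T1_carrier shift[OF base1]]])
        (rule good_orb_ind_shift[OF J, of "if 0 < d then real CARD('p) - 1 else real CARD('p)" 0 0 0 d 1 0, OF base0])
    ultimately show ?case using base1 by simp
  next
    case (Suc i)
    have "orb_ind 0 0 (2 + int (Suc i)) d = (\<lambda>g. hecke_action \<mu> T1 (orb_ind 1 0 (2 + int i) d) g -
        real CARD('p) * orb_ind 1 0 (1 + int i) d g)"
      by (simp add: hecke_action_T1_orb_ind d algebra_simps)
    moreover have "good J \<dots>"
      by (rule good_diff[OF J good_action[OF J T1_carrier shift] good_scale[OF J Z_inv_card(1) shift]])
        (use Suc in simp_all)
    ultimately show ?case using Suc by (simp add: algebra_simps)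
  qed
  then show ?thesis ..
qed

lemma good_ladder_T2:
  assumes J: "left_ideal J" and d: "0 \<le> d"
    and base0: "good J (\<lambda>g. (if 0 < d then real CARD('p) - 1 else real CARD('p)) * orb_ind 0 0 d 0 g)"
    and base1: "good J (orb_ind 0 0 d 1)"
  shows "good J (orb_ind 0 0 d (1 + int i))"
proof -
  have shift: "good J (orb_ind n m d i)" if "good J (orb_ind 0 0 d i)" for n m i
    using good_orb_ind_shift[OF J, of 1 0 0 d i n m] that by simp
  have "good J (orb_ind 0 0 d (1 + int i)) \<and> good J (orb_ind 0 0 d (2 + int i))"
  proof (induction i)
    case 0
    have "orb_ind 0 0 d 2 = (\<lambda>g. hecke_action \<mu> T2 (orb_ind 0 1 d 1) g -
        (if 0 < d then real CARD('p) - 1 else real CARD('p)) * orb_ind 0 1 d 0 g)"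
      by (cases "0 < d") (simp_all add: hecke_action_T2_orb_ind d)
    moreover have "good J \<dots>"
      by (rule good_diff[OF J good_action[OF J T2_carrier shift[OF base1]]])
        (rule good_orb_ind_shift[OF J, of "if 0 < d then real CARD('p) - 1 else real CARD('p)" 0 0 d 0 0 1, OF base0])
    ultimately show ?case using base1 by simp
  next
    case (Suc i)
    have "orb_ind 0 0 d (2 + int (Suc i)) = (\<lambda>g. hecke_action \<mu> T2 (orb_ind 0 1 d (2 + int i)) g -
        real CARD('p) * orb_ind 0 1 d (1 + int i) g)"
      by (simp add: hecke_action_T2_orb_ind d algebra_simps)
    moreover have "good J \<dots>"
      by (rule good_diff[OF J good_action[OF J T2_carrier shift] good_scale[OF J Z_inv_card(1) shift]])
        (use Suc in simp_all)
    ultimately show ?case using Suc by (simp add: algebra_simps)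
  qed
  then show ?thesis ..
qed

lemma left_ideal_carrier: "left_ideal hecke_carrier"
  unfolding left_ideal_def
  using hecke_add_carrier convolution_carrier hecke_const_carrier[OF Z_inv_0, where ?'p = 'p]
  by (simp add: hecke_const_def)

lemma good_axis:
  "good hecke_carrier (orb_ind 0 0 (int i) 0)" "good hecke_carrier (orb_ind 0 0 0 (int i))"
proof -
  note J = left_ideal_carrier
  have um: "(\<lambda>g. - 1 * \<theta> g) \<in> (hecke_carrier :: ('p Gp \<Rightarrow> real) set)" if "\<theta> \<in> hecke_carrier" for \<theta>
    using hecke_scale_carrier[OF that, of "- 1"] Z_inv_of_int[of "- 1"] by simp
  have sub: "(\<lambda>g. \<theta> g + - 1 * \<eta> g) \<in> (hecke_carrier :: ('p Gp \<Rightarrow> real) set)"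
    "hecke_action \<mu> (\<lambda>g. \<theta> g + - 1 * \<eta> g) f0 = (\<lambda>g. hecke_action \<mu> \<theta> f0 g - hecke_action \<mu> \<eta> f0 g)"
    if "\<theta> \<in> hecke_carrier" "\<eta> \<in> hecke_carrier" for \<theta> \<eta>
    using hecke_add_carrier[OF that(1) um[OF that(2)]] hecke_action_add_left[OF that(1) um[OF that(2)] rinv_f0]
      hecke_action_scale_left[of "- 1" \<eta> f0] by simp_all
  have one: "hecke_const 1 \<in> (hecke_carrier :: ('p Gp \<Rightarrow> real) set)" by (rule hecke_const_carrier) simp
  have goodI: "good hecke_carrier f" if "rinv f" "\<theta> \<in> hecke_carrier" "\<eta> \<in> hecke_carrier"
    "\<And>g. f g - zshift 1 1 f g = hecke_action \<mu> \<theta> f0 g - hecke_action \<mu> \<eta> f0 g" for f \<theta> \<eta>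
    unfolding good_def
    by (intro conjI bexI[OF _ sub(1)[OF that(2,3)]]) (simp_all only: that sub(2)[OF that(2,3)])
  note simps = f0_eq rinv_orb_ind hecke_action_const hecke_action_z zshift_orb_ind
    hecke_action_T1_orb_ind hecke_action_T2_orb_ind hecke_action_convolution hecke_z_carrier
    T1_carrier T2_carrier convolution_carrier zshift_add rinv_add
  have 00: "good hecke_carrier (orb_ind 0 0 0 0)"
    by (rule goodI[OF rinv_orb_ind one hecke_z_carrier[of 1 1]]) (simp add: simps)
  \<comment> \<open>\<open>T1\<close> and \<open>T2\<close> turn \<open>f0\<close> into sums of
    shifted functions of (1, 0) and (0, 1). Subtracting the shift of the first from the second
    cancels the (0, 1) part and leaves the (1, 0) function minus its shift by S_p.\<close>
  have 10: "good hecke_carrier (orb_ind 0 0 1 0)"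
    by (rule goodI[OF rinv_orb_ind T2_carrier convolution_carrier[OF hecke_z_carrier[of 0 1] T1_carrier]])
      (simp add: simps hecke_action_rinv)
  have 01: "good hecke_carrier (orb_ind 0 0 0 1)"
    by (rule goodI[OF rinv_orb_ind T1_carrier convolution_carrier[OF hecke_z_carrier[of 1 0] T2_carrier]])
      (simp add: simps hecke_action_rinv)
  have p00: "good hecke_carrier (\<lambda>g. (if 0 < (0::int) then real CARD('p) - 1 else real CARD('p)) * orb_ind 0 0 0 0 g)"
    using good_scale[OF J Z_inv_card(1) 00] by simp
  show "good hecke_carrier (orb_ind 0 0 (int i) 0)"
    using good_ladder_T1[OF J order_refl p00 10, of "i - 1"] 00 by (cases i) simp_all
  show "good hecke_carrier (orb_ind 0 0 0 (int i))"
    using good_ladder_T2[OF J order_refl p00 01, of "i - 1"] 00 by (cases i) simp_all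
qed

text \<open>The left ideal generated by the two elements of \<open>ideal_gens\<close>, with p - 1
  written as a scalar.\<close>

definition gen_ideal :: "('p Gp \<Rightarrow> real) set" where
  "gen_ideal = {(\<lambda>g. (real CARD('p) - 1) * x g + convolution \<mu> y (hecke_dual (hecke_poly_at_1 \<mu>)) g) | x y.
     x \<in> hecke_carrier \<and> y \<in> hecke_carrier}"

lemma gen_idealI:
  "x \<in> hecke_carrier \<Longrightarrow> y \<in> hecke_carrier \<Longrightarrow>
    (\<lambda>g. (real CARD('p) - 1) * x g + convolution \<mu> y (hecke_dual (hecke_poly_at_1 \<mu>)) g) \<in> gen_ideal"
  unfolding gen_ideal_def by blast

lemma dual_poly_carrier: "hecke_dual (hecke_poly_at_1 \<mu>) \<in> hecke_carrier"
  by (rule hecke_dual_carrier[OF hecke_poly_at_1_eq(2)])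

lemma convolution_zero_left: "convolution \<mu> (\<lambda>_. 0) \<theta> = (\<lambda>_. 0)"
  by (simp add: convolution_def)

lemma left_ideal_gen_ideal: "left_ideal gen_ideal"
  unfolding left_ideal_def
proof (intro conjI ballI subsetI)
  interpret R: ring "hecke \<mu>" by (rule ring_hecke)
  let ?P = "hecke_dual (hecke_poly_at_1 \<mu>)"
  let ?c = "real CARD('p) - 1"
  note P = dual_poly_carrier
  have z: "(\<lambda>_. 0) \<in> (hecke_carrier :: ('p Gp \<Rightarrow> real) set)" using R.zero_closed by simp
  show "(\<lambda>_. 0) \<in> gen_ideal" using gen_idealI[OF z z] by (simp add: convolution_zero_left)
  show "a \<in> hecke_carrier" if "a \<in> gen_ideal" for a
    using that unfolding gen_ideal_def
    by (auto intro!: hecke_add_carrier hecke_scale_carrier convolution_carrier P Z_inv_card)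
  show "(\<lambda>g. a g + b g) \<in> gen_ideal" if ab: "a \<in> gen_ideal" "b \<in> gen_ideal" for a b
  proof -
    obtain x y where a: "a = (\<lambda>g. ?c * x g + convolution \<mu> y ?P g)" "x \<in> hecke_carrier" "y \<in> hecke_carrier"
      using ab(1) unfolding gen_ideal_def by blast
    obtain x' y' where b: "b = (\<lambda>g. ?c * x' g + convolution \<mu> y' ?P g)" "x' \<in> hecke_carrier" "y' \<in> hecke_carrier"
      using ab(2) unfolding gen_ideal_def by blast
    have "convolution \<mu> (\<lambda>g. y g + y' g) ?P = (\<lambda>g. convolution \<mu> y ?P g + convolution \<mu> y' ?P g)"
      using R.l_distr[of y y' ?P] a b P by simp
    then have "(\<lambda>g. a g + b g) = (\<lambda>g. ?c * (x g + x' g) + convolution \<mu> (\<lambda>g. y g + y' g) ?P g)"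
      unfolding a(1) b(1) by (simp add: algebra_simps)
    then show ?thesis using gen_idealI[OF hecke_add_carrier[OF a(2) b(2)] hecke_add_carrier[OF a(3) b(3)]] by simp
  qed
  show "convolution \<mu> \<theta> a \<in> gen_ideal" if \<theta>: "\<theta> \<in> hecke_carrier" and a: "a \<in> gen_ideal" for \<theta> a
  proof -
    obtain x y where a: "a = (\<lambda>g. ?c * x g + convolution \<mu> y ?P g)" "x \<in> hecke_carrier" "y \<in> hecke_carrier"
      using a unfolding gen_ideal_def by blast
    have "convolution \<mu> \<theta> a = (\<lambda>g. convolution \<mu> \<theta> (\<lambda>g. ?c * x g) g + convolution \<mu> \<theta> (convolution \<mu> y ?P) g)"
      using R.r_distr[of "\<lambda>g. ?c * x g" "convolution \<mu> y ?P" \<theta>] a P \<theta>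
      by (simp add: hecke_scale_carrier Z_inv_card convolution_carrier)
    also have "convolution \<mu> \<theta> (\<lambda>g. ?c * x g) = (\<lambda>g. ?c * convolution \<mu> \<theta> x g)"
      by (rule convolution_scale_right)
    also have "convolution \<mu> \<theta> (convolution \<mu> y ?P) = convolution \<mu> (convolution \<mu> \<theta> y) ?P"
      using R.m_assoc[of \<theta> y ?P] a P \<theta> by simp
    finally show ?thesis using gen_idealI[OF convolution_carrier[OF \<theta> a(2)] convolution_carrier[OF \<theta> a(3)]] by simp
  qed
qed

lemma good_gen_ideal_p_minus_1:
  assumes "good hecke_carrier f"
  shows "good gen_ideal (\<lambda>g. (real CARD('p) - 1) * f g)"
proof -
  obtain a where f: "rinv f" and a: "a \<in> hecke_carrier" "(\<lambda>g. f g - zshift 1 1 f g) = hecke_action \<mu> a f0"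
    using assms unfolding good_def by (elim conjE bexE)
  have z: "(\<lambda>_. 0) \<in> (hecke_carrier :: ('p Gp \<Rightarrow> real) set)"
    using left_ideal_carrier by (simp add: left_ideal_def)
  let ?b = "\<lambda>g. (real CARD('p) - 1) * a g"
  have "?b \<in> gen_ideal" using gen_idealI[OF a(1) z] by (simp add: convolution_zero_left)
  moreover have "hecke_action \<mu> ?b f0 = (\<lambda>g. (real CARD('p) - 1) * (f g - zshift 1 1 f g))"
    unfolding hecke_action_scale_left a(2)[symmetric] ..
  moreover have "(\<lambda>g. (real CARD('p) - 1) * f g - zshift 1 1 (\<lambda>g. (real CARD('p) - 1) * f g) g) =
      (\<lambda>g. (real CARD('p) - 1) * (f g - zshift 1 1 f g))"
    by (simp only: zshift_scale right_diff_distrib)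
  ultimately show ?thesis
    unfolding good_def using rinv_scale[OF f]
    by (intro conjI bexI[of _ ?b]) (simp_all only:)
qed

lemma good_11: "good gen_ideal (orb_ind 0 0 1 1)"
proof -
  let ?P = "hecke_dual (hecke_poly_at_1 \<mu>)"
  let ?c = "real CARD('p) - 1"
  \<comment> \<open>Both coefficients are read off from \<open>dual_poly_action_f0\<close>:
    \<open>?x\<close> is 1 - S_p, to be multiplied by p - 1, and \<open>?y\<close> is p S_p, to be
    multiplied by the dual polynomial.\<close>
  let ?x = "\<lambda>g. hecke_const 1 g + - 1 * hecke_z 1 1 g :: real"
  let ?y = "\<lambda>g. real CARD('p) * hecke_z 1 1 g :: real"
  have one: "hecke_const 1 \<in> (hecke_carrier :: ('p Gp \<Rightarrow> real) set)" by (rule hecke_const_carrier) simp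
  have um: "(\<lambda>g. - 1 * hecke_z 1 1 g) \<in> (hecke_carrier :: ('p Gp \<Rightarrow> real) set)"
    using hecke_scale_carrier[OF hecke_z_carrier, of "- 1"] Z_inv_of_int[of "- 1"] by simp
  have x: "?x \<in> (hecke_carrier :: ('p Gp \<Rightarrow> real) set)" by (rule hecke_add_carrier[OF one um])
  have y: "?y \<in> (hecke_carrier :: ('p Gp \<Rightarrow> real) set)"
    by (rule hecke_scale_carrier[OF hecke_z_carrier Z_inv_card(1)])
  let ?a = "\<lambda>g. ?c * ?x g + convolution \<mu> ?y ?P g"
  have "hecke_action \<mu> ?a f0 = (\<lambda>g. hecke_action \<mu> (\<lambda>g. ?c * ?x g) f0 g + hecke_action \<mu> (convolution \<mu> ?y ?P) f0 g)"
    by (rule hecke_action_add_left[OF hecke_scale_carrier[OF x Z_inv_card(2)] convolution_carrier[OF y dual_poly_carrier] rinv_f0])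
  also have "hecke_action \<mu> (\<lambda>g. ?c * ?x g) f0 = (\<lambda>g. ?c * (f0 g - zshift 1 1 f0 g))"
    unfolding hecke_action_scale_left hecke_action_add_left[OF one um rinv_f0]
      hecke_action_const[OF rinv_f0] hecke_action_z[OF rinv_f0] by simp
  also have "hecke_action \<mu> (convolution \<mu> ?y ?P) f0 = (\<lambda>g. real CARD('p) * zshift 1 1 (hecke_action \<mu> ?P f0) g)"
    unfolding hecke_action_convolution[OF y dual_poly_carrier rinv_f0] hecke_action_scale_left
      hecke_action_z[OF hecke_action_rinv[OF dual_poly_carrier rinv_f0]] ..
  finally have "hecke_action \<mu> ?a f0 = (\<lambda>g. orb_ind 0 0 1 1 g - zshift 1 1 (orb_ind 0 0 1 1) g)"
    unfolding f0_eq dual_poly_action_f0 zshift_orb_ind by simp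
  then show ?thesis
    unfolding good_def using rinv_orb_ind gen_idealI[OF x y] by (intro conjI bexI[of _ ?a]) simp_all
qed

text \<open>The column through (1, 1) is climbed with \<open>T2\<close>, then each row with
  \<open>T1\<close>. Every climb also uses the function of a boundary orbit, multiplied by p - 1,
  which \<open>good_axis\<close> brings into the ideal.\<close>

lemma good_interior: "good gen_ideal (orb_ind 0 0 (1 + int i) (1 + int j))"
proof -
  note J = left_ideal_gen_ideal
  have pi: "good gen_ideal (\<lambda>g. (if 0 < (1::int) then real CARD('p) - 1 else real CARD('p)) * orb_ind 0 0 1 0 g)"
    using good_gen_ideal_p_minus_1[OF good_axis(1)[of 1]] by simp
  have "good gen_ideal (orb_ind 0 0 1 (1 + int j))"
    by (rule good_ladder_T2[OF J _ pi good_11]) simp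
  moreover have "good gen_ideal (\<lambda>g. (if 0 < 1 + int j then real CARD('p) - 1 else real CARD('p)) * orb_ind 0 0 0 (1 + int j) g)"
    using good_gen_ideal_p_minus_1[OF good_axis(2)[of "Suc j"]] by simp
  ultimately show ?thesis
    by (intro good_ladder_T1[OF J]) simp_all
qed

end

section \<open>Torsion-freeness\<close>

text \<open>
  The system of equations satisfied by the part of a Hecke operator of maximal distance: differences
  of consecutive equations are killed by the shift \<open>(s, t) \<mapsto> (s + 1, t + 1)\<close> minus one.
\<close>

lemma diagonal_system_trivial:
  fixes c :: "int \<Rightarrow> int \<Rightarrow> int \<Rightarrow> real"
  assumes eq: "\<And>i s t. 0 \<le> i \<Longrightarrow> i \<le> M \<Longrightarrow>
      (\<Sum>k\<in>{0..M}. if k \<le> i then c k s (t + i - k) else c k (s + k - i) t) = 0"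
    and bound: "\<And>k s t. 0 \<le> k \<Longrightarrow> k \<le> M \<Longrightarrow> N < s \<Longrightarrow> c k s t = 0"
    and k: "0 \<le> k" "k \<le> M"
  shows "c k s t = 0"
proof -
  \<comment> \<open>\<open>W i\<close> is the tail of the \<open>i\<close>-th equation, from index
    \<open>i\<close> on. The head depends on \<open>s\<close> and \<open>t + i\<close> only, so it
    agrees with the head of equation \<open>i - 1\<close> at \<open>(s, t + 1)\<close>, and
    subtraction compares the tails.\<close>
  define W where "W i s t = (\<Sum>k\<in>{i..M}. c k (s + k - i) t)" for i s t
  have split: "{0..M} = {0..i - 1} \<union> {i..M}" "{0..i - 1} \<inter> {i..M} = {}" if "0 \<le> i" "i \<le> M" for i
    using that by auto
  have W_shift: "W i s t = W i (s + 1) (t + 1)" if i: "1 \<le> i" "i \<le> M" for i s t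
  proof -
    have "(\<Sum>k\<in>{0..M}. if k \<le> i then c k s (t + i - k) else c k (s + k - i) t) =
        (\<Sum>k\<in>{0..i - 1}. c k s (t + i - k)) + W i s t"
      unfolding split(1)[of i, OF order_trans[OF zero_le_one i(1)] i(2)] W_def
      by (subst sum.union_disjoint) (auto intro!: sum.cong arg_cong2[where f = "(+)"])
    moreover have "(\<Sum>k\<in>{0..M}. if k \<le> i - 1 then c k s (t + 1 + (i - 1) - k) else c k (s + k - (i - 1)) (t + 1)) =
        (\<Sum>k\<in>{0..i - 1}. c k s (t + i - k)) + W i (s + 1) (t + 1)"
      unfolding split(1)[of i, OF order_trans[OF zero_le_one i(1)] i(2)] W_def
      by (subst sum.union_disjoint) (auto intro!: sum.cong arg_cong2[where f = "(+)"] simp: algebra_simps)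
    ultimately show ?thesis using eq[of i s t] eq[of "i - 1" s "t + 1"] i by simp
  qed
  have W_zero: "W i s t = 0" if i: "1 \<le> i" for i s t
  proof (cases "i \<le> M")
    case True
    have "W i s t = W i (s + int n) (t + int n)" for n
    proof (induction n)
      case (Suc n)
      then show ?case using W_shift[OF i True, of "s + int n" "t + int n"] by (simp add: algebra_simps)
    qed simp
    \<comment> \<open>Shifting until the first argument exceeds \<open>N\<close> reaches the region
      where all terms vanish.\<close>
    then have "W i s t = W i (s + int (nat (N + 1 - s))) (t + int (nat (N + 1 - s)))" .
    also have "\<dots> = 0"
      unfolding W_def by (intro sum.neutral ballI bound) (use i in auto)
    finally show ?thesis .
  qed (simp add: W_def)
  \<comment> \<open>Consecutive tails, the second one taken at \<open>s + 1\<close>, differ by the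
    single term of index \<open>i\<close>.\<close>
  have pos: "c i s t = 0" if i: "1 \<le> i" "i \<le> M" for i s t
  proof -
    have "{i..M} = insert i {i + 1..M}" using i by auto
    then have "W i s t = c i s t + W (i + 1) (s + 1) t" unfolding W_def by (simp add: algebra_simps)
    then show ?thesis using W_zero i by simp
  qed
  show ?thesis
  proof (cases "k = 0")
    case True
    \<comment> \<open>Index 0 is isolated by equation 0, once the other unknowns vanish.\<close>
    have "{0..M} = insert 0 {1..M}" using k by auto
    then have "c 0 s t + (\<Sum>k\<in>{1..M}. if k \<le> 0 then c k s (t + 0 - k) else c k (s + k - 0) t) = 0"
      using eq[of 0 s t] k by simp
    moreover have "(\<Sum>k\<in>{1..M}. if k \<le> 0 then c k s (t + 0 - k) else c k (s + k - 0) t) = 0"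
      by (intro sum.neutral ballI) (simp add: pos)
    ultimately show ?thesis using True by simp
  qed (use pos k in simp)
qed

text \<open>The diagonal pair attached to the ball b + p^m Z_p. Every element of the mirabolic group
  is of this form up to \<open>Gp0\<close>, so the cosets in the support of \<open>f0\<close> are
  the vertices of the tree.\<close>

definition ppair :: "int \<Rightarrow> 'p::prime_card padic \<Rightarrow> 'p Gp" where
  "ppair m b = (gl2_of (pp powi m) b 0 1, gl2_of (pp powi m) b 0 1)"

lemma orep_inverse_ppair:
  "inverse (orep n m i j) * ppair l b =
    (gl2_of (pp powi (l - n - i)) (pp powi (- n - i) * (b - 1)) 0 (pp powi (- n)),
     gl2_of (pp powi (l - m - j)) (pp powi (- m - j) * b) 0 (pp powi (- m)) :: 'p::prime_card Hp)"
proof -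
  have "inverse (gl2_of (pp powi (n + i)) (pp powi n) 0 (pp powi n) :: 'p Hp) =
    gl2_of (pp powi (- n - i)) (- (pp powi (- n - i))) 0 (pp powi (- n))"
    by (rule gl2_inverse_unique, rule gl2_eqI)
      (simp_all add: power_int_minus power_int_diff power_int_add)
  moreover have "inverse (gl2_of (pp powi (m + j)) 0 0 (pp powi m) :: 'p Hp) =
    gl2_of (pp powi (- m - j)) 0 0 (pp powi (- m))"
    by (rule gl2_inverse_unique, rule gl2_eqI)
      (simp_all add: power_int_minus power_int_diff power_int_add)
  moreover have "pp powi (- n - i) * pp powi l = (pp powi (l - n - i) :: 'p padic)" for n i
    unfolding power_int_add[OF disjI1[OF pp_nonzero], symmetric] by (simp add: algebra_simps)
  ultimately show ?thesis
    unfolding orep_def ppair_def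
    by (intro prod_eqI) (simp_all add: gl2_of_mult algebra_simps)
qed

lemma ppair_mirabolic: "ppair m b \<in> mirabolic"
  unfolding ppair_def by (rule mirabolicI) simp

lemma f0_ppair: "f0 (ppair m b) = 1"
proof -
  have "ppair m b \<in> {u * k | u k. u \<in> mirabolic \<and> k \<in> Gp0}"
    by (intro CollectI exI[of _ "ppair m b"] exI[of _ 1]) (simp add: ppair_mirabolic)
  then show ?thesis unfolding f0_def by simp
qed

lemma f0_support:
  fixes g :: "'p::prime_card Gp"
  assumes "f0 g \<noteq> 0"
  shows "\<exists>m b. g \<in> coset (ppair m b)"
proof -
  have "g \<in> {u * k | u k. u \<in> mirabolic \<and> k \<in> Gp0}"
  proof (rule ccontr)
    assume "g \<notin> {u * k | u k. u \<in> mirabolic \<and> k \<in> Gp0}"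
    then have "f0 g = 0" unfolding f0_def by (rule indicator_simps(2))
    with assms show False by simp
  qed
  then obtain u k where u: "u \<in> mirabolic" "k \<in> Gp0" "g = u * k" by blast
  obtain a b where a: "a \<noteq> 0" "fst u = gl2_of a b 0 1" "snd u = gl2_of a b 0 1"
    using u(1) by (rule mirabolicE)
  obtain l where l: "l \<in> Hp0" "gl2_of a b 0 1 = gl2_of (pp powi (val a)) b 0 1 * l"
    using gl2_unit_absorb[OF a(1), of 1 b] by auto
  have "u = ppair (val a) b * (l, l)" by (rule prod_eqI) (use a l in \<open>simp_all add: ppair_def\<close>)
  then have "g = ppair (val a) b * ((l, l) * k)" unfolding u(3) by (simp only: mult.assoc)
  moreover have "(l, l) * k \<in> Gp0" using l u(2) by (intro Gp0_mult) (simp_all add: Gp0_iff)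
  ultimately show ?thesis unfolding coset_def by blast
qed

lemma ppair_coset:
  fixes b c :: "'p::prime_card padic"
  shows "ppair m b \<in> coset (ppair l c) \<longleftrightarrow> m = l \<and> pdvd m (b - c)"
proof -
  have e: "inverse (gl2_of (pp powi l) c 0 1 :: 'p Hp) * gl2_of (pp powi m) b 0 1 =
    gl2_of (pp powi (m - l)) ((b - c) / pp powi l) 0 1"
  proof -
    have "inverse (gl2_of (pp powi l) c 0 1 :: 'p Hp) = gl2_of (1 / pp powi l) (- c / pp powi l) 0 1"
      by (rule gl2_inverse_unique, rule gl2_eqI) simp_all
    then show ?thesis by (simp add: gl2_of_mult power_int_diff diff_divide_distrib)
  qed
  have "ppair m b \<in> coset (ppair l c) \<longleftrightarrow> gl2_of (pp powi (m - l)) ((b - c) / pp powi l) 0 1 \<in> (Hp0 :: 'p Hp set)"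
    unfolding coset_iff Gp0_iff by (simp add: ppair_def e)
  also have "\<dots> \<longleftrightarrow> m = l \<and> pdvd m (b - c)"
    by (auto simp: Hp0_iff le_cont_iff dval_upper pdvd_divide)
  finally show ?thesis .
qed

lemma dvals_orep_inverse_ppair:
  fixes b :: "'p::prime_card padic" and n m i j l :: int
  defines "h \<equiv> inverse (orep n m i j) * ppair l b"
  shows "dval (fst h) = l - 2 * n - i" "dval (snd h) = l - 2 * m - j"
  unfolding h_def orep_inverse_ppair by (simp_all add: dval_upper)

text \<open>The hypothesis bounds the sum of the distances to the two given vertices by the length
  \<open>i + j\<close> of the geodesic joining them, so the vertex lies on it; the conclusion
  describes the two arms.\<close>

lemma ppair_geodesic:
  fixes b :: "'p::prime_card padic" and n m i j l :: int
  defines "h \<equiv> inverse (orep n m i j) * ppair l b"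
  assumes ij: "0 \<le> i" "0 \<le> j"
    and le: "dval (fst h) - 2 * cont (fst h) + (dval (snd h) - 2 * cont (snd h)) \<le> i + j"
  shows "0 \<le> l \<and> (l \<le> i \<and> pdvd l (b - 1) \<or> l \<le> j \<and> pdvd l b)"
proof -
  \<comment> \<open>The exponents of the smallest balls that contain the given one together with 1 +
    p^i Z_p and p^j Z_p respectively. The distances are \<open>l + i - 2 * e\<close> and
    \<open>l + j - 2 * f\<close>, and \<open>e\<close>, \<open>f\<close> cannot both be positive
    because 0 and 1 differ modulo p.\<close>
  define e f where "e = cont (fst h) - (- n - i)" and "f = cont (snd h) - (- m - j)"
  have e: "e \<le> l" "e \<le> i" "pdvd e (b - 1)"
    using le_cont_iff[of "cont (fst h)" "fst h"]
    unfolding e_def h_def orep_inverse_ppair by (simp_all add: pdvd_iff[of _ "_ powi _"])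
  have f: "f \<le> l" "f \<le> j" "pdvd f b"
    using le_cont_iff[of "cont (snd h)" "snd h"]
    unfolding f_def h_def orep_inverse_ppair by (simp_all add: pdvd_iff[of _ "_ powi _"])
  have l: "l \<le> e + f"
    using le dvals_orep_inverse_ppair[of n m i j l b] unfolding e_def f_def h_def by linarith
  have "e \<le> 0 \<or> f \<le> 0"
  proof (rule ccontr)
    assume "\<not> ?thesis"
    then have "pdvd 1 b" "pdvd 1 (b - 1)"
      using pdvd_mono[OF e(3), of 1] pdvd_mono[OF f(3), of 1] by simp_all
    from pdvd_diff[OF this] have "pdvd 1 (1 :: 'p padic)" by simp
    then show False by (simp add: pdvd_iff)
  qed
  then show ?thesis
  proof
    assume "e \<le> 0"
    then have "e = 0" "f = l" using l f(1) e(1) by linarith+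
    then show ?thesis using e f by simp
  next
    assume "f \<le> 0"
    then have "f = 0" "e = l" using l f(1) e(1) by linarith+
    then show ?thesis using e f by simp
  qed
qed

text \<open>The vertex at distance \<open>k\<close> from the ball 1 + p^i Z_p: up to Z_p at
  \<open>k = i\<close>, then down towards p^j Z_p.\<close>

definition geodesic :: "int \<Rightarrow> int \<Rightarrow> 'p::prime_card Gp" where
  "geodesic i k = (if k \<le> i then ppair (i - k) 1 else ppair (k - i) 0)"

lemma geodesic_inj: "inj_on coset (geodesic i ` A :: 'p::prime_card Gp set)"
  and geodesic_inj': "inj_on (geodesic i :: int \<Rightarrow> 'p::prime_card Gp) A"
proof -
  have one: "\<not> pdvd m (1 :: 'p padic)" "\<not> pdvd m (0 - 1 :: 'p padic)" if "0 < m" for m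
    using that by (simp_all add: pdvd_iff)
  have *: "k = l" if "(geodesic i k :: 'p Gp) \<in> coset (geodesic i l)" for k l
    using that one unfolding geodesic_def by (auto simp: ppair_coset split: if_splits)
  show "inj_on (geodesic i :: int \<Rightarrow> 'p Gp) A"
  proof (rule inj_onI)
    fix k l assume "geodesic i k = (geodesic i l :: 'p Gp)"
    then have "(geodesic i k :: 'p Gp) \<in> coset (geodesic i l)" by simp
    then show "k = l" by (rule *)
  qed
  show "inj_on coset (geodesic i ` A :: 'p Gp set)"
  proof (rule inj_onI, elim imageE)
    fix x y :: "'p Gp" and k l assume "coset x = coset y" "x = geodesic i k" "y = geodesic i l"
    then have "(geodesic i k :: 'p Gp) \<in> coset (geodesic i l)" using coset_self[of x] by simp
    then have "k = l" by (rule *)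
    then show "x = y" using \<open>x = geodesic i k\<close> \<open>y = geodesic i l\<close> by simp
  qed
qed

text \<open>Double coset representatives at distances \<open>k\<close> and \<open>l\<close> in the
  two factors, with \<open>s\<close> and \<open>t\<close> the larger exponents.\<close>

definition diag_pair :: "int \<Rightarrow> int \<Rightarrow> int \<Rightarrow> int \<Rightarrow> 'p::prime_card Gp" where
  "diag_pair k l s t = (gl2_of (pp powi s) 0 0 (pp powi (s - k)), gl2_of (pp powi t) 0 0 (pp powi (t - l)))"

text \<open>Vertex number \<open>k\<close> has distances \<open>k\<close> and
  \<open>i + j - k\<close> from the two ends, so only the scaling depends on the arm of the
  geodesic.\<close>

lemma hecke_orep_geodesic:
  fixes \<theta> :: "'p::prime_card Gp \<Rightarrow> real"
  assumes \<theta>: "\<theta> \<in> hecke_carrier" and ij: "0 \<le> i" "0 \<le> j" and k: "0 \<le> k" "k \<le> i + j"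
  shows "\<theta> (inverse (orep n m i j) * geodesic i k) =
    (if k \<le> i then \<theta> (diag_pair k (i + j - k) (- n) (- m + i - k))
     else \<theta> (diag_pair k (i + j - k) (- n + k - i) (- m)))"
proof (cases "k \<le> i")
  case True
  have "\<theta> (inverse (orep n m i j) * ppair (i - k) 1) = \<theta> (diag_pair k (i + j - k) (- n) (- m + i - k))"
    unfolding orep_inverse_ppair
  proof (rule hecke_cartan[OF \<theta>])
    show "cont (fst (gl2_of (pp powi (i - k - n - i)) (pp powi (- n - i) * (1 - 1)) 0 (pp powi (- n)) :: 'p Hp,
        gl2_of (pp powi (i - k - m - j)) (pp powi (- m - j) * 1) 0 (pp powi (- m)) :: 'p Hp)) =
        cont (fst (diag_pair k (i + j - k) (- n) (- m + i - k) :: 'p Gp))"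
      using k by (simp add: diag_pair_def cont_diag)
    have "cont (gl2_of (pp powi (i - k - m - j)) (pp powi (- m - j)) 0 (pp powi (- m)) :: 'p Hp) = - m - j"
      by (rule cont_upper) (use True ij in \<open>auto simp: pdvd_iff\<close>)
    then show "cont (snd (gl2_of (pp powi (i - k - n - i)) (pp powi (- n - i) * (1 - 1)) 0 (pp powi (- n)) :: 'p Hp,
        gl2_of (pp powi (i - k - m - j)) (pp powi (- m - j) * 1) 0 (pp powi (- m)) :: 'p Hp)) =
        cont (snd (diag_pair k (i + j - k) (- n) (- m + i - k) :: 'p Gp))"
      using k by (simp add: diag_pair_def cont_diag)
  qed (simp_all add: diag_pair_def dval_upper)
  then show ?thesis using True by (simp add: geodesic_def)
next
  case False
  have "\<theta> (inverse (orep n m i j) * ppair (k - i) 0) = \<theta> (diag_pair k (i + j - k) (- n + k - i) (- m))"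
    unfolding orep_inverse_ppair
  proof (rule hecke_cartan[OF \<theta>])
    show "cont (snd (gl2_of (pp powi (k - i - n - i)) (pp powi (- n - i) * (0 - 1)) 0 (pp powi (- n)) :: 'p Hp,
        gl2_of (pp powi (k - i - m - j)) (pp powi (- m - j) * 0) 0 (pp powi (- m)) :: 'p Hp)) =
        cont (snd (diag_pair k (i + j - k) (- n + k - i) (- m) :: 'p Gp))"
      using k by (simp add: diag_pair_def cont_diag)
    have "cont (gl2_of (pp powi (k - i - n - i)) (- (pp powi (- n - i))) 0 (pp powi (- n)) :: 'p Hp) = - n - i"
      by (rule cont_upper) (use False ij in \<open>auto simp: pdvd_iff\<close>)
    then show "cont (fst (gl2_of (pp powi (k - i - n - i)) (pp powi (- n - i) * (0 - 1)) 0 (pp powi (- n)) :: 'p Hp,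
        gl2_of (pp powi (k - i - m - j)) (pp powi (- m - j) * 0) 0 (pp powi (- m)) :: 'p Hp)) =
        cont (fst (diag_pair k (i + j - k) (- n + k - i) (- m) :: 'p Gp))"
      using k by (simp add: diag_pair_def cont_diag)
  qed (simp_all add: diag_pair_def dval_upper)
  then show ?thesis using False by (simp add: geodesic_def)
qed

lemma hecke_diag_pair:
  fixes \<theta> :: "'p::prime_card Gp \<Rightarrow> real"
  assumes \<theta>: "\<theta> \<in> hecke_carrier"
  shows "\<theta> g = \<theta> (diag_pair (dval (fst g) - 2 * cont (fst g)) (dval (snd g) - 2 * cont (snd g))
    (dval (fst g) - cont (fst g)) (dval (snd g) - cont (snd g)))"
  by (rule hecke_cartan[OF \<theta>])
    (use cont_le_dval[of "fst g"] cont_le_dval[of "snd g"] in \<open>simp_all add: diag_pair_def cont_diag dval_diag\<close>)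

text \<open>The sum of the distances of the two components from the base vertex.\<close>

definition radius :: "'p::prime_card Gp \<Rightarrow> int" where
  "radius g = dval (fst g) - 2 * cont (fst g) + (dval (snd g) - 2 * cont (snd g))"

lemma hecke_support_bounded:
  fixes \<theta> :: "'p::prime_card Gp \<Rightarrow> real"
  assumes "\<theta> \<in> hecke_carrier"
  shows "finite ((\<lambda>g. (radius g, dval (fst g))) ` {g. \<theta> g \<noteq> 0})"
proof -
  obtain S where S: "finite S" "{g. \<theta> g \<noteq> 0} \<subseteq> (\<Union>s\<in>S. coset s)"
    using hecke_carrierD(4)[OF assms] unfolding coset_finite_def by (elim exE conjE)
  have "(radius g, dval (fst g)) = (radius s, dval (fst s))" if g: "g \<in> coset s" for g s :: "'p Gp"
  proof -
    obtain k where "k \<in> Gp0" "g = s * k" using g unfolding coset_def by (elim imageE)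
    then show ?thesis by (simp add: radius_def Gp0_iff)
  qed
  then have "(\<lambda>g. (radius g, dval (fst g))) ` {g. \<theta> g \<noteq> 0} \<subseteq> (\<lambda>g. (radius g, dval (fst g))) ` S"
    using S(2) by blast
  then show ?thesis using S(1) by (rule finite_subset[OF _ finite_imageI])
qed

context haar
begin

text \<open>
  The integral runs over the cosets that meet \<open>P\<^sub>p\<close>, and these are the vertices of the tree. If \<open>\<theta>\<close> lives
  within distance \<open>i + j\<close>, only the vertices on the geodesic joining the two vertices given by
  \<open>orep n m i j\<close> contribute.
\<close>

lemma hecke_action_f0_orep:
  assumes \<theta>: "\<theta> \<in> hecke_carrier" and ij: "0 \<le> i" "0 \<le> j"
    and M: "\<And>g. \<theta> g \<noteq> 0 \<Longrightarrow> radius g \<le> i + j"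
  shows "hecke_action \<mu> \<theta> f0 (orep n m i j) = (\<Sum>k\<in>{0..i + j}. \<theta> (inverse (orep n m i j) * geodesic i k))"
proof -
  let ?x = "orep n m i j :: 'p Gp"
  \<comment> \<open>The substitution moves the translation to \<open>\<theta>\<close>, so that the
    integral runs over the cosets in the support of \<open>f0\<close>.\<close>
  define \<psi> where "\<psi> = (\<lambda>g. \<theta> (inverse ?x * g) * f0 g)"
  let ?U = "geodesic i ` {0..i + j} :: 'p Gp set"
  have \<psi>: "rinv \<psi>"
    unfolding \<psi>_def by (intro rinv_mult rinv_translate rinv_f0 hecke_carrierD(3)[OF \<theta>])
  have supp: "{g. \<psi> g \<noteq> 0} \<subseteq> (\<Union>u\<in>?U. coset u)"
  proof
    fix g assume "g \<in> {g. \<psi> g \<noteq> 0}"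
    then have g: "\<theta> (inverse ?x * g) \<noteq> 0" "f0 g \<noteq> 0" by (simp_all add: \<psi>_def)
    obtain l b where lb: "g \<in> coset (ppair l b)" using f0_support[OF g(2)] by (elim exE)
    have "\<theta> (inverse ?x * ppair l b) \<noteq> 0"
      using g(1) rinv_coset[OF rinv_translate[OF hecke_carrierD(3)[OF \<theta>]] lb, of "inverse ?x"] by simp
    then have "radius (inverse ?x * ppair l b) \<le> i + j" by (rule M)
    then have *: "0 \<le> l \<and> (l \<le> i \<and> pdvd l (b - 1) \<or> l \<le> j \<and> pdvd l b)"
      unfolding radius_def by (rule ppair_geodesic[OF ij])
    have "\<exists>k\<in>{0..i + j}. ppair l b \<in> coset (geodesic i k)"
    proof (cases "l \<le> i \<and> pdvd l (b - 1)")
      case True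
      then have "ppair l b \<in> coset (geodesic i (i - l))" using * by (simp add: geodesic_def ppair_coset)
      then show ?thesis using True * ij by (intro bexI[of _ "i - l"]) simp_all
    next
      case False
      with * have l: "0 \<le> l" "l \<le> j" "pdvd l b" by blast+
      \<comment> \<open>For \<open>l = 0\<close> the ball is Z_p, which already belongs to the first
        arm.\<close>
      have "l \<noteq> 0"
      proof
        assume "l = 0"
        then have "pdvd l (b - 1)" using l(3) pdvd_diff[of 0 b 1] by simp
        with False \<open>l = 0\<close> ij show False by simp
      qed
      then have "ppair l b \<in> coset (geodesic i (i + l))" using l by (simp add: geodesic_def ppair_coset)
      then show ?thesis using l ij by (intro bexI[of _ "i + l"]) simp_all
    qed
    then obtain k where "k \<in> {0..i + j}" "ppair l b \<in> coset (geodesic i k)" by (elim bexE)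
    then show "g \<in> (\<Union>u\<in>?U. coset u)" using lb coset_eq by (intro UN_I[OF imageI]) blast+
  qed
  have "hecke_action \<mu> \<theta> f0 ?x = (LINT g|\<mu>. \<psi> (?x * g))"
    by (simp add: hecke_action_def \<psi>_def)
  also have "\<dots> = (LINT g|\<mu>. \<psi> g)"
  proof (rule integral_translate[OF \<psi>])
    show "coset_finite {g. \<psi> g \<noteq> 0}"
      unfolding coset_finite_def by (intro exI[of _ ?U] conjI supp) simp
  qed
  also have "\<dots> = (\<Sum>u\<in>?U. \<psi> u)"
    by (rule integral_cosets[OF \<psi> _ geodesic_inj supp]) simp
  also have "\<dots> = (\<Sum>k\<in>{0..i + j}. \<psi> (geodesic i k))"
    by (simp add: sum.reindex[OF geodesic_inj'])
  also have "\<dots> = (\<Sum>k\<in>{0..i + j}. \<theta> (inverse ?x * geodesic i k))"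
    by (intro sum.cong refl) (simp add: \<psi>_def geodesic_def f0_ppair)
  finally show ?thesis .
qed

text \<open>With \<open>M\<close> the largest radius in the support, the values on the orbits with
  \<open>i + j = M\<close> involve only the part of radius \<open>M\<close>, and their vanishing is
  the system of \<open>diagonal_system_trivial\<close>.\<close>

lemma hecke_action_f0_inj:
  assumes \<theta>: "\<theta> \<in> hecke_carrier" and zero: "hecke_action \<mu> \<theta> f0 = (\<lambda>_. 0)"
  shows "\<theta> = (\<lambda>_. 0)"
proof (rule ccontr)
  assume "\<theta> \<noteq> (\<lambda>_. 0)"
  then have "\<not> (\<forall>g. \<theta> g = 0)" unfolding fun_eq_iff .
  then obtain g0 where g0: "\<theta> g0 \<noteq> 0" by blast
  let ?F = "(\<lambda>g. (radius g, dval (fst g))) ` {g. \<theta> g \<noteq> 0}"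
  have fin: "finite ?F" by (rule hecke_support_bounded[OF \<theta>])
  define M where "M = Max (fst ` ?F)"
  define N where "N = Max (snd ` ?F)"
  have M: "radius g \<le> M" and N: "dval (fst g) \<le> N" if "\<theta> g \<noteq> 0" for g
  proof -
    have mem: "(radius g, dval (fst g)) \<in> ?F" using that by (intro imageI) simp
    show "radius g \<le> M" "dval (fst g) \<le> N"
      using Max_ge[OF finite_imageI[OF fin, of fst] imageI[OF mem]]
        Max_ge[OF finite_imageI[OF fin, of snd] imageI[OF mem]]
      unfolding M_def N_def by (simp_all only: fst_conv snd_conv)
  qed
  have "M \<in> fst ` ?F" unfolding M_def using fin g0 by (intro Max_in) auto
  then obtain g where g: "\<theta> g \<noteq> 0" "radius g = M" by auto
  define k l where "k = dval (fst g) - 2 * cont (fst g)" and "l = dval (snd g) - 2 * cont (snd g)"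
  have kl: "0 \<le> k" "0 \<le> l" "k + l = M"
    using cont_le_dval[of "fst g"] cont_le_dval[of "snd g"] g(2) unfolding k_def l_def radius_def by simp_all
  have "\<theta> (diag_pair k (M - k) s t) = 0" for s t
  proof (rule diagonal_system_trivial[of M "\<lambda>k s t. \<theta> (diag_pair k (M - k) s t)"])
    fix i s t :: int assume i: "0 \<le> i" "i \<le> M"
    have "(\<Sum>k\<in>{0..i + (M - i)}. \<theta> (inverse (orep (- s) (- t) i (M - i)) * geodesic i k)) =
        hecke_action \<mu> \<theta> f0 (orep (- s) (- t) i (M - i))"
      by (rule hecke_action_f0_orep[OF \<theta>, symmetric]) (use i M in simp_all)
    then have "(\<Sum>k\<in>{0..M}. \<theta> (inverse (orep (- s) (- t) i (M - i)) * geodesic i k)) = 0"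
      by (simp add: zero)
    moreover have "(\<Sum>k\<in>{0..M}. \<theta> (inverse (orep (- s) (- t) i (M - i)) * geodesic i k)) =
        (\<Sum>k\<in>{0..M}. if k \<le> i then \<theta> (diag_pair k (M - k) s (t + i - k)) else \<theta> (diag_pair k (M - k) (s + k - i) t))"
      by (rule sum.cong[OF refl]) (use i in \<open>simp add: hecke_orep_geodesic[OF \<theta>]\<close>)
    ultimately show "(\<Sum>k\<in>{0..M}. if k \<le> i then \<theta> (diag_pair k (M - k) s (t + i - k))
        else \<theta> (diag_pair k (M - k) (s + k - i) t)) = 0" by simp
  next
    \<comment> \<open>The determinant of the first component has valuation \<open>2 * s - k\<close>,
      so this bound on \<open>s\<close> leaves the support.\<close>
    fix k s t :: int assume k: "0 \<le> k" "k \<le> M" "\<bar>N\<bar> + M < s"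
    show "\<theta> (diag_pair k (M - k) s t) = 0"
    proof (rule ccontr)
      assume "\<theta> (diag_pair k (M - k) s t) \<noteq> 0"
      then have "dval (fst (diag_pair k (M - k) s t :: 'p Gp)) \<le> N" by (rule N)
      then have "2 * s - k \<le> N" by (simp add: diag_pair_def dval_diag)
      then show False using k by linarith
    qed
  qed (use kl in simp_all)
  moreover have "\<theta> g = \<theta> (diag_pair k (M - k) (dval (fst g) - cont (fst g)) (dval (snd g) - cont (snd g)))"
  proof -
    have "M - k = l" using kl(3) by simp
    then show ?thesis using hecke_diag_pair[OF \<theta>, of g] unfolding k_def[symmetric] l_def[symmetric] by (simp only:)
  qed
  ultimately show False using g(1) by simp
qed

end

section \<open>Localization at a central regular element\<close>

text \<open>Centrality of \<open>s\<close> makes the operations on fractions well defined, and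
  regularity on \<open>M\<close> cancels the auxiliary exponent \<open>j\<close> in
  \<open>loc_rel\<close>.\<close>

locale central_localization = ring R for R :: "('a, 'c) ring_scheme" (structure) +
  fixes M :: "('a, 'b, 'd) module_scheme" and s :: 'a
  assumes s_closed: "s \<in> carrier R"
    and s_central: "\<And>a. a \<in> carrier R \<Longrightarrow> s \<otimes> a = a \<otimes> s"
    and M_zero: "\<zero>\<^bsub>M\<^esub> \<in> carrier M"
    and M_add: "\<And>m n. m \<in> carrier M \<Longrightarrow> n \<in> carrier M \<Longrightarrow> m \<oplus>\<^bsub>M\<^esub> n \<in> carrier M"
    and M_smult: "\<And>a m. a \<in> carrier R \<Longrightarrow> m \<in> carrier M \<Longrightarrow> a \<odot>\<^bsub>M\<^esub> m \<in> carrier M"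
    and M_distrib: "\<And>a m n. a \<in> carrier R \<Longrightarrow> m \<in> carrier M \<Longrightarrow> n \<in> carrier M \<Longrightarrow>
      a \<odot>\<^bsub>M\<^esub> (m \<oplus>\<^bsub>M\<^esub> n) = a \<odot>\<^bsub>M\<^esub> m \<oplus>\<^bsub>M\<^esub> a \<odot>\<^bsub>M\<^esub> n"
    and M_assoc: "\<And>a b m. a \<in> carrier R \<Longrightarrow> b \<in> carrier R \<Longrightarrow> m \<in> carrier M \<Longrightarrow>
      (a \<otimes> b) \<odot>\<^bsub>M\<^esub> m = a \<odot>\<^bsub>M\<^esub> (b \<odot>\<^bsub>M\<^esub> m)"
    and M_one: "\<And>m. m \<in> carrier M \<Longrightarrow> \<one> \<odot>\<^bsub>M\<^esub> m = m"
    and s_regular: "\<And>m n. m \<in> carrier M \<Longrightarrow> n \<in> carrier M \<Longrightarrow> s \<odot>\<^bsub>M\<^esub> m = s \<odot>\<^bsub>M\<^esub> n \<Longrightarrow> m = n"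
begin

abbreviation spow :: "nat \<Rightarrow> 'b \<Rightarrow> 'b" where
  "spow k m \<equiv> s [^] k \<odot>\<^bsub>M\<^esub> m"

lemma s_pow_closed: "s [^] (k :: nat) \<in> carrier R"
  using s_closed by simp

lemma spow_closed: "m \<in> carrier M \<Longrightarrow> spow k m \<in> carrier M"
  by (rule M_smult[OF s_pow_closed])

lemma spow_spow: "m \<in> carrier M \<Longrightarrow> spow k (spow l m) = spow (k + l) m"
  by (simp add: nat_pow_mult[symmetric] s_closed M_assoc)

lemma spow_inj: "m \<in> carrier M \<Longrightarrow> n \<in> carrier M \<Longrightarrow> spow k m = spow k n \<Longrightarrow> m = n"
proof (induction k)
  case (Suc k)
  have "spow (Suc k) m = s \<odot>\<^bsub>M\<^esub> spow k m" "spow (Suc k) n = s \<odot>\<^bsub>M\<^esub> spow k n"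
    using Suc.prems spow_spow[of m 1 k] spow_spow[of n 1 k] s_closed by simp_all
  then have "spow k m = spow k n" using Suc.prems s_regular spow_closed by metis
  then show ?case using Suc by blast
qed (simp add: M_one)

lemma s_pow_central: "a \<in> carrier R \<Longrightarrow> s [^] (k :: nat) \<otimes> a = a \<otimes> s [^] k"
proof (induction k)
  case (Suc k)
  have "s [^] Suc k \<otimes> a = s [^] k \<otimes> (s \<otimes> a)" using Suc.prems s_closed by (simp add: m_assoc)
  also have "\<dots> = (s [^] k \<otimes> a) \<otimes> s" using Suc.prems s_closed by (simp add: s_central m_assoc)
  also have "\<dots> = a \<otimes> s [^] Suc k" using Suc s_closed by (simp add: m_assoc)
  finally show ?case .
qed simp

lemma smult_spow: "a \<in> carrier R \<Longrightarrow> m \<in> carrier M \<Longrightarrow> a \<odot>\<^bsub>M\<^esub> spow k m = spow k (a \<odot>\<^bsub>M\<^esub> m)"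
  using M_assoc[of a "s [^] k" m] M_assoc[of "s [^] k" a m] s_pow_central[of a k] s_pow_closed by simp

lemma loc_rel_iff:
  "((m, k), (n, l)) \<in> loc_rel R M s \<longleftrightarrow> m \<in> carrier M \<and> n \<in> carrier M \<and> spow l m = spow k n"
proof (cases "m \<in> carrier M \<and> n \<in> carrier M")
  case True
  then have *: "spow l m \<in> carrier M" "spow k n \<in> carrier M" by (simp_all add: spow_closed)
  have "(\<exists>j::nat. spow j (spow l m) = spow j (spow k n)) \<longleftrightarrow> spow l m = spow k n"
  proof
    assume "\<exists>j::nat. spow j (spow l m) = spow j (spow k n)"
    then obtain j :: nat where "spow j (spow l m) = spow j (spow k n)" by (elim exE)
    then show "spow l m = spow k n" by (rule spow_inj[OF *])
  qed simp
  with True show ?thesis unfolding loc_rel_def by simp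
qed (auto simp: loc_rel_def)

lemma mem_loc_frac_iff:
  "m \<in> carrier M \<Longrightarrow> (n, l) \<in> loc_frac R M s m k \<longleftrightarrow> n \<in> carrier M \<and> spow l m = spow k n"
  unfolding loc_frac_def by (simp add: loc_rel_iff)

lemma loc_frac_mem: "m \<in> carrier M \<Longrightarrow> (m, k) \<in> loc_frac R M s m k"
  by (simp add: mem_loc_frac_iff)

lemma loc_frac_eq_iff:
  assumes m: "m \<in> carrier M" and n: "n \<in> carrier M"
  shows "loc_frac R M s m k = loc_frac R M s n l \<longleftrightarrow> spow l m = spow k n"
proof
  assume "loc_frac R M s m k = loc_frac R M s n l"
  then have "(n, l) \<in> loc_frac R M s m k" using loc_frac_mem[OF n] by simp
  then show "spow l m = spow k n" using m by (simp add: mem_loc_frac_iff)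
next
  assume eq: "spow l m = spow k n"
  have "spow q m = spow k r \<longleftrightarrow> spow q n = spow l r" if r: "r \<in> carrier M" for q r
  proof -
    have "spow q m = spow k r \<longleftrightarrow> spow l (spow q m) = spow l (spow k r)"
      using spow_inj[of "spow q m" "spow k r" l] spow_closed m r by auto
    also have "spow l (spow q m) = spow q (spow l m)" by (simp add: spow_spow m add.commute)
    also have "\<dots> = spow k (spow q n)" unfolding eq by (simp add: spow_spow n add.commute)
    also have "spow l (spow k r) = spow k (spow l r)" by (simp add: spow_spow r add.commute)
    also have "spow k (spow q n) = spow k (spow l r) \<longleftrightarrow> spow q n = spow l r"
      using spow_inj[of "spow q n" "spow l r" k] spow_closed n r by auto
    finally show ?thesis .
  qed
  then show "loc_frac R M s m k = loc_frac R M s n l"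
    by (intro Set.set_eqI) (auto simp: mem_loc_frac_iff m n)
qed

lemma carrier_loc_module:
  "carrier (loc_module R M s) = {loc_frac R M s m k | m k. m \<in> carrier M}"
  unfolding loc_module_def loc_frac_def quotient_def by auto

text \<open>The operations of \<open>loc_module\<close> are unions over all representatives; once
  the member sets agree, the union is that common set.\<close>

lemma UN_pairs_const:
  assumes "(m0, k0) \<in> A" "(n0, l0) \<in> B"
    and "\<And>m k n l. (m, k) \<in> A \<Longrightarrow> (n, l) \<in> B \<Longrightarrow> F m k n l = F m0 k0 n0 l0"
  shows "(\<Union>(m, k)\<in>A. \<Union>(n, l)\<in>B. F m k n l) = F m0 k0 n0 l0"
  using assms by fast

lemma loc_module_add:
  assumes m: "m \<in> carrier M" and n: "n \<in> carrier M"
  shows "loc_frac R M s m k \<oplus>\<^bsub>loc_module R M s\<^esub> loc_frac R M s n l =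
    loc_frac R M s (spow l m \<oplus>\<^bsub>M\<^esub> spow k n) (k + l)"
proof -
  have const: "loc_frac R M s (spow l' m' \<oplus>\<^bsub>M\<^esub> spow k' n') (k' + l') =
      loc_frac R M s (spow l m \<oplus>\<^bsub>M\<^esub> spow k n) (k + l)"
    if m': "(m', k') \<in> loc_frac R M s m k" and n': "(n', l') \<in> loc_frac R M s n l" for m' k' n' l'
  proof -
    have *: "m' \<in> carrier M" "spow k' m = spow k m'" "n' \<in> carrier M" "spow l' n = spow l n'"
      using m' n' m n by (simp_all add: mem_loc_frac_iff)
    have "spow (k + l) (spow l' m' \<oplus>\<^bsub>M\<^esub> spow k' n') =
        spow (l + l') (spow k m') \<oplus>\<^bsub>M\<^esub> spow (k + k') (spow l n')"
      using * by (simp add: M_distrib s_pow_closed spow_closed spow_spow ac_simps)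
    also have "\<dots> = spow (l + l') (spow k' m) \<oplus>\<^bsub>M\<^esub> spow (k + k') (spow l' n)"
      by (simp only: *)
    also have "\<dots> = spow (k' + l') (spow l m \<oplus>\<^bsub>M\<^esub> spow k n)"
      using m n by (simp add: M_distrib s_pow_closed spow_closed spow_spow ac_simps)
    finally show ?thesis
      using * m n by (subst loc_frac_eq_iff) (simp_all add: M_add spow_closed)
  qed
  show ?thesis
    unfolding loc_module_def ring.simps module.simps
    by (rule UN_pairs_const[OF loc_frac_mem[OF m] loc_frac_mem[OF n]]) (rule const)
qed

end

lemma (in ring) central_localization_regular:
  assumes "s \<in> carrier R" "\<And>a. a \<in> carrier R \<Longrightarrow> s \<otimes> a = a \<otimes> s"
    "\<And>a b. a \<in> carrier R \<Longrightarrow> b \<in> carrier R \<Longrightarrow> s \<otimes> a = s \<otimes> b \<Longrightarrow> a = b"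
  shows "central_localization R (regular_module R) s"
proof unfold_locales
  show "s \<in> carrier R" "\<And>a. a \<in> carrier R \<Longrightarrow> s \<otimes> a = a \<otimes> s" by (fact assms)+
  show "m = n"
    if "m \<in> carrier (regular_module R)" "n \<in> carrier (regular_module R)"
      "s \<odot>\<^bsub>regular_module R\<^esub> m = s \<odot>\<^bsub>regular_module R\<^esub> n" for m n
    by (rule assms(3)) (use that in \<open>simp_all add: regular_module_def\<close>)
qed (simp_all add: regular_module_def r_distr m_assoc)

locale central_localization_both = central_localization R M s
  for R :: "('a, 'c) ring_scheme" (structure) and M :: "('a, 'b, 'd) module_scheme" and s +
  assumes s_regular_ring: "\<And>a b. a \<in> carrier R \<Longrightarrow> b \<in> carrier R \<Longrightarrow> s \<otimes> a = s \<otimes> b \<Longrightarrow> a = b"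
begin

sublocale reg: central_localization R "regular_module R" s
  by (rule central_localization_regular[OF s_closed s_central s_regular_ring])

lemma regular_sel [simp]:
  "carrier (regular_module R) = carrier R" "\<zero>\<^bsub>regular_module R\<^esub> = \<zero>"
  "a \<oplus>\<^bsub>regular_module R\<^esub> b = a \<oplus> b" "a \<odot>\<^bsub>regular_module R\<^esub> b = a \<otimes> b"
  by (simp_all add: regular_module_def)

abbreviation rfrac :: "'a \<Rightarrow> nat \<Rightarrow> ('a \<times> nat) set" where
  "rfrac \<equiv> loc_frac R (regular_module R) s"

abbreviation mfrac :: "'b \<Rightarrow> nat \<Rightarrow> ('b \<times> nat) set" where
  "mfrac \<equiv> loc_frac R M s"

lemma loc_module_smult:
  assumes a: "a \<in> carrier R" and m: "m \<in> carrier M"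
  shows "rfrac a k \<odot>\<^bsub>loc_module R M s\<^esub> mfrac m l = mfrac (a \<odot>\<^bsub>M\<^esub> m) (k + l)"
proof -
  have const: "mfrac (a' \<odot>\<^bsub>M\<^esub> m') (k' + l') = mfrac (a \<odot>\<^bsub>M\<^esub> m) (k + l)"
    if a': "(a', k') \<in> rfrac a k" and m': "(m', l') \<in> mfrac m l" for a' k' m' l'
  proof -
    have *: "a' \<in> carrier R" "s [^] k' \<otimes> a = s [^] k \<otimes> a'" "m' \<in> carrier M" "spow l' m = spow l m'"
      using a' m' a m reg.mem_loc_frac_iff[of a a' k' k] by (simp_all add: mem_loc_frac_iff)
    have swap: "spow (i + j) (b \<odot>\<^bsub>M\<^esub> n) = (s [^] i \<otimes> b) \<odot>\<^bsub>M\<^esub> spow j n"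
      if "b \<in> carrier R" "n \<in> carrier M" for i j b n
    proof -
      have "(s [^] i \<otimes> b) \<odot>\<^bsub>M\<^esub> spow j n = spow i (b \<odot>\<^bsub>M\<^esub> spow j n)"
        by (rule M_assoc[OF s_pow_closed that(1) spow_closed[OF that(2)]])
      also have "\<dots> = spow (i + j) (b \<odot>\<^bsub>M\<^esub> n)"
        unfolding smult_spow[OF that] by (rule spow_spow[OF M_smult[OF that]])
      finally show ?thesis ..
    qed
    have "spow (k + l) (a' \<odot>\<^bsub>M\<^esub> m') = spow (k' + l') (a \<odot>\<^bsub>M\<^esub> m)"
      by (simp only: swap * a m)
    then show ?thesis using * a m by (subst loc_frac_eq_iff) (simp_all add: M_smult)
  qed
  have "(a, k) \<in> rfrac a k" using reg.loc_frac_mem[of a k] a by simp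
  then show ?thesis
    unfolding loc_module_def ring.simps module.simps
    by (rule UN_pairs_const[OF _ loc_frac_mem[OF m]]) (rule const)
qed

lemma loc_ring_sel:
  "carrier (loc_ring R s) = {rfrac a k | a k. a \<in> carrier R}"
  "\<one>\<^bsub>loc_ring R s\<^esub> = rfrac \<one> 0"
  using reg.carrier_loc_module by (simp_all add: loc_ring_def Let_def)

lemma loc_ring_add:
  "a \<in> carrier R \<Longrightarrow> b \<in> carrier R \<Longrightarrow>
    rfrac a k \<oplus>\<^bsub>loc_ring R s\<^esub> rfrac b l = rfrac (s [^] l \<otimes> a \<oplus> s [^] k \<otimes> b) (k + l)"
  using reg.loc_module_add[of a b k l] by (simp add: loc_ring_def Let_def)

end

text \<open>The ring is taken as a module over itself, so that products of fractions are a case of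
  \<open>loc_module_smult\<close>.\<close>

sublocale central_localization_both \<subseteq> reg2: central_localization_both R "regular_module R" s
  by unfold_locales (rule s_regular_ring)

context central_localization_both
begin

lemma loc_ring_mult:
  "a \<in> carrier R \<Longrightarrow> b \<in> carrier R \<Longrightarrow> rfrac a k \<otimes>\<^bsub>loc_ring R s\<^esub> rfrac b l = rfrac (a \<otimes> b) (k + l)"
  using reg2.loc_module_smult[of a b k l] by (simp add: loc_ring_def Let_def)

text \<open>The fractions whose numerators are multiples of \<open>x\<close> by elements of
  \<open>J\<close> form a submodule. It contains every generator, since m = (s m) / s, hence the
  whole generated submodule.\<close>

lemma generated_coefficient:
  assumes x: "x \<in> carrier M"
    and J: "J \<subseteq> carrier R" "\<zero> \<in> J" "\<And>a b. a \<in> J \<Longrightarrow> b \<in> J \<Longrightarrow> a \<oplus> b \<in> J"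
      "\<And>r a. r \<in> carrier R \<Longrightarrow> a \<in> J \<Longrightarrow> r \<otimes> a \<in> J"
    and A: "A \<subseteq> carrier M" "\<And>m. m \<in> A \<Longrightarrow> \<exists>a\<in>J. s \<odot>\<^bsub>M\<^esub> m = a \<odot>\<^bsub>M\<^esub> x"
    and M_group: "\<And>m. m \<in> carrier M \<Longrightarrow> \<zero>\<^bsub>M\<^esub> \<oplus>\<^bsub>M\<^esub> m = m" "\<And>m. m \<in> carrier M \<Longrightarrow> m \<oplus>\<^bsub>M\<^esub> \<zero>\<^bsub>M\<^esub> = m"
      "\<And>a b m. a \<in> carrier R \<Longrightarrow> b \<in> carrier R \<Longrightarrow> m \<in> carrier M \<Longrightarrow>
        (a \<oplus> b) \<odot>\<^bsub>M\<^esub> m = a \<odot>\<^bsub>M\<^esub> m \<oplus>\<^bsub>M\<^esub> b \<odot>\<^bsub>M\<^esub> m"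
      "\<And>m n. m \<in> carrier M \<Longrightarrow> n \<in> carrier M \<Longrightarrow> m \<oplus>\<^bsub>M\<^esub> n = \<zero>\<^bsub>M\<^esub> \<Longrightarrow> n = (\<ominus> \<one>) \<odot>\<^bsub>M\<^esub> m"
      "\<zero> \<odot>\<^bsub>M\<^esub> x = \<zero>\<^bsub>M\<^esub>"
    and f: "f \<in> generated_submodule (loc_ring R s) (loc_module R M s) ((\<lambda>m. mfrac m 0) ` A)"
  shows "\<exists>a\<in>J. \<exists>k. f = mfrac (a \<odot>\<^bsub>M\<^esub> x) k"
proof -
  let ?L = "loc_module R M s"
  define N where "N = {mfrac (a \<odot>\<^bsub>M\<^esub> x) k | a k. a \<in> J}"
  have NI: "mfrac (a \<odot>\<^bsub>M\<^esub> x) k \<in> N" if "a \<in> J" for a k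
    unfolding N_def using that by blast
  have Jc: "a \<in> carrier R" if "a \<in> J" for a using J(1) that by blast
  have zero: "\<zero>\<^bsub>?L\<^esub> = mfrac \<zero>\<^bsub>M\<^esub> 0" by (simp add: loc_module_def)
  have spow_zero: "spow k \<zero>\<^bsub>M\<^esub> = \<zero>\<^bsub>M\<^esub>" for k
  proof -
    have "spow k (\<zero> \<odot>\<^bsub>M\<^esub> x) = (s [^] k \<otimes> \<zero>) \<odot>\<^bsub>M\<^esub> x" by (rule M_assoc[symmetric]) (simp_all add: s_pow_closed x)
    then show ?thesis using M_group(5) s_pow_closed by simp
  qed
  have "submodule N (loc_ring R s) ?L"
  proof (rule submodule.intro)
    show "subgroup N (add_monoid ?L)"
    proof
      show "N \<subseteq> carrier (add_monoid ?L)"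
        unfolding N_def using Jc M_smult x by (auto simp: carrier_loc_module)
      show "\<one>\<^bsub>add_monoid ?L\<^esub> \<in> N"
        using NI[OF J(2), of 0] M_group(5) by (simp add: zero)
      show "P \<otimes>\<^bsub>add_monoid ?L\<^esub> Q \<in> N" if P: "P \<in> N" and Q: "Q \<in> N" for P Q
      proof -
        obtain a k where a: "P = mfrac (a \<odot>\<^bsub>M\<^esub> x) k" "a \<in> J" using P unfolding N_def by blast
        obtain b l where b: "Q = mfrac (b \<odot>\<^bsub>M\<^esub> x) l" "b \<in> J" using Q unfolding N_def by blast
        have "P \<oplus>\<^bsub>?L\<^esub> Q = mfrac (spow l (a \<odot>\<^bsub>M\<^esub> x) \<oplus>\<^bsub>M\<^esub> spow k (b \<odot>\<^bsub>M\<^esub> x)) (k + l)"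
          unfolding a(1) b(1) using a(2) b(2) Jc x by (simp add: loc_module_add M_smult)
        also have "spow l (a \<odot>\<^bsub>M\<^esub> x) \<oplus>\<^bsub>M\<^esub> spow k (b \<odot>\<^bsub>M\<^esub> x) = (s [^] l \<otimes> a \<oplus> s [^] k \<otimes> b) \<odot>\<^bsub>M\<^esub> x"
          using a(2) b(2) Jc x s_pow_closed by (simp add: M_assoc M_group(3))
        finally show ?thesis using a(2) b(2) J(3,4) s_pow_closed by (auto intro: NI)
      qed
      show "inv\<^bsub>add_monoid ?L\<^esub> P \<in> N" if P: "P \<in> N" for P
      proof -
        obtain a k where a: "P = mfrac (a \<odot>\<^bsub>M\<^esub> x) k" "a \<in> J" using P unfolding N_def by blast
        let ?m = "a \<odot>\<^bsub>M\<^esub> x"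
        let ?b = "(\<ominus> \<one>) \<otimes> a"
        have m: "?m \<in> carrier M" using a(2) Jc x M_smult by blast
        have b: "?b \<in> J" using J(4)[of "\<ominus> \<one>" a] a(2) by simp
        have n: "?b \<odot>\<^bsub>M\<^esub> x = (\<ominus> \<one>) \<odot>\<^bsub>M\<^esub> ?m" using a(2) Jc x by (simp add: M_assoc del: l_minus)
        have nc: "?b \<odot>\<^bsub>M\<^esub> x \<in> carrier M" using b Jc x M_smult by blast
        have sum0: "?m \<oplus>\<^bsub>M\<^esub> ?b \<odot>\<^bsub>M\<^esub> x = \<zero>\<^bsub>M\<^esub>" "?b \<odot>\<^bsub>M\<^esub> x \<oplus>\<^bsub>M\<^esub> ?m = \<zero>\<^bsub>M\<^esub>"
          using M_group(3)[of a ?b x] M_group(3)[of ?b a x] a(2) b Jc x M_group(5) by (simp_all add: r_neg l_neg l_minus)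
        \<comment> \<open>The inverse in \<open>add_monoid\<close> is defined by a description, so
          the candidate is shown directly to be the only solution.\<close>
        have inv_unique: "Q = mfrac (?b \<odot>\<^bsub>M\<^esub> x) k"
          if Q: "Q \<in> carrier ?L" and PQ: "P \<oplus>\<^bsub>?L\<^esub> Q = \<zero>\<^bsub>?L\<^esub>" for Q
        proof -
          obtain q l where q: "Q = mfrac q l" "q \<in> carrier M" using Q unfolding carrier_loc_module by blast
          have "mfrac (spow l ?m \<oplus>\<^bsub>M\<^esub> spow k q) (k + l) = mfrac \<zero>\<^bsub>M\<^esub> 0"
            using PQ m q by (simp add: a(1) loc_module_add zero)
          then have "spow l ?m \<oplus>\<^bsub>M\<^esub> spow k q = \<zero>\<^bsub>M\<^esub>"
            using m q M_zero by (simp add: loc_frac_eq_iff M_add spow_closed spow_zero M_one)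
          then have "spow k q = (\<ominus> \<one>) \<odot>\<^bsub>M\<^esub> spow l ?m" using m q by (intro M_group(4) spow_closed)
          also have "\<dots> = spow l (?b \<odot>\<^bsub>M\<^esub> x)" unfolding n using m by (intro smult_spow) simp_all
          finally show ?thesis unfolding q(1) by (simp add: loc_frac_eq_iff[OF q(2) nc])
        qed
        have zz: "mfrac (\<zero>\<^bsub>M\<^esub>) (k + k) = \<zero>\<^bsub>?L\<^esub>"
          unfolding zero using M_zero by (simp add: loc_frac_eq_iff spow_zero M_one)
        have sumk: "spow k ?m \<oplus>\<^bsub>M\<^esub> spow k (?b \<odot>\<^bsub>M\<^esub> x) = \<zero>\<^bsub>M\<^esub>" "spow k (?b \<odot>\<^bsub>M\<^esub> x) \<oplus>\<^bsub>M\<^esub> spow k ?m = \<zero>\<^bsub>M\<^esub>"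
          using M_distrib[OF s_pow_closed m nc, of k] M_distrib[OF s_pow_closed nc m, of k] sum0 spow_zero by simp_all
        have "P \<oplus>\<^bsub>?L\<^esub> mfrac (?b \<odot>\<^bsub>M\<^esub> x) k = \<zero>\<^bsub>?L\<^esub>" "mfrac (?b \<odot>\<^bsub>M\<^esub> x) k \<oplus>\<^bsub>?L\<^esub> P = \<zero>\<^bsub>?L\<^esub>"
          unfolding a(1) using m nc sumk zz by (simp_all add: loc_module_add)
        moreover have "mfrac (?b \<odot>\<^bsub>M\<^esub> x) k \<in> carrier ?L" using nc unfolding carrier_loc_module by blast
        ultimately have "inv\<^bsub>add_monoid ?L\<^esub> P = mfrac (?b \<odot>\<^bsub>M\<^esub> x) k"
          unfolding m_inv_def by (intro the_equality) (simp_all add: inv_unique)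
        then show ?thesis using NI[OF b] by simp
      qed
    qed
    show "submodule_axioms N (loc_ring R s) ?L"
    proof
      fix P Q assume P: "P \<in> carrier (loc_ring R s)" and Q: "Q \<in> N"
      obtain r l where r: "P = rfrac r l" "r \<in> carrier R" using P unfolding loc_ring_sel by blast
      obtain a k where a: "Q = mfrac (a \<odot>\<^bsub>M\<^esub> x) k" "a \<in> J" using Q unfolding N_def by blast
      have "P \<odot>\<^bsub>?L\<^esub> Q = mfrac ((r \<otimes> a) \<odot>\<^bsub>M\<^esub> x) (l + k)"
        unfolding r(1) a(1) using r(2) a(2) Jc x by (simp add: loc_module_smult M_smult M_assoc)
      then show "P \<odot>\<^bsub>?L\<^esub> Q \<in> N" using NI J(4)[OF r(2) a(2)] by simp
    qed
  qed
  moreover have "(\<lambda>m. mfrac m 0) ` A \<subseteq> N"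
  proof (rule image_subsetI)
    fix m assume m: "m \<in> A"
    then obtain a where a: "a \<in> J" "s \<odot>\<^bsub>M\<^esub> m = a \<odot>\<^bsub>M\<^esub> x" using A(2) by blast
    have "mfrac m 0 = mfrac (a \<odot>\<^bsub>M\<^esub> x) 1"
      using a m A(1) Jc x M_smult s_closed by (subst loc_frac_eq_iff) (auto simp: M_one)
    then show "mfrac m 0 \<in> N" using NI[OF a(1)] by simp
  qed
  ultimately have "f \<in> N" using f unfolding generated_submodule_def by blast
  then show ?thesis unfolding N_def by blast
qed

text \<open>Cross-multiplication turns the equality of fractions into one between multiples of
  \<open>x\<close>, where \<open>inj\<close> applies.\<close>

lemma coefficient_unique:
  assumes x: "x \<in> carrier M" and inj: "\<And>a b. a \<in> carrier R \<Longrightarrow> b \<in> carrier R \<Longrightarrow> a \<odot>\<^bsub>M\<^esub> x = b \<odot>\<^bsub>M\<^esub> x \<Longrightarrow> a = b"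
    and P: "P \<in> carrier (loc_ring R s)" and a: "a \<in> carrier R"
    and eq: "P \<odot>\<^bsub>loc_module R M s\<^esub> mfrac x 0 = mfrac (a \<odot>\<^bsub>M\<^esub> x) k"
  shows "P = rfrac a k"
proof -
  obtain b l where b: "P = rfrac b l" "b \<in> carrier R" using P unfolding loc_ring_sel by blast
  have "mfrac (b \<odot>\<^bsub>M\<^esub> x) l = mfrac (a \<odot>\<^bsub>M\<^esub> x) k"
    using eq b x by (simp add: loc_module_smult)
  then have "spow k (b \<odot>\<^bsub>M\<^esub> x) = spow l (a \<odot>\<^bsub>M\<^esub> x)"
    using a b x by (simp add: loc_frac_eq_iff M_smult)
  then have "(s [^] k \<otimes> b) \<odot>\<^bsub>M\<^esub> x = (s [^] l \<otimes> a) \<odot>\<^bsub>M\<^esub> x"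
    using a b x s_pow_closed by (simp add: M_assoc)
  then have "s [^] k \<otimes> b = s [^] l \<otimes> a" by (intro inj[of "s [^] k \<otimes> b" "s [^] l \<otimes> a"] m_closed s_pow_closed a b)
  then show ?thesis unfolding b(1) using reg.loc_frac_eq_iff[of b a l k] a b by simp
qed

lemma rfrac_in_ideal:
  assumes I: "ideal I (loc_ring R s)" and g: "rfrac g 0 \<in> I" "rfrac h 0 \<in> I"
    and c: "g \<in> carrier R" "h \<in> carrier R" "y \<in> carrier R" "z \<in> carrier R"
  shows "rfrac (y \<otimes> g \<oplus> z \<otimes> h) k \<in> I"
proof -
  interpret I: ideal I "loc_ring R s" by (rule I)
  have "rfrac y k \<otimes>\<^bsub>loc_ring R s\<^esub> rfrac g 0 \<in> I" "rfrac z k \<otimes>\<^bsub>loc_ring R s\<^esub> rfrac h 0 \<in> I"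
    by (rule I.I_l_closed[OF g(1)], use c in \<open>auto simp: loc_ring_sel\<close>)
      (rule I.I_l_closed[OF g(2)], use c in \<open>auto simp: loc_ring_sel\<close>)
  then have "rfrac (y \<otimes> g) k \<in> I" "rfrac (z \<otimes> h) k \<in> I"
    using c by (simp_all add: loc_ring_mult)
  then have "rfrac (y \<otimes> g) k \<oplus>\<^bsub>loc_ring R s\<^esub> rfrac (z \<otimes> h) k \<in> I"
    by (rule additive_subgroup.a_closed[OF I.is_additive_subgroup])
  then have "rfrac (s [^] k \<otimes> (y \<otimes> g) \<oplus> s [^] k \<otimes> (z \<otimes> h)) (k + k) \<in> I"
    using c by (simp add: loc_ring_add)
  \<comment> \<open>Adding two fractions over s^k gives the denominator s^(2k); the common factor
    s^k cancels.\<close>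
  moreover have "rfrac (s [^] k \<otimes> (y \<otimes> g) \<oplus> s [^] k \<otimes> (z \<otimes> h)) (k + k) = rfrac (y \<otimes> g \<oplus> z \<otimes> h) k"
    using c s_pow_closed
    by (subst reg.loc_frac_eq_iff) (simp_all add: r_distr nat_pow_mult[symmetric] s_closed m_assoc)
  ultimately show ?thesis by simp
qed

end

section \<open>The universal module\<close>

text \<open>The four numbers are built from contents and determinant valuations. Right
  multiplication by \<open>s\<close> changes each by a bounded amount: superadditivity for
  \<open>s\<close> gives a bound on one side, for its inverse on the other.\<close>

lemma orb_right_mult_bounded:
  fixes s :: "'p::prime_card Gp"
  shows "\<exists>K. \<forall>x n m i j n' m' i' j'. orb x = (n, m, i, j) \<longrightarrow> orb (x * s) = (n', m', i', j') \<longrightarrow>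
    n \<in> {n' - K..n' + K} \<and> m \<in> {m' - K..m' + K} \<and> i \<in> {i' - K..i' + K} \<and> j \<in> {j' - K..j' + K}"
proof -
  obtain a b where s: "s = (a, b)" by (cases s)
  define \<alpha> \<alpha>' \<beta> \<beta>' \<delta> where "\<alpha> = cont a" "\<alpha>' = cont (inverse a)" "\<beta> = cont b" "\<beta>' = cont (inverse b)"
    "\<delta> = dval a - dval b"
  note defs = this
  obtain A A' B B' D where abs: "- A \<le> \<alpha>" "\<alpha> \<le> A" "- A' \<le> \<alpha>'" "\<alpha>' \<le> A'" "- B \<le> \<beta>" "\<beta> \<le> B"
      "- B' \<le> \<beta>'" "\<beta>' \<le> B'" "- D \<le> \<delta>" "\<delta> \<le> D"
    by (metis abs_ge_self abs_ge_minus_self minus_le_iff)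
  \<comment> \<open>A generous bound; what matters is its independence of \<open>x\<close>.\<close>
  define K where "K = 3 * A + 3 * A' + 3 * B + 3 * B' + D"
  have "n \<in> {n' - K..n' + K} \<and> m \<in> {m' - K..m' + K} \<and> i \<in> {i' - K..i' + K} \<and> j \<in> {j' - K..j' + K}"
    if o: "orb x = (n, m, i, j)" and o': "orb (x * s) = (n', m', i', j')" for x n m i j n' m' i' j'
  proof -
    obtain y z where x: "x = (y, z)" by (cases x)
    let ?c = "cont (inverse z * y)"
    let ?c' = "cont (inverse (z * b) * (y * a))"
    have n: "n = rcont y" "n' = rcont (y * a)" and m: "m = rcont z" "m' = rcont (z * b)"
      and i: "i = dval y - dval z - n + m - ?c" "i' = dval (y * a) - dval (z * b) - n' + m' - ?c'"
      and j: "j = n - m - ?c" "j' = n' - m' - ?c'"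
      using o o' by (simp_all add: orb_def x s Let_def)
    have up: "n + \<alpha> \<le> n'" "m + \<beta> \<le> m'"
      unfolding n m defs by (rule rcont_mult)+
    have down: "n' + \<alpha>' \<le> n" "m' + \<beta>' \<le> m"
      using rcont_mult[of "y * a" "inverse a"] rcont_mult[of "z * b" "inverse b"]
      unfolding n m defs by (simp_all add: mult.assoc)
    have c_up: "?c + \<alpha> + \<beta>' \<le> ?c'"
      using cont_mult[of "inverse b" "inverse z * y * a"] cont_mult[of "inverse z * y" a]
      unfolding defs by (simp add: mult.assoc gl2_inverse_mult)
    have c_down: "?c' + \<alpha>' + \<beta> \<le> ?c"
    proof -
      have "inverse z * y = b * (inverse (z * b) * (y * a) * inverse a)"
        by (simp add: gl2_inverse_mult mult.assoc)
      then show ?thesis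
        using cont_mult[of b "inverse (z * b) * (y * a) * inverse a"]
          cont_mult[of "inverse (z * b) * (y * a)" "inverse a"]
        unfolding defs by simp
    qed
    have d: "dval (y * a) - dval (z * b) = dval y - dval z + \<delta>"
      unfolding defs by (simp add: dval_mult)
    have nonneg: "0 \<le> A" "0 \<le> A'" "0 \<le> B" "0 \<le> B'" "0 \<le> D" using abs by linarith+
    have diff: "n - n' \<le> A" "n' - n \<le> A'" "m - m' \<le> B" "m' - m \<le> B'"
      "?c - ?c' \<le> A + B'" "?c' - ?c \<le> A' + B"
      using up down c_up c_down abs by linarith+
    have i': "i - i' = (n' - n) + (m - m') + (?c' - ?c) - \<delta>" and j': "j - j' = (n - n') + (m' - m) + (?c' - ?c)"
      using i j d by linarith+
    have "i - i' \<le> A' + B + (A' + B) + D" "i' - i \<le> A + B' + (A + B') + D"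
      "j - j' \<le> A + B' + (A' + B)" "j' - j \<le> A' + B + (A + B')"
      using i' j' diff abs(9,10) by linarith+
    then show ?thesis
      using diff(1-4) nonneg unfolding K_def atLeastAtMost_iff by (intro conjI; linarith)
  qed
  then show ?thesis by blast
qed

lemma finite_orb_right_mult:
  fixes s :: "'p::prime_card Gp"
  assumes "finite F"
  shows "finite (orb ` {x. orb (x * s) \<in> F})"
proof -
  obtain K where K: "\<And>x n m i j n' m' i' j'. orb x = (n, m, i, j) \<Longrightarrow> orb (x * s) = (n', m', i', j') \<Longrightarrow>
      n \<in> {n' - K..n' + K} \<and> m \<in> {m' - K..m' + K} \<and> i \<in> {i' - K..i' + K} \<and> j \<in> {j' - K..j' + K}"
    using orb_right_mult_bounded[of s] by metis
  have "orb ` {x. orb (x * s) \<in> F} \<subseteq>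
    (\<Union>(n, m, i, j)\<in>F. {n - K..n + K} \<times> {m - K..m + K} \<times> {i - K..i + K} \<times> {j - K..j + K})"
  proof (rule image_subsetI)
    fix x assume x: "x \<in> {x. orb (x * s) \<in> F}"
    obtain n m i j where o: "orb x = (n, m, i, j)" by (rule prod_cases4)
    obtain n' m' i' j' where o': "orb (x * s) = (n', m', i', j')" by (rule prod_cases4)
    have "(n', m', i', j') \<in> F" using x o' by simp
    then show "orb x \<in> (\<Union>(n, m, i, j)\<in>F. {n - K..n + K} \<times> {m - K..m + K} \<times> {i - K..i + K} \<times> {j - K..j + K})"
      using K[OF o o'] unfolding o by (intro UN_I[of "(n', m', i', j')"]) simp_all
  qed
  moreover have "finite (\<Union>(n, m, i, j)\<in>F. {n - K..n + K} \<times> {m - K..m + K} \<times> {i - K..i + K} \<times> {j - K..j + K})"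
    using assms by (intro finite_UN_I) (simp_all add: case_prod_beta)
  ultimately show ?thesis by (rule finite_subset)
qed

text \<open>For \<open>i = 0\<close> or \<open>j = 0\<close> one ball contains the other, so both
  can be centred at 0 and a pair of diagonal matrices represents the orbit. The exponents of the
  witness solve \<open>orb_upper\<close> with \<open>M = n - m - j\<close>.\<close>

lemma orb_centre_torus:
  assumes o: "orb (g :: 'p::prime_card Gp) = (n, m, i, j)" and ij: "i = 0 \<or> j = 0"
  shows "\<exists>h\<in>centre_torus. orb (h :: 'p Gp) = orb g"
proof -
  let ?z = "pp powi m :: 'p padic" and ?a = "pp powi (n - m + i - j) :: 'p padic" and ?d = "pp powi (n - m) :: 'p padic"
  have pos: "0 \<le> i" "0 \<le> j" using orbit_equiv_orep[OF o] by blast+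
  have "orb (gl2_of (?z * ?a) 0 0 (?z * ?d), gl2_of ?z 0 0 ?z) =
    (val (?z * ?d), m, val (?z * ?a) - m - (n - m - j), val (?z * ?d) - m - (n - m - j))"
    by (rule orb_upper) (use ij pos in \<open>auto simp: val_mult pdvd_iff\<close>)
  also have "\<dots> = orb g" unfolding o by (simp add: val_mult)
  also have "gl2_of (?z * ?a) 0 0 (?z * ?d) = gl2_of ?z 0 0 ?z * gl2_of ?a 0 0 ?d"
    by (simp add: gl2_of_mult)
  finally have torus: "orb (gl2_of ?z 0 0 ?z * gl2_of ?a 0 0 ?d, gl2_of ?z 0 0 ?z) = orb g" .
  have "(gl2_of ?z 0 0 ?z * gl2_of ?a 0 0 ?d, gl2_of ?z 0 0 ?z) \<in> centre_torus"
    unfolding centre_torus_def mem_Collect_eq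
    by (intro exI[of _ ?z] exI[of _ ?a] exI[of _ ?d]) simp
  show ?thesis using torus by (rule bexI) fact
qed

lemma Cc_sel [simp]:
  "\<zero>\<^bsub>Cc \<mu>\<^esub> = (\<lambda>_. 0)" "f \<oplus>\<^bsub>Cc \<mu>\<^esub> h = (\<lambda>g. f g + h g)" "\<theta> \<odot>\<^bsub>Cc \<mu>\<^esub> f = hecke_action \<mu> \<theta> f"
  by (simp_all add: Cc_def)

text \<open>Because \<open>orb\<close> is a complete invariant, support on finitely many orbits
  means a finite image under \<open>orb\<close>.\<close>

lemma carrier_Cc_iff:
  fixes f :: "'p::prime_card Gp \<Rightarrow> real"
  shows "f \<in> carrier (Cc \<mu>) \<longleftrightarrow> (\<forall>g. f g \<in> Z_inv CARD('p)) \<and> orbit_fun f \<and> finite (orb ` {g. f g \<noteq> 0})"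
proof -
  have "(\<exists>S. finite S \<and> {g. f g \<noteq> 0} \<subseteq> {u * s * k | u s k. u \<in> mirabolic \<and> s \<in> S \<and> k \<in> Gp0}) \<longleftrightarrow>
    finite (orb ` {g. f g \<noteq> 0})" (is "?L \<longleftrightarrow> _")
  proof
    assume ?L
    then obtain S where S: "finite S" "{g. f g \<noteq> 0} \<subseteq> {u * s * k | u s k. u \<in> mirabolic \<and> s \<in> S \<and> k \<in> Gp0}"
      by (elim exE conjE)
    have "orb ` {g. f g \<noteq> 0} \<subseteq> orb ` S"
    proof (rule image_subsetI)
      fix g assume "g \<in> {g. f g \<noteq> 0}"
      then have "g \<in> {u * s * k | u s k. u \<in> mirabolic \<and> s \<in> S \<and> k \<in> Gp0}" using S(2) by (rule rev_subsetD)
      then obtain u s k where "g = u * s * k" "u \<in> mirabolic" "s \<in> S" "k \<in> Gp0"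
        unfolding mem_Collect_eq by (elim exE conjE)
      then show "orb g \<in> orb ` S" by (simp add: orb_mult_Gp0 orb_mirabolic_mult)
    qed
    then show "finite (orb ` {g. f g \<noteq> 0})" using S(1) by (simp add: finite_subset)
  next
    assume fin: "finite (orb ` {g. f g \<noteq> 0})"
    let ?r = "\<lambda>(n, m, i, j). orep n m i j :: 'p Gp"
    let ?S = "?r ` orb ` {g. f g \<noteq> 0}"
    have "{g. f g \<noteq> 0} \<subseteq> {u * s * k | u s k. u \<in> mirabolic \<and> s \<in> ?S \<and> k \<in> Gp0}"
    proof (rule subsetI)
      fix g assume g: "g \<in> {g. f g \<noteq> 0}"
      obtain n m i j where o: "orb g = (n, m, i, j)" by (rule prod_cases4)
      have r: "?r (orb g) \<in> ?S" using g by (intro imageI)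
      have "orbit_equiv g (?r (orb g))" using orbit_equiv_orep(3)[OF o] by (simp add: o)
      then obtain u k where "u \<in> mirabolic" "k \<in> Gp0" "g = u * ?r (orb g) * k"
        unfolding orbit_equiv_def by (elim bexE)
      then show "g \<in> {u * s * k | u s k. u \<in> mirabolic \<and> s \<in> ?S \<and> k \<in> Gp0}"
        unfolding mem_Collect_eq using r by (intro exI[of _ u] exI[of _ "?r (orb g)"] exI[of _ k] conjI)
    qed
    then show ?L by (intro exI[of _ ?S] conjI) (rule finite_imageI[OF fin])
  qed
  then show ?thesis
    unfolding Cc_def orbit_fun_def by (simp add: image_subset_iff)
qed

lemma carrier_Cc_rinv: "f \<in> carrier (Cc \<mu>) \<Longrightarrow> rinv f"
  by (simp add: carrier_Cc_iff orbit_fun_rinv)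

lemma f0_carrier_Cc: "(f0 :: 'p::prime_card Gp \<Rightarrow> real) \<in> carrier (Cc \<mu>)"
proof -
  have "orb ` {g :: 'p Gp. orb_ind 0 0 0 0 g \<noteq> (0 :: real)} \<subseteq> {(0, 0, 0, 0)}"
    by (rule image_subsetI) (simp add: orb_ind_def)
  then have "finite (orb ` {g :: 'p Gp. orb_ind 0 0 0 0 g \<noteq> (0 :: real)})" by (rule finite_subset) simp
  then show ?thesis
    by (simp add: carrier_Cc_iff f0_eq orbit_fun_orb_ind) (simp add: orb_ind_def)
qed

lemma Cc_add_carrier:
  assumes "f \<in> carrier (Cc \<mu>)" "h \<in> carrier (Cc \<mu>)"
  shows "(\<lambda>g. f g + h g) \<in> carrier (Cc (\<mu> :: 'p::prime_card Gp measure))"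
proof -
  have "orb ` {g. f g + h g \<noteq> 0} \<subseteq> orb ` {g. f g \<noteq> 0} \<union> orb ` {g. h g \<noteq> 0}" by fastforce
  then have "finite (orb ` {g. f g + h g \<noteq> 0})"
    by (rule finite_subset) (use assms in \<open>simp add: carrier_Cc_iff\<close>)
  then show ?thesis using assms by (simp add: carrier_Cc_iff orbit_fun_add Z_inv_add card_pos)
qed

context haar
begin

lemma Cc_action_carrier:
  assumes \<theta>: "\<theta> \<in> hecke_carrier" and f: "f \<in> carrier (Cc \<mu>)"
  shows "hecke_action \<mu> \<theta> f \<in> carrier (Cc \<mu>)"
proof -
  have f': "\<And>g. f g \<in> Z_inv CARD('p)" "orbit_fun f" "finite (orb ` {g. f g \<noteq> 0})"
    using f by (simp_all add: carrier_Cc_iff)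
  obtain S where S: "finite S" "\<forall>f x. rinv f \<longrightarrow> hecke_action \<mu> \<theta> f x = (\<Sum>s\<in>S. \<theta> s * f (x * s))"
    using hecke_transversal[OF \<theta>] by (elim exE conjE)
  have act: "hecke_action \<mu> \<theta> f x = (\<Sum>s\<in>S. \<theta> s * f (x * s))" for x
    using S(2) carrier_Cc_rinv[OF f] by simp
  have "hecke_action \<mu> \<theta> f x \<in> Z_inv CARD('p)" for x
    unfolding act by (intro Z_inv_sum Z_inv_mult hecke_carrierD(1)[OF \<theta>] f'(1) card_pos)
  moreover have "finite (orb ` {g. hecke_action \<mu> \<theta> f g \<noteq> 0})"
  proof (rule finite_subset)
    show "orb ` {g. hecke_action \<mu> \<theta> f g \<noteq> 0} \<subseteq> (\<Union>s\<in>S. orb ` {x. orb (x * s) \<in> orb ` {g. f g \<noteq> 0}})"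
    proof (rule image_subsetI)
      fix x assume "x \<in> {g. hecke_action \<mu> \<theta> f g \<noteq> 0}"
      then have "(\<Sum>s\<in>S. \<theta> s * f (x * s)) \<noteq> 0" by (simp add: act)
      then obtain s where s: "s \<in> S" "\<theta> s * f (x * s) \<noteq> 0" by (rule sum.not_neutral_contains_not_neutral)
      then have "orb (x * s) \<in> orb ` {g. f g \<noteq> 0}" by (intro imageI) simp
      then show "orb x \<in> (\<Union>s\<in>S. orb ` {x. orb (x * s) \<in> orb ` {g. f g \<noteq> 0}})"
        using s(1) by (intro UN_I[of s] imageI) simp_all
    qed
    show "finite (\<Union>s\<in>S. orb ` {x. orb (x * s) \<in> orb ` {g. f g \<noteq> 0}})"
      using S(1) f'(3) by (intro finite_UN_I finite_orb_right_mult)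
  qed
  ultimately show ?thesis
    using hecke_action_orbit_fun[OF \<theta> f'(2)] by (simp add: carrier_Cc_iff)
qed

section \<open>Centrality and regularity of one minus S_p\<close>

lemma one_minus_S_eq: "one_minus_S \<mu> = hecke_const 1 \<ominus>\<^bsub>hecke \<mu>\<^esub> hecke_z 1 1"
proof -
  have "convolution \<mu> S1 S2 g = hecke_z 1 1 g" for g
  proof -
    have "convolution \<mu> S1 S2 g = hecke_const 1 (zpair 0 (- 1) * (g * zpair (- 1) 0))"
      unfolding S1_eq S2_eq by (subst hecke_z_convolution[OF hecke_z_carrier]) (simp add: hecke_z_eq)
    also have "zpair 0 (- 1) * (g * zpair (- 1) 0) = zpair (- 1) (- 1) * g"
      unfolding zpair_commute[of "- 1" 0 g, symmetric] mult.assoc[symmetric] zpair_add by simp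
    finally show ?thesis by (simp add: hecke_z_eq)
  qed
  then have "convolution \<mu> S1 S2 = hecke_z 1 1" by (rule ext)
  then show ?thesis by (simp add: one_minus_S_def)
qed

lemma one_minus_S_carrier: "one_minus_S \<mu> \<in> hecke_carrier"
proof -
  interpret R: ring "hecke \<mu>" by (rule ring_hecke)
  show ?thesis
    using R.minus_closed[of "hecke_const 1" "hecke_z 1 1"]
    by (simp add: one_minus_S_eq hecke_z_carrier hecke_const_carrier)
qed

lemma one_minus_S_action:
  assumes "rinv f"
  shows "hecke_action \<mu> (one_minus_S \<mu>) f = (\<lambda>g. f g - zshift 1 1 f g)"
proof -
  have "one_minus_S \<mu> = (\<lambda>g. hecke_const 1 g + (- 1) * hecke_z 1 1 g)"
    by (simp add: one_minus_S_eq a_minus_def hecke_a_inv[OF hecke_z_carrier])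
  moreover have "hecke_action \<mu> (\<lambda>g. hecke_const 1 g + (- 1) * hecke_z 1 1 g) f =
      (\<lambda>g. hecke_action \<mu> (hecke_const 1) f g + hecke_action \<mu> (\<lambda>g. (- 1) * hecke_z 1 1 g) f g)"
    using assms by (intro hecke_action_add_left hecke_scale_carrier hecke_z_carrier hecke_const_carrier)
      (simp_all add: Z_inv_uminus)
  ultimately show ?thesis
    unfolding hecke_action_scale_left hecke_action_const[OF assms] hecke_action_z[OF assms] by simp
qed

text \<open>Convolving with \<open>hecke_z\<close> on either side translates by a central element of
  the group; the right-hand side is computed through the dual.\<close>

lemma hecke_z_central:
  assumes \<theta>: "\<theta> \<in> hecke_carrier"
  shows "convolution \<mu> (hecke_z m n) \<theta> = convolution \<mu> \<theta> (hecke_z m n)"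
proof -
  have "hecke_dual (convolution \<mu> \<theta> (hecke_const 1)) = hecke_action \<mu> \<theta> (hecke_dual (hecke_const 1))"
    by (rule hecke_dual_convolution)
  then have a: "hecke_action \<mu> \<theta> (hecke_const 1) = hecke_dual \<theta>"
    by (simp add: hecke_dual_const convolution_const_right[OF \<theta> Z_inv_1])
  have z: "hecke_dual (hecke_z m n) = zshift m n (hecke_const 1 :: 'p Gp \<Rightarrow> real)"
    by (rule ext) (simp add: hecke_dual_z hecke_z_eq zshift_def zpair_commute)
  have "hecke_dual (convolution \<mu> \<theta> (hecke_z m n)) = zshift m n (hecke_dual \<theta>)"
    unfolding hecke_dual_convolution z hecke_action_zshift a ..
  then have "convolution \<mu> \<theta> (hecke_z m n) g = zshift m n (hecke_dual \<theta>) (inverse g)" for g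
    by (metis hecke_dual_def Gp_inverse(5))
  also have "zshift m n (hecke_dual \<theta>) (inverse g) = \<theta> (g * zpair (- m) (- n))" for g
    by (simp add: zshift_def hecke_dual_def Gp_inverse_mult zpair_inverse zpair_commute)
  finally show ?thesis by (intro ext) (simp add: hecke_z_convolution[OF \<theta>])
qed

lemma one_minus_S_central:
  assumes \<theta>: "\<theta> \<in> carrier (hecke \<mu>)"
  shows "one_minus_S \<mu> \<otimes>\<^bsub>hecke \<mu>\<^esub> \<theta> = \<theta> \<otimes>\<^bsub>hecke \<mu>\<^esub> one_minus_S \<mu>"
proof -
  interpret R: ring "hecke \<mu>" by (rule ring_hecke)
  have z: "hecke_z 1 1 \<in> carrier (hecke \<mu>)" by (simp add: hecke_z_carrier)
  have "hecke_z 1 1 \<otimes>\<^bsub>hecke \<mu>\<^esub> \<theta> = \<theta> \<otimes>\<^bsub>hecke \<mu>\<^esub> hecke_z 1 1"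
    using \<theta> by (simp add: hecke_z_central)
  moreover have "one_minus_S \<mu> = \<one>\<^bsub>hecke \<mu>\<^esub> \<ominus>\<^bsub>hecke \<mu>\<^esub> hecke_z 1 1" by (simp add: one_minus_S_eq)
  ultimately show ?thesis
    using \<theta> z by (simp add: a_minus_def R.l_distr R.r_distr R.l_minus R.r_minus del: hecke_sel)
qed

text \<open>The difference of \<open>f\<close> and \<open>h\<close> is invariant under the shift by
  S_p, so a nonzero value would be repeated on the infinitely many orbits
  \<open>(n + k, m + k, i, j)\<close>.\<close>

lemma one_minus_S_regular:
  assumes f: "f \<in> carrier (Cc \<mu>)" and h: "h \<in> carrier (Cc \<mu>)"
    and eq: "hecke_action \<mu> (one_minus_S \<mu>) f = hecke_action \<mu> (one_minus_S \<mu>) h"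
  shows "f = h"
proof (rule ext, rule ccontr)
  fix g assume g: "f g \<noteq> h g"
  have "f x - zshift 1 1 f x = h x - zshift 1 1 h x" for x
    using eq unfolding one_minus_S_action[OF carrier_Cc_rinv[OF f]] one_minus_S_action[OF carrier_Cc_rinv[OF h]]
    by (rule fun_cong)
  then have step: "f (x * zpair 1 1) - h (x * zpair 1 1) = f x - h x" for x
    unfolding zshift_def by (simp add: algebra_simps)
  have shift: "f (g * zpair (int k) (int k)) - h (g * zpair (int k) (int k)) = f g - h g" for k
  proof (induction k)
    case (Suc k)
    have "g * zpair (int (Suc k)) (int (Suc k)) = g * zpair (int k) (int k) * zpair 1 1"
      by (simp add: mult.assoc zpair_add add.commute)
    then show ?case using step Suc by simp
  qed simp
  obtain n m i j where o: "orb g = (n, m, i, j)" by (rule prod_cases4)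
  let ?F = "orb ` {x. f x \<noteq> 0} \<union> orb ` {x. h x \<noteq> 0}"
  have "(\<lambda>k. (n + int k, m + int k, i, j)) ` UNIV \<subseteq> ?F"
  proof (rule image_subsetI)
    fix k
    let ?x = "g * zpair (int k) (int k)"
    have "f ?x \<noteq> 0 \<or> h ?x \<noteq> 0" using shift[of k] g by linarith
    then have "orb ?x \<in> ?F" by (elim disjE) (simp_all add: imageI)
    then show "(n + int k, m + int k, i, j) \<in> ?F" using orb_zpair[OF o] by simp
  qed
  moreover have "finite ?F" using f h by (simp add: carrier_Cc_iff)
  ultimately have "finite ((\<lambda>k. (n + int k, m + int k, i, j)) ` (UNIV :: nat set))" by (rule finite_subset)
  then have "finite (UNIV :: nat set)" by (rule finite_imageD) (simp add: inj_on_def)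
  then show False by simp
qed

lemma hecke_action_f0_cancel:
  assumes a: "a \<in> hecke_carrier" and b: "b \<in> hecke_carrier"
    and eq: "hecke_action \<mu> a f0 = hecke_action \<mu> b f0"
  shows "a = b"
proof -
  let ?b = "\<lambda>g. (- 1) * b g"
  have b': "?b \<in> hecke_carrier" by (rule hecke_scale_carrier[OF b]) (simp add: Z_inv_uminus)
  have "hecke_action \<mu> (\<lambda>g. a g + ?b g) f0 = (\<lambda>_. 0)"
    unfolding hecke_action_add_left[OF a b' rinv_f0] hecke_action_scale_left eq by simp
  then have "(\<lambda>g. a g + ?b g) = (\<lambda>_. 0)"
    by (rule hecke_action_f0_inj[OF hecke_add_carrier[OF a b']])
  then show ?thesis by (simp add: fun_eq_iff)
qed

text \<open>Regularity is transported from functions to the Hecke algebra along the injective map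
  that applies an element to \<open>f0\<close>.\<close>

lemma one_minus_S_regular_hecke:
  assumes a: "a \<in> hecke_carrier" and b: "b \<in> hecke_carrier"
    and eq: "convolution \<mu> (one_minus_S \<mu>) a = convolution \<mu> (one_minus_S \<mu>) b"
  shows "a = b"
proof (rule hecke_action_f0_cancel[OF a b], rule one_minus_S_regular)
  show "hecke_action \<mu> (one_minus_S \<mu>) (hecke_action \<mu> a f0) =
      hecke_action \<mu> (one_minus_S \<mu>) (hecke_action \<mu> b f0)"
    using eq by (simp add: hecke_action_convolution[OF one_minus_S_carrier _ rinv_f0, symmetric] a b)
qed (intro Cc_action_carrier a b f0_carrier_Cc)+

lemma central_localization_Cc: "central_localization_both (hecke \<mu>) (Cc \<mu>) (one_minus_S \<mu>)"
proof -
  interpret R: ring "hecke \<mu>" by (rule ring_hecke)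
  show ?thesis
  proof unfold_locales
    show "\<zero>\<^bsub>Cc \<mu>\<^esub> \<in> carrier (Cc \<mu>)" by (simp add: carrier_Cc_iff orbit_fun_zero)
    show "one_minus_S \<mu> \<otimes>\<^bsub>hecke \<mu>\<^esub> a = a \<otimes>\<^bsub>hecke \<mu>\<^esub> one_minus_S \<mu>" if "a \<in> carrier (hecke \<mu>)" for a
      using that by (rule one_minus_S_central)
    show "f = h"
      if "f \<in> carrier (Cc \<mu>)" "h \<in> carrier (Cc \<mu>)"
        "one_minus_S \<mu> \<odot>\<^bsub>Cc \<mu>\<^esub> f = one_minus_S \<mu> \<odot>\<^bsub>Cc \<mu>\<^esub> h" for f h
      using that unfolding Cc_sel by (rule one_minus_S_regular)
    show "a = b"
      if "a \<in> carrier (hecke \<mu>)" "b \<in> carrier (hecke \<mu>)"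
        "one_minus_S \<mu> \<otimes>\<^bsub>hecke \<mu>\<^esub> a = one_minus_S \<mu> \<otimes>\<^bsub>hecke \<mu>\<^esub> b" for a b
      using that unfolding hecke_sel by (rule one_minus_S_regular_hecke)
  qed (simp_all add: one_minus_S_carrier Cc_add_carrier Cc_action_carrier hecke_action_add_right
      hecke_action_convolution hecke_action_const carrier_Cc_rinv)
qed

text \<open>\<open>f\<close> is the finite sum of its restrictions to orbits, each a multiple of a
  shifted orbit function.\<close>

lemma good_Cc1:
  assumes f: "f \<in> Cc1 \<mu>"
  shows "good gen_ideal f"
proof -
  have fc: "f \<in> carrier (Cc \<mu>)"
    and ft: "\<And>g. g \<in> centre_torus \<Longrightarrow> f g \<in> (\<lambda>x. (of_nat CARD('p) - 1) * x) ` Z_inv CARD('p)"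
    using f unfolding Cc1_def by simp_all
  have f': "\<And>g. f g \<in> Z_inv CARD('p)" "orbit_fun f" "finite (orb ` {g. f g \<noteq> 0})"
    using fc by (simp_all add: carrier_Cc_iff)
  have "good gen_ideal (\<lambda>g. of_bool (orb g = t) * f g)" if t: "t \<in> orb ` {g. f g \<noteq> 0}" for t
  proof -
    obtain g0 :: "'p Gp" where g0: "t = orb g0" using t by (metis imageE)
    obtain n m i j where o: "orb g0 = (n, m, i, j)" by (rule prod_cases4)
    have pos: "0 \<le> i" "0 \<le> j" using orbit_equiv_orep[OF o] by blast+
    have "good gen_ideal (\<lambda>g. f g0 * orb_ind 0 0 i j g)"
    proof (cases "i = 0 \<or> j = 0")
      case True
      \<comment> \<open>A boundary orbit meets \<open>centre_torus\<close>, so the value of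
        \<open>f\<close> on all of it is a multiple of p - 1, which turns
        \<open>good hecke_carrier\<close> into \<open>good gen_ideal\<close>.\<close>
      obtain h :: "'p Gp" where h: "h \<in> centre_torus" "orb h = orb g0" using orb_centre_torus[OF o True] by (elim bexE)
      obtain r where r: "f h = (real CARD('p) - 1) * r" "r \<in> Z_inv CARD('p)" using ft[OF h(1)] by auto
      have "good hecke_carrier (orb_ind 0 0 i j)"
        using True pos good_axis(1)[of "nat i"] good_axis(2)[of "nat j"] by auto
      then have "good gen_ideal (\<lambda>g. (real CARD('p) - 1) * (r * orb_ind 0 0 i j g))"
        by (intro good_gen_ideal_p_minus_1 good_scale left_ideal_carrier r(2))
      then show ?thesis using r(1) orbit_fun_orb[OF f'(2) h(2)] by (simp add: mult.assoc)
    next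
      case False
      then have "good gen_ideal (orb_ind 0 0 i j)"
        using pos good_interior[of "nat (i - 1)" "nat (j - 1)"] by simp
      then show ?thesis by (intro good_scale left_ideal_gen_ideal f'(1))
    qed
    then have "good gen_ideal (\<lambda>g. f g0 * orb_ind n m i j g)"
      by (rule good_orb_ind_shift[OF left_ideal_gen_ideal])
    moreover have "f g0 * orb_ind n m i j g = of_bool (orb g = t) * f g" for g
      using orbit_fun_orb[OF f'(2), of g g0] by (simp add: orb_ind_def g0 o)
    ultimately show ?thesis by simp
  qed
  then have "good gen_ideal (\<lambda>g. \<Sum>t\<in>orb ` {g. f g \<noteq> 0}. of_bool (orb g = t) * f g)"
    by (intro good_sum left_ideal_gen_ideal f'(3))
  moreover have "(\<Sum>t\<in>orb ` {g. f g \<noteq> 0}. of_bool (orb g = t) * f g) = f g" for g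
  proof (cases "f g = 0")
    case False
    then have "orb g \<in> orb ` {g. f g \<noteq> 0}" by (intro imageI) simp
    then show ?thesis using f'(3) by (simp add: of_bool_def if_distrib[of "\<lambda>x. x * _"] cong: if_cong)
  qed simp
  ultimately show ?thesis by simp
qed

lemma Cc1_coefficient:
  assumes "f \<in> Cc1 \<mu>"
  shows "\<exists>a\<in>gen_ideal. hecke_action \<mu> (one_minus_S \<mu>) f = hecke_action \<mu> a f0"
  using good_Cc1[OF assms] unfolding good_def by (simp add: one_minus_S_action)

lemma gen_idealE:
  assumes "a \<in> gen_ideal"
  obtains x y where "x \<in> hecke_carrier" "y \<in> hecke_carrier"
    "a = x \<otimes>\<^bsub>hecke \<mu>\<^esub> hecke_const (of_nat CARD('p) - 1) \<oplus>\<^bsub>hecke \<mu>\<^esub> y \<otimes>\<^bsub>hecke \<mu>\<^esub> hecke_dual (hecke_poly_at_1 \<mu>)"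
proof -
  obtain x y where "x \<in> hecke_carrier" "y \<in> hecke_carrier"
    "a = (\<lambda>g. (real CARD('p) - 1) * x g + convolution \<mu> y (hecke_dual (hecke_poly_at_1 \<mu>)) g)"
    using assms unfolding gen_ideal_def mem_Collect_eq by (elim exE conjE)
  then show thesis
    by (intro that[of x y]) (simp_all add: convolution_const_right Z_inv_card)
qed

lemma gen_ideal_subset_Idl: "gen_ideal \<subseteq> Idl\<^bsub>hecke \<mu>\<^esub> (ideal_gens \<mu>)"
proof (rule subsetI)
  fix a assume "a \<in> gen_ideal"
  then obtain x y where xy: "x \<in> hecke_carrier" "y \<in> hecke_carrier"
    "a = x \<otimes>\<^bsub>hecke \<mu>\<^esub> hecke_const (of_nat CARD('p) - 1) \<oplus>\<^bsub>hecke \<mu>\<^esub> y \<otimes>\<^bsub>hecke \<mu>\<^esub> hecke_dual (hecke_poly_at_1 \<mu>)"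
    by (rule gen_idealE)
  have "a \<in> I" if I: "ideal I (hecke \<mu>)" and g: "ideal_gens \<mu> \<subseteq> I" for I
  proof -
    interpret I: ideal I "hecke \<mu>" by (rule I)
    have "hecke_const (of_nat CARD('p) - 1) \<in> I" "hecke_dual (hecke_poly_at_1 \<mu>) \<in> I"
      using g by (simp_all add: ideal_gens_def)
    then show ?thesis
      unfolding xy(3) by (intro additive_subgroup.a_closed[OF I.is_additive_subgroup] I.I_l_closed) (simp_all only: hecke_sel xy)
  qed
  then show "a \<in> Idl\<^bsub>hecke \<mu>\<^esub> (ideal_gens \<mu>)" unfolding genideal_def by simp
qed

lemma Cc1_loc_coefficient:
  assumes f: "f \<in> Cc1_loc \<mu>"
  shows "\<exists>a\<in>gen_ideal. \<exists>k. f = loc_frac (hecke \<mu>) (Cc \<mu>) (one_minus_S \<mu>) (a \<odot>\<^bsub>Cc \<mu>\<^esub> f0) k"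
proof -
  interpret L: central_localization_both "hecke \<mu>" "Cc \<mu>" "one_minus_S \<mu>" by (rule central_localization_Cc)
  have J: "gen_ideal \<subseteq> hecke_carrier" "(\<lambda>_. 0) \<in> gen_ideal"
    "\<And>a b. a \<in> gen_ideal \<Longrightarrow> b \<in> gen_ideal \<Longrightarrow> (\<lambda>g. a g + b g) \<in> gen_ideal"
    "\<And>r a. r \<in> hecke_carrier \<Longrightarrow> a \<in> gen_ideal \<Longrightarrow> convolution \<mu> r a \<in> gen_ideal"
    using left_ideal_gen_ideal unfolding left_ideal_def by simp_all
  have m1: "\<ominus>\<^bsub>hecke \<mu>\<^esub> \<one>\<^bsub>hecke \<mu>\<^esub> = (\<lambda>g. (- 1) * hecke_const 1 g)"
    by (simp add: hecke_a_inv hecke_const_carrier)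
  have neg: "h = hecke_action \<mu> (\<lambda>g. (- 1) * hecke_const 1 g) f"
    if f: "f \<in> carrier (Cc \<mu>)" and 0: "(\<lambda>g. f g + h g) = (\<lambda>_. 0)" for f h
    unfolding hecke_action_scale_left hecke_action_const[OF carrier_Cc_rinv[OF f]]
    using fun_cong[OF 0] by (intro ext) (simp add: add_eq_0_iff)
  have zero: "hecke_action \<mu> (\<lambda>_. 0) f0 = (\<lambda>_. 0)"
    using hecke_action_scale_left[of 0 "\<lambda>_. 0" f0] by simp
  have sub: "Cc1 \<mu> \<subseteq> carrier (Cc \<mu>)" unfolding Cc1_def by simp
  show ?thesis
  proof (rule L.generated_coefficient[where A = "Cc1 \<mu>"])
    show "f \<in> generated_submodule (loc_ring (hecke \<mu>) (one_minus_S \<mu>)) (loc_module (hecke \<mu>) (Cc \<mu>) (one_minus_S \<mu>))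
        ((\<lambda>m. L.mfrac m 0) ` Cc1 \<mu>)"
      using f unfolding Cc1_loc_def hecke_loc_def Cc_loc_def to_Cc_loc_def .
    show "h = (\<ominus>\<^bsub>hecke \<mu>\<^esub> \<one>\<^bsub>hecke \<mu>\<^esub>) \<odot>\<^bsub>Cc \<mu>\<^esub> f"
      if "f \<in> carrier (Cc \<mu>)" "h \<in> carrier (Cc \<mu>)" "f \<oplus>\<^bsub>Cc \<mu>\<^esub> h = \<zero>\<^bsub>Cc \<mu>\<^esub>" for f h
      using that neg unfolding m1 by simp
    show "(a \<oplus>\<^bsub>hecke \<mu>\<^esub> b) \<odot>\<^bsub>Cc \<mu>\<^esub> m = a \<odot>\<^bsub>Cc \<mu>\<^esub> m \<oplus>\<^bsub>Cc \<mu>\<^esub> b \<odot>\<^bsub>Cc \<mu>\<^esub> m"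
      if "a \<in> carrier (hecke \<mu>)" "b \<in> carrier (hecke \<mu>)" "m \<in> carrier (Cc \<mu>)" for a b m
      using that by (simp add: hecke_action_add_left carrier_Cc_rinv)
    show "f0 \<in> carrier (Cc \<mu>)" by (rule f0_carrier_Cc)
  qed (use J sub Cc1_coefficient zero in simp_all)
qed

end

theorem theorem4p23:
  fixes \<mu> :: "'p::prime_card Gp measure"
    and f :: "(('p Gp \<Rightarrow> real) \<times> nat) set"
  assumes "haar_measure \<mu>"
    and "f \<in> Cc1_loc \<mu>"
  shows "(\<exists>!P. P \<in> carrier (hecke_loc \<mu>) \<and> P \<odot>\<^bsub>Cc_loc \<mu>\<^esub> to_Cc_loc \<mu> f0 = f) \<and>
    f = P_loc \<mu> f \<odot>\<^bsub>Cc_loc \<mu>\<^esub> to_Cc_loc \<mu> f0 \<and>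
    P_loc \<mu> f \<in> Idl\<^bsub>hecke_loc \<mu>\<^esub> (to_hecke_loc \<mu> ` ideal_gens \<mu>) \<and>
    (\<forall>f1\<in>Cc1 \<mu>. f = to_Cc_loc \<mu> (one_minus_S \<mu> \<odot>\<^bsub>Cc \<mu>\<^esub> f1) \<longrightarrow>
       P_loc \<mu> f \<in> to_hecke_loc \<mu> ` (Idl\<^bsub>hecke \<mu>\<^esub> (ideal_gens \<mu>)))"
proof -
  interpret haar \<mu> by unfold_locales (rule assms(1))
  interpret L: central_localization_both "hecke \<mu>" "Cc \<mu>" "one_minus_S \<mu>" by (rule central_localization_Cc)
  note defs = hecke_loc_def Cc_loc_def to_Cc_loc_def to_hecke_loc_def
  have "gen_ideal \<subseteq> carrier (hecke \<mu>)"
    using left_ideal_gen_ideal unfolding left_ideal_def hecke_sel by (elim conjE)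
  then have gc: "a \<in> carrier (hecke \<mu>)" if "a \<in> gen_ideal" for a
    using that by (rule subsetD)
  have cancel: "a = b" if "a \<in> carrier (hecke \<mu>)" "b \<in> carrier (hecke \<mu>)" "a \<odot>\<^bsub>Cc \<mu>\<^esub> f0 = b \<odot>\<^bsub>Cc \<mu>\<^esub> f0" for a b
    by (rule hecke_action_f0_cancel) (use that in simp_all)
  have sol: "L.rfrac a k \<in> carrier (hecke_loc \<mu>)" "L.rfrac a k \<odot>\<^bsub>Cc_loc \<mu>\<^esub> to_Cc_loc \<mu> f0 = L.mfrac (a \<odot>\<^bsub>Cc \<mu>\<^esub> f0) k"
    if "a \<in> gen_ideal" for a k
  proof -
    show "L.rfrac a k \<in> carrier (hecke_loc \<mu>)"
      unfolding defs L.loc_ring_sel mem_Collect_eq using gc[OF that] by (intro exI conjI) (rule refl)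
    show "L.rfrac a k \<odot>\<^bsub>Cc_loc \<mu>\<^esub> to_Cc_loc \<mu> f0 = L.mfrac (a \<odot>\<^bsub>Cc \<mu>\<^esub> f0) k"
      unfolding defs using L.loc_module_smult[OF gc[OF that] f0_carrier_Cc, of k 0] by (simp only: add_0_right)
  qed
  have uniq: "P = L.rfrac a k"
    if "a \<in> gen_ideal" "P \<in> carrier (hecke_loc \<mu>)" "P \<odot>\<^bsub>Cc_loc \<mu>\<^esub> to_Cc_loc \<mu> f0 = L.mfrac (a \<odot>\<^bsub>Cc \<mu>\<^esub> f0) k" for a k P
  proof (rule L.coefficient_unique[OF f0_carrier_Cc cancel])
    show "P \<in> carrier (loc_ring (hecke \<mu>) (one_minus_S \<mu>))" using that(2) unfolding defs .
    show "P \<odot>\<^bsub>loc_module (hecke \<mu>) (Cc \<mu>) (one_minus_S \<mu>)\<^esub> L.mfrac f0 0 = L.mfrac (a \<odot>\<^bsub>Cc \<mu>\<^esub> f0) k"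
      using that(3) unfolding defs .
  qed (assumption | rule gc[OF that(1)])+
  have P_loc: "P_loc \<mu> (L.mfrac (a \<odot>\<^bsub>Cc \<mu>\<^esub> f0) k) = L.rfrac a k" if "a \<in> gen_ideal" for a k
    unfolding P_loc_def by (rule the_equality, rule conjI[OF sol[OF that]], elim conjE, rule uniq[OF that])
  obtain a k where a: "a \<in> gen_ideal" and f: "f = L.mfrac (a \<odot>\<^bsub>Cc \<mu>\<^esub> f0) k"
    using Cc1_loc_coefficient[OF assms(2)] by (elim bexE exE)
  obtain x y where xy: "x \<in> hecke_carrier" "y \<in> hecke_carrier"
    "a = x \<otimes>\<^bsub>hecke \<mu>\<^esub> hecke_const (of_nat CARD('p) - 1) \<oplus>\<^bsub>hecke \<mu>\<^esub> y \<otimes>\<^bsub>hecke \<mu>\<^esub> hecke_dual (hecke_poly_at_1 \<mu>)"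
    using a by (rule gen_idealE)
  show ?thesis
  proof (intro conjI ballI impI)
    show "\<exists>!P. P \<in> carrier (hecke_loc \<mu>) \<and> P \<odot>\<^bsub>Cc_loc \<mu>\<^esub> to_Cc_loc \<mu> f0 = f"
      unfolding f by (rule ex1I, rule conjI[OF sol[OF a]], elim conjE, rule uniq[OF a])
    show "f = P_loc \<mu> f \<odot>\<^bsub>Cc_loc \<mu>\<^esub> to_Cc_loc \<mu> f0"
      unfolding f P_loc[OF a] sol(2)[OF a] ..
    \<comment> \<open>The generated ideal is an intersection, so membership is tested in each ideal
      that contains the generators.\<close>
    have "L.rfrac a k \<in> I" if I: "ideal I (hecke_loc \<mu>)" and g: "to_hecke_loc \<mu> ` ideal_gens \<mu> \<subseteq> I" for I
      unfolding xy(3)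
    proof (rule L.rfrac_in_ideal)
      show "ideal I (loc_ring (hecke \<mu>) (one_minus_S \<mu>))" using I unfolding defs .
      show "L.rfrac (hecke_const (of_nat CARD('p) - 1)) 0 \<in> I" "L.rfrac (hecke_dual (hecke_poly_at_1 \<mu>)) 0 \<in> I"
        using g unfolding defs ideal_gens_def by simp_all
    qed (simp_all add: xy dual_poly_carrier hecke_const_carrier Z_inv_card)
    then show "P_loc \<mu> f \<in> Idl\<^bsub>hecke_loc \<mu>\<^esub> (to_hecke_loc \<mu> ` ideal_gens \<mu>)"
      unfolding f P_loc[OF a] genideal_def by simp
    fix f1 assume f1: "f1 \<in> Cc1 \<mu>" and eq: "f = to_Cc_loc \<mu> (one_minus_S \<mu> \<odot>\<^bsub>Cc \<mu>\<^esub> f1)"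
    \<comment> \<open>Here \<open>f\<close> is a fraction with trivial denominator whose numerator
      is \<open>b\<close> applied to \<open>f0\<close>, and by uniqueness
      \<open>P_loc \<mu> f\<close> is the image of \<open>b\<close>.\<close>
    obtain b where b: "b \<in> gen_ideal" "hecke_action \<mu> (one_minus_S \<mu>) f1 = hecke_action \<mu> b f0"
      using Cc1_coefficient[OF f1] by (elim bexE)
    have "P_loc \<mu> f = to_hecke_loc \<mu> b"
      unfolding eq defs using b P_loc[OF b(1), of 0] by simp
    then show "P_loc \<mu> f \<in> to_hecke_loc \<mu> ` (Idl\<^bsub>hecke \<mu>\<^esub> (ideal_gens \<mu>))"
      using subsetD[OF gen_ideal_subset_Idl b(1)] by (rule image_eqI)
  qed
qed

end
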